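(* Let $p$ be a prime and let $c$ be an integer. Then \[ \sum_{\substack{r\in\mathbb{Z},\ |r|<2\sqrt p,\\ r\equiv c\pmod 5}}H(4p-r^2)= \begin{cases} \frac{p-1}{2},&\text{if } c\equiv\pm(p+1)\pmod 5 \text{ and } p\equiv\pm 2\pmod 5,\\ \frac{p-3}{2},&\text{if } c\equiv 0\pmod 5 \text{ and } p\equiv 4\pmod 5. \end{cases} \]
   Context: $H(N)$ denotes the Hurwitz class number: for an integer $N\ge 0$, $H(0)=-1/12$; $H(N)=0$ if $N\equiv 1,2\pmod 4$; otherwise $H(N)$ is the number of $\mathrm{SL}_2(\mathbb{Z})$-equivalence classes of (not necessarily primitive) positive definite binary quadratic forms of discriminant $-N$, where classes containing a multiple of $x^2+y^2$ are counted with weight $1/2$ and classes containing a multiple of $x^2+xy+y^2$ are counted with weight $1/3$. The sum runs over all integers $r$ (positive, negative and zero) satisfying the stated conditions. *)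

theory Defs
  imports "HOL-Number_Theory.Number_Theory"
begin

text \<open>Binary quadratic forms a x^2 + b x y + c y^2 are represented as triples (a,b,c).\<close>

type_synonym qform = "int \<times> int \<times> int"

definition pd_forms :: "int \<Rightarrow> qform set" where
  "pd_forms N = {(a, b, c). a > 0 \<and> b^2 - 4*a*c = - N}"

text \<open>Action of the matrix (al, be; ga, de): f(x,y) maps to f(al x + be y, ga x + de y).\<close>
definition form_act :: "int \<Rightarrow> int \<Rightarrow> int \<Rightarrow> int \<Rightarrow> qform \<Rightarrow> qform" where
  "form_act al be ga de f = (case f of (a, b, c) \<Rightarrow>
     (a*al^2 + b*al*ga + c*ga^2,
      2*a*al*be + b*(al*de + be*ga) + 2*c*ga*de,
      a*be^2 + b*be*de + c*de^2))"

definition sl2_equiv :: "int \<Rightarrow> (qform \<times> qform) set" where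
  "sl2_equiv N = {(f, g). f \<in> pd_forms N \<and> g \<in> pd_forms N \<and>
      (\<exists>al be ga de. al*de - be*ga = 1 \<and> g = form_act al be ga de f)}"

definition form_classes :: "int \<Rightarrow> qform set set" where
  "form_classes N = pd_forms N // sl2_equiv N"

definition class_weight :: "qform set \<Rightarrow> real" where
  "class_weight C = (if \<exists>k. (k, 0, k) \<in> C then 1/2
                     else if \<exists>k. (k, k, k) \<in> C then 1/3 else 1)"

definition hurwitz :: "int \<Rightarrow> real" where
  "hurwitz N = (if N = 0 then - 1/12
                else if N < 0 \<or> N mod 4 = 1 \<or> N mod 4 = 2 then 0
                else (\<Sum>C\<in>form_classes N. class_weight C))"

end

theory Submission
  imports Defs "HOL-Library.Groups_Big_Fun"
begin

text \<open>
  The sum counts, up to conjugation by \<open>\<Gamma> = SL\<^sub>2(\<int>)\<close>, the elliptic integer matrices of determinant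
  \<open>p\<close> and trace \<open>\<equiv> p + 1\<close>, that is, those with a fixed vector modulo 5. It is evaluated by a Lefschetz
  fixed point formula for the Hecke correspondence \<open>T\<^sub>p\<close> on the modular curve \<open>X\<^sub>1(5)\<close>, carried out
  combinatorially on the tree dual to the Farey tessellation.

  A matrix \<open>M\<close> moves the centre of a Farey triangle to a point of the upper half plane, and each
  triangle that does not contain the image of its own centre gets an arrow across the side behind
  which that image lies. The number of triangles without an arrow plus the number of edges with two
  arrows minus the number of edges without arrows is insensitive to finite changes of the arrows.
  Directing the arrows at the fixed point of \<open>M\<close> instead shows that, per conjugacy class, this number is
  the Hurwitz weight for elliptic \<open>M\<close>, 0 for hyperbolic \<open>M\<close> with irrational fixed points and \<open>-1\<close> for \<open>M\<close>
  with rational fixed points.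

  Summed over all \<open>M\<close> together with their fixed vectors modulo 5, the number becomes the difference of
  the traces of two operators acting on the vertices and on the edges of the quotient graph. They
  commute with the boundary map, so the difference is the trace on constants minus the trace on
  \<open>H\<^sup>1\<close>. As \<open>X\<^sub>1(5)\<close> has genus 0, \<open>H\<^sup>1\<close> is detected by the loops around the cusps, on which only
  triangular matrices contribute.\<close>

subsection \<open>Reduction of binary quadratic forms\<close>

text \<open>In PSL2(Z) a Farey triangle has a stabiliser of order 3 and a side one of order 2. So
  each class of definite forms is given a third of the number of its forms with root in a fixed
  closed triangle, minus half the number with root on a fixed side; this is exactly its Hurwitz
  weight. All sums run over integer matrices of determinant p and need finite support. The arrows
  lack it, but \<open>fixv\<close> and \<open>inde\<close> have it for all traces at once, whereas
  redirecting the arrows is a finite change only for a fixed trace. For odd p the number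
  \<open>sg\<close> is odd, so no image of a centre lies on a side; p = 2 is settled by the single
  value H(4). M and -M are both counted, which doubles the numbers. If p is not 0 or 1 modulo 5, a
  matrix of trace p + 1 modulo 5 has the distinct eigenvalues 1 and p there, hence exactly 4 nonzero
  fixed vectors. The traces p + 1 and -(p + 1) each contribute -(p - 1); they agree modulo 5 exactly
  for p = 4 modulo 5, which is why that case has its own formula.\<close>

definition selling :: "qform \<Rightarrow> bool" where
  "selling f = (case f of (a, b, c) \<Rightarrow> b \<le> 0 \<and> 0 \<le> 2*a + b \<and> 0 \<le> 2*c + b)"

text \<open>Sum of the values at e1, e2 and e1 + e2. The condition \<open>selling\<close> says that
  e1, e2, -(e1 + e2) is an obtuse superbase; equivalently, the root of a positive definite form lies
  in the closed Farey triangle with vertices 0, 1, infinity.\<close>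

definition superbase_sum :: "qform \<Rightarrow> int" where
  "superbase_sum f = (case f of (a, b, c) \<Rightarrow> 2*a + 2*c + b)"

text \<open>\<open>rot\<close> permutes the superbase cyclically; \<open>flip\<close> passes to the
  superbase of the triangle across the side from 0 to infinity.\<close>

definition rot :: "qform \<Rightarrow> qform" where
  "rot f = (case f of (a, b, c) \<Rightarrow> (c, - 2*c - b, a + b + c))"

definition flip :: "qform \<Rightarrow> qform" where
  "flip f = (case f of (a, b, c) \<Rightarrow> (c, - b, a))"

lemma form_act_comp:
  "form_act al' be' ga' de' (form_act al be ga de f) =
   form_act (al*al' + be*ga') (al*be' + be*de') (ga*al' + de*ga') (ga*be' + de*de') f"
  by (cases f) (simp add: form_act_def algebra_simps power2_eq_square)

lemma form_act_id: "form_act 1 0 0 1 f = f"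
  by (cases f) (simp add: form_act_def)

lemma form_act_inverse:
  assumes "al*de - be*ga = 1"
  shows "form_act de (-be) (-ga) al (form_act al be ga de f) = f"
proof -
  have "al*de + be*(-ga) = 1" "al*(-be) + be*al = 0" "ga*de + de*(-ga) = 0" "ga*(-be) + de*al = 1"
    using assms by (auto simp: algebra_simps)
  then show ?thesis
    by (simp only: form_act_comp form_act_id)
qed

lemma form_act_pd:
  assumes "f \<in> pd_forms N" "N > 0" "al*de - be*ga = 1"
  shows "form_act al be ga de f \<in> pd_forms N"
proof -
  obtain a b c where f: "f = (a,b,c)" by (cases f)
  have a: "a > 0" and d: "b^2 - 4*a*c = -N" using assms by (auto simp: pd_forms_def f)
  define a' where "a' = a*al^2 + b*al*ga + c*ga^2"
  define b' where "b' = 2*a*al*be + b*(al*de + be*ga) + 2*c*ga*de"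
  define c' where "c' = a*be^2 + b*be*de + c*de^2"
  have "4*a*a' = (2*a*al + b*ga)^2 - (b^2 - 4*a*c)*ga^2"
    unfolding a'_def by (simp add: algebra_simps power2_eq_square)
  then have "4*a*a' = (2*a*al + b*ga)^2 + N*ga^2" using d by simp
  moreover have "(2*a*al + b*ga)^2 + N*ga^2 > 0"
  proof (cases "ga = 0")
    case True
    then have "al \<noteq> 0" using assms(3) by auto
    then show ?thesis using True a by simp
  next
    case False
    then have "N*ga^2 > 0" using assms(2) by simp
    then show ?thesis by (meson add_nonneg_pos zero_le_power2)
  qed
  ultimately have a': "a' > 0" using a
    by (metis mult_pos_pos zero_less_mult_pos zero_less_numeral)
  have "b'^2 - 4*a'*c' = (b^2 - 4*a*c) * (al*de - be*ga)^2"
    unfolding a'_def b'_def c'_def by (simp add: algebra_simps power2_eq_square)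
  then have "b'^2 - 4*a'*c' = -N" using d assms(3) by simp
  with a' show ?thesis by (simp add: pd_forms_def f form_act_def a'_def b'_def c'_def)
qed

lemma sl2_equivI:
  assumes "f \<in> pd_forms N" "N > 0" "al*de - be*ga = 1" "g = form_act al be ga de f"
  shows "(f, g) \<in> sl2_equiv N"
  using assms form_act_pd unfolding sl2_equiv_def by blast

lemma equiv_sl2_equiv: "equiv (pd_forms N) (sl2_equiv N)"
proof (rule equivI)
  show "sl2_equiv N \<subseteq> pd_forms N \<times> pd_forms N" by (auto simp: sl2_equiv_def)
  show "refl_on (pd_forms N) (sl2_equiv N)"
  proof (rule refl_onI)
    fix f assume "f \<in> pd_forms N"
    moreover have "1*1 - 0*0 = (1::int) \<and> f = form_act 1 0 0 1 f" by (simp add: form_act_id)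
    ultimately show "(f, f) \<in> sl2_equiv N" unfolding sl2_equiv_def by blast
  qed
  show "sym (sl2_equiv N)"
  proof (rule symI)
    fix f g assume "(f, g) \<in> sl2_equiv N"
    then obtain al be ga de where h: "f \<in> pd_forms N" "g \<in> pd_forms N"
      "al*de - be*ga = 1" "g = form_act al be ga de f" by (auto simp: sl2_equiv_def)
    have "f = form_act de (-be) (-ga) al g" using form_act_inverse[OF h(3)] h(4) by simp
    moreover have "de*al - (-be)*(-ga) = 1" using h(3) by (simp add: algebra_simps)
    ultimately show "(g, f) \<in> sl2_equiv N" using h unfolding sl2_equiv_def by blast
  qed
  show "trans (sl2_equiv N)"
  proof (rule transI)
    fix f g k assume "(f, g) \<in> sl2_equiv N" "(g, k) \<in> sl2_equiv N"
    then obtain al be ga de al' be' ga' de' where h: "f \<in> pd_forms N" "k \<in> pd_forms N"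
      "al*de - be*ga = 1" "al'*de' - be'*ga' = 1" "g = form_act al be ga de f"
      "k = form_act al' be' ga' de' g" by (auto simp: sl2_equiv_def)
    have "(al*al' + be*ga')*(ga*be' + de*de') - (al*be' + be*de')*(ga*al' + de*ga')
        = (al*de - be*ga)*(al'*de' - be'*ga')" by (simp add: algebra_simps)
    then have "(al*al' + be*ga')*(ga*be' + de*de') - (al*be' + be*de')*(ga*al' + de*ga') = 1"
      using h by simp
    then show "(f, k) \<in> sl2_equiv N" using h form_act_comp unfolding sl2_equiv_def by blast
  qed
qed

lemma rot_equiv: "f \<in> pd_forms N \<Longrightarrow> N > 0 \<Longrightarrow> (f, rot f) \<in> sl2_equiv N"
  by (rule sl2_equivI[where al=0 and be="-1" and ga=1 and de="-1"])
     (auto simp: form_act_def rot_def split: prod.splits)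

lemma flip_equiv: "f \<in> pd_forms N \<Longrightarrow> N > 0 \<Longrightarrow> (f, flip f) \<in> sl2_equiv N"
  by (rule sl2_equivI[where al=0 and be="-1" and ga=1 and de=0])
     (auto simp: form_act_def flip_def split: prod.splits)

lemma sl2_equiv_trans:
  "(f, g) \<in> sl2_equiv N \<Longrightarrow> (g, k) \<in> sl2_equiv N \<Longrightarrow> (f, k) \<in> sl2_equiv N"
  using equiv_sl2_equiv[of N] by (meson equivE transE)

lemma sl2_equiv_pd: "(f, g) \<in> sl2_equiv N \<Longrightarrow> f \<in> pd_forms N \<and> g \<in> pd_forms N"
  by (auto simp: sl2_equiv_def)

lemma pd_c_pos:
  assumes "(a, b, c) \<in> pd_forms N" "N > 0" shows "c > 0"
proof -
  have "4*(a*c) = b^2 + N" "a > 0" using assms by (auto simp: pd_forms_def)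
  then have "4*(a*c) > 0" using assms(2) zero_le_power2[of b] by linarith
  then show ?thesis using \<open>a > 0\<close> by (simp add: zero_less_mult_iff)
qed

lemma superbase_sum_pos:
  assumes "f \<in> pd_forms N" "N > 0" shows "superbase_sum f > 0"
proof -
  obtain a b c where f: "f = (a,b,c)" by (cases f)
  have "form_act 1 1 0 1 f \<in> pd_forms N" using form_act_pd[OF assms, of 1 1 1 0] by simp
  then have "a + b + c > 0" using pd_c_pos assms(2) by (fastforce simp: form_act_def f)
  moreover have "c > 0" "a > 0" using pd_c_pos[of a b c N] assms by (auto simp: f pd_forms_def)
  ultimately show ?thesis by (simp add: superbase_sum_def f)
qed

text \<open>Selling's descent: for b > 0, \<open>flip\<close> lowers the superbase sum by 2b, and
  rotations bring the other two violated inequalities into this position. The sum is a positive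
  integer, so the descent ends.\<close>

lemma ex_selling:
  assumes "f \<in> pd_forms N" "N > 0"
  shows "\<exists>g. (f, g) \<in> sl2_equiv N \<and> selling g"
  using assms(1)
proof (induction "nat (superbase_sum f)" arbitrary: f rule: less_induct)
  case less
  have step: ?case if g: "(f, g) \<in> sl2_equiv N" "superbase_sum g < superbase_sum f" for g
  proof -
    have "g \<in> pd_forms N" using g sl2_equiv_pd by blast
    moreover have "nat (superbase_sum g) < nat (superbase_sum f)"
      using g superbase_sum_pos[OF less.prems assms(2)] by simp
    ultimately show ?thesis using less.hyps g(1) sl2_equiv_trans by meson
  qed
  obtain a b c where f: "f = (a,b,c)" by (cases f)
  note r = rot_equiv[OF less.prems assms(2)]
  have rr: "(f, rot (rot f)) \<in> sl2_equiv N"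
    using r rot_equiv assms(2) sl2_equiv_pd sl2_equiv_trans by meson
  have fl: "(f, flip g) \<in> sl2_equiv N" if "(f, g) \<in> sl2_equiv N" for g
    using that flip_equiv assms(2) sl2_equiv_pd sl2_equiv_trans by meson
  consider "selling f" | "b > 0" | "2*a + b < 0" | "2*c + b < 0"
    by (force simp: selling_def f)
  then show ?case
  proof cases
    case 1
    then show ?thesis using less.prems equiv_sl2_equiv by (meson equivE refl_onD)
  next
    case 2
    then show ?thesis
      by (intro step[OF flip_equiv[OF less.prems assms(2)]]) (simp add: f flip_def superbase_sum_def)
  next
    case 3
    then show ?thesis
      by (intro step[OF fl[OF rr]]) (simp add: f rot_def flip_def superbase_sum_def)
  next
    case 4
    then show ?thesis
      by (intro step[OF fl[OF r]]) (simp add: f rot_def flip_def superbase_sum_def)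
  qed
qed

section \<open>Minimality and uniqueness of obtuse superbases\<close>

lemma loeschian_square:
  fixes m n :: int
  shows "4*(m^2 + m*n + n^2) = (2*m + n)^2 + 3*n^2"
  by (simp add: algebra_simps power2_eq_square)

lemma loeschian_pos:
  fixes m n :: int
  assumes "m \<noteq> 0 \<or> n \<noteq> 0" shows "m^2 + m*n + n^2 \<ge> 1"
proof (cases "n = 0")
  case True
  then have "m^2 > 0" using assms by simp
  then have "m^2 \<ge> 1" by linarith
  then show ?thesis using True by simp
next
  case False
  then have n: "n^2 > 0" by simp
  have "1 \<le> t" if "4*t = x + 3*n^2" "0 \<le> x" for t x :: int
    using that n by linarith
  then show ?thesis using loeschian_square[of m n] zero_le_power2 by blast
qed

lemma loeschian_one:
  fixes m n :: int
  assumes "m^2 + m*n + n^2 = 1"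
  shows "(m, n) \<in> {(1,0), (-1,0), (0,1), (0,-1), (1,-1), (-1,1)}"
proof -
  have "n^2 + n*m + m^2 = 1" using assms by (simp add: algebra_simps)
  then obtain x y where "x \<ge> 0" "y \<ge> 0" "4*1 = x + 3*n^2" "4*1 = y + 3*m^2"
    using loeschian_square[of m n] loeschian_square[of n m] assms zero_le_power2 by metis
  then have "n^2 \<le> 1" "m^2 \<le> 1" by linarith+
  then have "\<bar>n\<bar> \<le> 1" "\<bar>m\<bar> \<le> 1" by (simp_all add: abs_square_le_1)
  then have "n \<in> {-1,0,1}" "m \<in> {-1,0,1}" by auto
  then show ?thesis using assms by auto
qed

text \<open>For an obtuse superbase, twice the form is a combination of \<open>x\<^sup>2\<close>, \<open>y\<^sup>2\<close> and
  \<open>(x - y)\<^sup>2\<close> with nonnegative weights, so the superbase sum of a transform is the same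
  combination of values of \<open>m\<^sup>2 + mn + n\<^sup>2\<close>.\<close>

lemma superbase_sum_form_act:
  "superbase_sum (form_act al be ga de (a, b, c)) =
     (2*a + b) * (al^2 + al*be + be^2) + (2*c + b) * (ga^2 + ga*de + de^2)
     + (- b) * ((al - ga)^2 + (al - ga)*(be - de) + (be - de)^2)"
  by (simp add: superbase_sum_def form_act_def algebra_simps power2_eq_square)

text \<open>By determinant 1 the two rows and their difference are nonzero, so each value of m^2 +
  mn + n^2 is at least 1. Equality of the sums forces the value 1 wherever the weight is
  positive.\<close>

lemma superbase_sum_mono:
  assumes "selling (a, b, c)" "al*de - be*ga = 1"
  shows "superbase_sum (a, b, c) \<le> superbase_sum (form_act al be ga de (a, b, c))"
    and "superbase_sum (form_act al be ga de (a, b, c)) = superbase_sum (a, b, c) \<Longrightarrow>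
       (2*a + b = 0 \<or> al^2 + al*be + be^2 = 1) \<and> (2*c + b = 0 \<or> ga^2 + ga*de + de^2 = 1)
       \<and> (b = 0 \<or> (al - ga)^2 + (al - ga)*(be - de) + (be - de)^2 = 1)"
proof -
  have 1: "al^2 + al*be + be^2 \<ge> 1" using assms(2) by (intro loeschian_pos) auto
  have 2: "ga^2 + ga*de + de^2 \<ge> 1" using assms(2) by (intro loeschian_pos) auto
  have 3: "(al - ga)^2 + (al - ga)*(be - de) + (be - de)^2 \<ge> 1"
    using assms(2) by (intro loeschian_pos) (auto simp: algebra_simps)
  have s: "2*a + b \<ge> 0" "2*c + b \<ge> 0" "- b \<ge> 0" using assms(1) by (auto simp: selling_def)
  have t: "superbase_sum (a,b,c) = (2*a + b) + (2*c + b) + (- b)" by (simp add: superbase_sum_def)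
  have le: "(2*a + b) \<le> (2*a + b) * (al^2 + al*be + be^2)"
     "(2*c + b) \<le> (2*c + b) * (ga^2 + ga*de + de^2)"
     "(- b) \<le> (- b) * ((al - ga)^2 + (al - ga)*(be - de) + (be - de)^2)"
    using s 1 2 3 by (simp_all add: mult_le_cancel_left1 del: mult_minus_left)
  show "superbase_sum (a, b, c) \<le> superbase_sum (form_act al be ga de (a, b, c))"
    unfolding superbase_sum_form_act t using le by linarith
  assume "superbase_sum (form_act al be ga de (a, b, c)) = superbase_sum (a, b, c)"
  then have "(2*a + b) * (al^2 + al*be + be^2) = (2*a + b)"
     "(2*c + b) * (ga^2 + ga*de + de^2) = (2*c + b)"
     "(- b) * ((al - ga)^2 + (al - ga)*(be - de) + (be - de)^2) = (- b)"
    unfolding superbase_sum_form_act t using le by linarith+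
  then show "(2*a + b = 0 \<or> al^2 + al*be + be^2 = 1) \<and> (2*c + b = 0 \<or> ga^2 + ga*de + de^2 = 1)
       \<and> (b = 0 \<or> (al - ga)^2 + (al - ga)*(be - de) + (be - de)^2 = 1)"
    by (simp del: mult_minus_left)
qed

lemma selling_superbase_sum_eq:
  assumes "selling f" "selling g" "al*de - be*ga = 1" "g = form_act al be ga de f"
  shows "superbase_sum g = superbase_sum f"
proof (rule antisym)
  have "f = form_act de (-be) (-ga) al g" "de*al - (-be)*(-ga) = 1"
    using form_act_inverse[OF assms(3)] assms(3,4) by (auto simp: algebra_simps)
  then show "superbase_sum g \<le> superbase_sum f"
    using assms(2) superbase_sum_mono(1) by (cases g) blast
  show "superbase_sum f \<le> superbase_sum g"
    using assms(1,3,4) superbase_sum_mono(1) by (cases f) blast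
qed

text \<open>With all weights positive, the rows and their difference are among the six minimal
  vectors of the hexagonal form. This leaves, up to sign, the powers of the rotation.\<close>

lemma selling_unique_interior:
  assumes "selling (a,b,c)" "selling g" "((a,b,c), g) \<in> sl2_equiv N" "b < 0" "2*a + b > 0" "2*c + b > 0"
  shows "g \<in> {(a,b,c), rot (a,b,c), rot (rot (a,b,c))}"
proof -
  obtain al be ga de where d: "al*de - be*ga = 1" and g: "g = form_act al be ga de (a,b,c)"
    using assms by (auto simp: sl2_equiv_def)
  have e: "superbase_sum (form_act al be ga de (a, b, c)) = superbase_sum (a, b, c)"
    using selling_superbase_sum_eq[OF assms(1,2) d g] g by simp
  have q: "al^2 + al*be + be^2 = 1" "ga^2 + ga*de + de^2 = 1"
     "(al - ga)^2 + (al - ga)*(be - de) + (be - de)^2 = 1"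
    using superbase_sum_mono(2)[OF assms(1) d e] assms by auto
  show ?thesis
    using loeschian_one[OF q(1)] loeschian_one[OF q(2)] unfolding g
    by (elim insertE emptyE) (use q(3) d in \<open>simp_all add: form_act_def rot_def\<close>)
qed

text \<open>A root on a side lies in two closed triangles, each of which contributes three forms
  (with coincidences if a = c).\<close>

lemma selling_unique_edge:
  assumes "a > 0" "c > 0" "selling g" "((a,0,c), g) \<in> sl2_equiv N"
  shows "g \<in> {(a,0,c), (c,-2*c,a+c), (a+c,-2*a,a), (c,0,a), (a,-2*a,a+c), (a+c,-2*c,c)}"
proof -
  obtain al be ga de where d: "al*de - be*ga = 1" and g: "g = form_act al be ga de (a,0,c)"
    using assms by (auto simp: sl2_equiv_def)
  have s: "selling (a,0,c)" using assms by (simp add: selling_def)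
  have e: "superbase_sum (form_act al be ga de (a, 0, c)) = superbase_sum (a, 0, c)"
    using selling_superbase_sum_eq[OF s assms(3) d g] g by simp
  have q: "al^2 + al*be + be^2 = 1" "ga^2 + ga*de + de^2 = 1"
    using superbase_sum_mono(2)[OF s d e] assms by auto
  show ?thesis
    using loeschian_one[OF q(1)] loeschian_one[OF q(2)] unfolding g
    by (elim insertE emptyE) (use d assms(1,2) in \<open>simp_all add: form_act_def\<close>)
qed

lemma selling_rot: "selling f \<Longrightarrow> selling (rot f)"
  by (auto simp: selling_def rot_def split: prod.splits)

text \<open>In the Selling parameters x = 2a + b, y = 2c + b, z = -b the number N is xy + xz + yz.
  As N > 0, no two of them vanish together, so each is at most N.\<close>

lemma selling_bounds:
  assumes "(a, b, c) \<in> pd_forms N" "selling (a, b, c)" "N > 0"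
  shows "0 < a" "a \<le> N" "- N \<le> b" "b \<le> 0" "0 < c" "c \<le> N"
proof -
  have a: "a > 0" and d: "b^2 - 4*a*c = -N" using assms by (auto simp: pd_forms_def)
  show "0 < a" "b \<le> 0" "0 < c" using a assms pd_c_pos by (auto simp: selling_def)
  have bound: "x \<le> N" if "0 \<le> x" "0 \<le> y" "0 \<le> z" "x*y + x*z + y*z = N" for x y z :: int
  proof (cases "y + z = 0")
    case True
    then show ?thesis using that assms(3) by (simp add: add_nonneg_eq_0_iff)
  next
    case False
    then have "x*1 \<le> x*(y + z)" using that by (intro mult_left_mono) auto
    moreover have "0 \<le> y*z" using that by simp
    ultimately show ?thesis using that(4) by (simp add: algebra_simps)
  qed
  define x y z where "x = 2*a + b" and "y = 2*c + b" and "z = - b"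
  have nn: "0 \<le> x" "0 \<le> y" "0 \<le> z" using assms(2) by (auto simp: selling_def x_def y_def z_def)
  have e: "x*y + x*z + y*z = N"
    using d unfolding x_def y_def z_def by (simp add: algebra_simps power2_eq_square)
  have "x \<le> N" "y \<le> N" "z \<le> N"
    using bound[OF nn(1,2,3)] bound[OF nn(2,1,3)] bound[OF nn(3,1,2)] e by (simp_all add: algebra_simps)
  then show "a \<le> N" "- N \<le> b" "c \<le> N" by (simp_all add: x_def y_def z_def)
qed

lemma finite_selling:
  assumes "N > 0" shows "finite {f \<in> pd_forms N. selling f}"
proof (rule finite_subset)
  show "{f \<in> pd_forms N. selling f} \<subseteq> {0..N} \<times> {-N..0} \<times> {0..N}"
  proof
    fix f assume f: "f \<in> {f \<in> pd_forms N. selling f}"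
    obtain a b c where "f = (a,b,c)" by (cases f)
    then show "f \<in> {0..N} \<times> {-N..0} \<times> {0..N}"
      using f selling_bounds[of a b c N] assms by auto
  qed
qed simp

lemma middle_zero_selling: "(a, 0, c) \<in> pd_forms N \<Longrightarrow> N > 0 \<Longrightarrow> selling (a, 0, c)"
  using pd_c_pos[of a 0 c N] by (auto simp: selling_def pd_forms_def)

section \<open>Hurwitz weights as counts of reduced forms\<close>

lemma sl2_equiv_diag_iff:
  assumes "N > 0"
  shows "(f, (k, k, k)) \<in> sl2_equiv N \<longleftrightarrow> (f, (k, - k, k)) \<in> sl2_equiv N"
proof
  assume h: "(f, (k, k, k)) \<in> sl2_equiv N"
  then have "((k,k,k), flip (k,k,k)) \<in> sl2_equiv N" using assms sl2_equiv_pd flip_equiv by blast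
  then show "(f, (k, - k, k)) \<in> sl2_equiv N" using sl2_equiv_trans[OF h] by (simp add: flip_def)
next
  assume h: "(f, (k, - k, k)) \<in> sl2_equiv N"
  then have "((k,-k,k), flip (k,-k,k)) \<in> sl2_equiv N" using assms sl2_equiv_pd flip_equiv by blast
  then show "(f, (k, k, k)) \<in> sl2_equiv N" using sl2_equiv_trans[OF h] by (simp add: flip_def)
qed

text \<open>The three rotated forms give 3/3 = 1. They coincide exactly for multiples of x^2 - xy +
  y^2, which gives 1/3.\<close>

lemma class_weight_interior:
  assumes N: "N > 0" and f: "(a,b,c) \<in> pd_forms N" "selling (a,b,c)" "b < 0" "2*a + b > 0" "2*c + b > 0"
  defines "C \<equiv> sl2_equiv N `` {(a,b,c)}"
  shows "class_weight C = real (card {g \<in> C. selling g}) / 3 - real (card {g \<in> C. fst (snd g) = 0}) / 2"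
proof -
  have C: "g \<in> C \<longleftrightarrow> ((a,b,c), g) \<in> sl2_equiv N" for g by (simp add: C_def)
  note uniq = selling_unique_interior[OF f(2) _ _ f(3-5)]
  have fC: "(a,b,c) \<in> C" using f equiv_sl2_equiv C by (meson equivE refl_onD)
  have rC: "rot g \<in> C" if "g \<in> C" for g
    using that C rot_equiv[OF _ N] sl2_equiv_pd sl2_equiv_trans by meson
  have S: "{g \<in> C. selling g} = {(a,b,c), rot (a,b,c), rot (rot (a,b,c))}"
    using fC rC selling_rot f(2) C uniq by blast
  have Z: "g \<notin> C" if "fst (snd g) = 0" for g
  proof
    assume g: "g \<in> C"
    obtain x z where "g = (x, 0, z)" using \<open>fst (snd g) = 0\<close> by (metis prod.collapse)
    then show False
      using g C uniq[of g N] middle_zero_selling[of x z N] N sl2_equiv_pd[of "(a,b,c)" g N] f(3-5)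
      by (auto simp: rot_def)
  qed
  then have "{g \<in> C. fst (snd g) = 0} = {}" by auto
  then have Z': "card {g \<in> C. fst (snd g) = 0} = 0" by (simp only: card.empty)
  have w1: "\<not> (\<exists>k. (k,0,k) \<in> C)" using Z by auto
  have w2: "(\<exists>k. (k,k,k) \<in> C) \<longleftrightarrow> a = c \<and> b = - a"
  proof
    assume "\<exists>k. (k,k,k) \<in> C"
    then obtain k where k: "((a,b,c), (k, -k, k)) \<in> sl2_equiv N"
      using C sl2_equiv_diag_iff[OF N] by blast
    then have "k > 0" using sl2_equiv_pd by (fastforce simp: pd_forms_def)
    then have "selling (k, -k, k)" by (simp add: selling_def)
    from uniq[OF this k] show "a = c \<and> b = - a" by (auto simp: rot_def)
  next
    assume "a = c \<and> b = - a"
    then have "(a, - a, a) \<in> C" using fC by simp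
    then show "\<exists>k. (k,k,k) \<in> C" using C sl2_equiv_diag_iff[OF N] by blast
  qed
  show ?thesis
  proof (cases "a = c \<and> b = - a")
    case True
    then have "card {g \<in> C. selling g} = 1" unfolding S by (simp add: rot_def)
    then show ?thesis using Z' w1 w2 True by (simp add: class_weight_def)
  next
    case False
    then have "card {g \<in> C. selling g} = 3" unfolding S by (auto simp: rot_def card_insert_if)
    then show ?thesis using Z' w1 w2 False by (simp add: class_weight_def)
  qed
qed

text \<open>In general 6/3 - 2/2 = 1; for a = c the counts are halved and 3/3 - 1/2 = 1/2.\<close>

lemma class_weight_edge:
  assumes N: "N > 0" and f: "(a,0,c) \<in> pd_forms N"
  defines "C \<equiv> sl2_equiv N `` {(a,0,c)}"
  shows "class_weight C = real (card {g \<in> C. selling g}) / 3 - real (card {g \<in> C. fst (snd g) = 0}) / 2"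
proof -
  have C: "g \<in> C \<longleftrightarrow> ((a,0,c), g) \<in> sl2_equiv N" for g by (simp add: C_def)
  have pos: "a > 0" "c > 0" using f pd_c_pos[OF f N] by (auto simp: pd_forms_def)
  note uniq = selling_unique_edge[OF pos]
  have fC: "(a,0,c) \<in> C" using f equiv_sl2_equiv C by (meson equivE refl_onD)
  have rC: "rot g \<in> C" if "g \<in> C" for g
    using that C rot_equiv[OF _ N] sl2_equiv_pd sl2_equiv_trans by meson
  have sC: "flip g \<in> C" if "g \<in> C" for g
    using that C flip_equiv[OF _ N] sl2_equiv_pd sl2_equiv_trans by meson
  define T where "T = {(a,0,c), (c,-2*c,a+c), (a+c,-2*a,a), (c,0,a), (a,-2*a,a+c), (a+c,-2*c,c)}"
  have TC: "T \<subseteq> C"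
    using fC sC[OF fC] rC[OF fC] rC[OF rC[OF fC]] rC[OF sC[OF fC]] rC[OF rC[OF sC[OF fC]]]
    by (simp add: T_def flip_def rot_def algebra_simps)
  have Ts: "selling g" if "g \<in> T" for g
    using that pos unfolding T_def by (elim insertE emptyE) (simp_all add: selling_def)
  have "g \<in> T" if "g \<in> C" "selling g" for g
    using uniq[OF that(2)] that(1) unfolding C T_def by simp
  with TC Ts have S0: "{g \<in> C. selling g} = T" by blast
  note S = S0[unfolded T_def]
  have "selling g" if "g \<in> C" "fst (snd g) = 0" for g
  proof -
    obtain x z where "g = (x, 0, z)" using \<open>fst (snd g) = 0\<close> by (metis prod.collapse)
    then show ?thesis using middle_zero_selling[of x z N] N that C sl2_equiv_pd by blast
  qed
  then have "{g \<in> C. fst (snd g) = 0} = {g \<in> T. fst (snd g) = 0}" using S0 by blast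
  also have "\<dots> = {(a,0,c), (c,0,a)}"
    using pos by (auto simp: T_def)
  finally have Z: "{g \<in> C. fst (snd g) = 0} = {(a,0,c), (c,0,a)}" .
  have w1: "(\<exists>k. (k,0,k) \<in> C) \<longleftrightarrow> a = c"
  proof -
    have "(k,0,k) \<in> C \<longleftrightarrow> (k,0,k) \<in> {g \<in> C. fst (snd g) = 0}" for k by simp
    then show ?thesis unfolding Z by auto
  qed
  have w2: "\<not> (\<exists>k. (k,k,k) \<in> C)"
  proof
    assume "\<exists>k. (k,k,k) \<in> C"
    then obtain k where k: "((a,0,c), (k, -k, k)) \<in> sl2_equiv N"
      using C sl2_equiv_diag_iff[OF N] by blast
    then have "k > 0" using sl2_equiv_pd by (fastforce simp: pd_forms_def)
    then have "selling (k, -k, k)" by (simp add: selling_def)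
    from uniq[OF this k] show False using pos by auto
  qed
  show ?thesis
  proof (cases "a = c")
    case True
    then have "card {g \<in> C. selling g} = 3" unfolding S using pos by (auto simp: card_insert_if)
    moreover have "card {g \<in> C. fst (snd g) = 0} = 1" unfolding Z using True by simp
    ultimately show ?thesis using w1 w2 True by (simp add: class_weight_def)
  next
    case False
    then have "card {g \<in> C. selling g} = 6" unfolding S using pos by (auto simp: card_insert_if)
    moreover have "card {g \<in> C. fst (snd g) = 0} = 2" unfolding Z using False by simp
    ultimately show ?thesis using w1 w2 False by (simp add: class_weight_def)
  qed
qed

lemma class_weight_card:
  assumes N: "N > 0" and C: "C \<in> form_classes N"
  shows "class_weight C = real (card {g \<in> C. selling g}) / 3 - real (card {g \<in> C. fst (snd g) = 0}) / 2"
proof -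
  obtain f0 where f0: "f0 \<in> pd_forms N" "C = sl2_equiv N `` {f0}"
    using C by (auto simp: form_classes_def elim: quotientE)
  obtain f where f: "(f0, f) \<in> sl2_equiv N" "selling f" using ex_selling[OF f0(1) N] by blast
  have Cg: "C = sl2_equiv N `` {g}" if "(f, g) \<in> sl2_equiv N" for g
    using sl2_equiv_trans[OF f(1) that] f0(2) equiv_class_eq[OF equiv_sl2_equiv] by blast
  have pd: "f \<in> pd_forms N" using f sl2_equiv_pd by blast
  have refl: "(f, f) \<in> sl2_equiv N" using pd equiv_sl2_equiv by (meson equivE refl_onD)
  obtain a b c where abc: "f = (a,b,c)" by (cases f)
  have r: "(f, rot f) \<in> sl2_equiv N" "(f, rot (rot f)) \<in> sl2_equiv N"
    using rot_equiv[OF _ N] pd sl2_equiv_pd sl2_equiv_trans by meson+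
  consider "b < 0 \<and> 2*a + b > 0 \<and> 2*c + b > 0" | "b = 0" | "2*c + b = 0" | "2*a + b = 0"
    using f(2) by (force simp: selling_def abc)
  then show ?thesis
  proof cases
    case 1
    then show ?thesis using class_weight_interior[OF N, of a b c] pd f(2) Cg[OF refl] by (simp add: abc)
  next
    case 2
    then show ?thesis using class_weight_edge[OF N, of a c] pd Cg[OF refl] by (simp add: abc)
  next
    case 3
    then have "rot f = (c, 0, a + b + c)" by (simp add: rot_def abc)
    then show ?thesis using class_weight_edge[OF N, of c "a+b+c"] sl2_equiv_pd[OF r(1)] Cg[OF r(1)]
      by simp
  next
    case 4
    then have "rot (rot f) = (a + b + c, 0, a)" by (simp add: rot_def abc algebra_simps)
    then show ?thesis using class_weight_edge[OF N, of "a+b+c" a] sl2_equiv_pd[OF r(2)] Cg[OF r(2)]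
      by simp
  qed
qed

lemma hurwitz_card:
  assumes N: "N > 0" "N mod 4 = 0 \<or> N mod 4 = 3"
  shows "hurwitz N = real (card {f \<in> pd_forms N. selling f}) / 3
                   - real (card {f \<in> pd_forms N. fst (snd f) = 0}) / 2"
proof -
  have Un: "\<Union> (form_classes N) = pd_forms N"
    unfolding form_classes_def by (rule Union_quotient[OF equiv_sl2_equiv])
  have disj: "C \<inter> D = {}" if "C \<in> form_classes N" "D \<in> form_classes N" "C \<noteq> D" for C D
    using that quotient_disj[OF equiv_sl2_equiv] unfolding form_classes_def by blast
  define Sl where "Sl = {f \<in> pd_forms N. selling f}"
  define Ze where "Ze = {f \<in> pd_forms N. fst (snd f) = 0}"
  have fS: "finite Sl" unfolding Sl_def by (rule finite_selling[OF N(1)])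
  have "Ze \<subseteq> Sl"
    using middle_zero_selling[OF _ N(1)] unfolding Ze_def Sl_def by (auto split: prod.splits)
  then have fZ: "finite Ze" using fS finite_subset by blast
  have "form_classes N \<subseteq> (\<lambda>f. sl2_equiv N `` {f}) ` Sl"
  proof
    fix C assume "C \<in> form_classes N"
    then obtain f where f: "f \<in> pd_forms N" "C = sl2_equiv N `` {f}"
      by (auto simp: form_classes_def elim: quotientE)
    obtain g where g: "(f, g) \<in> sl2_equiv N" "selling g" using ex_selling[OF f(1) N(1)] by blast
    then have "C = sl2_equiv N `` {g}" using f equiv_class_eq[OF equiv_sl2_equiv] by blast
    moreover have "g \<in> Sl" using g sl2_equiv_pd by (auto simp: Sl_def)
    ultimately show "C \<in> (\<lambda>f. sl2_equiv N `` {f}) ` Sl" by blast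
  qed
  then have fC: "finite (form_classes N)" using fS finite_surj by blast
  have card: "real (card {f \<in> pd_forms N. P f}) = (\<Sum>C\<in>form_classes N. real (card {f \<in> C. P f}))"
    if fin: "finite {f \<in> pd_forms N. P f}" for P
  proof -
    have "{f \<in> pd_forms N. P f} = (\<Union>C\<in>form_classes N. {f \<in> C. P f})" using Un by blast
    moreover have "card (\<Union>C\<in>form_classes N. {f \<in> C. P f}) = (\<Sum>C\<in>form_classes N. card {f \<in> C. P f})"
    proof (rule card_UN_disjoint[OF fC])
      show "\<forall>C\<in>form_classes N. finite {f \<in> C. P f}"
        using Un by (auto intro: finite_subset[OF _ fin])
      show "\<forall>C\<in>form_classes N. \<forall>D\<in>form_classes N. C \<noteq> D \<longrightarrow> {f \<in> C. P f} \<inter> {f \<in> D. P f} = {}"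
        using disj by blast
    qed
    ultimately show ?thesis by simp
  qed
  have "hurwitz N = (\<Sum>C\<in>form_classes N. class_weight C)"
    using N by (auto simp: hurwitz_def)
  also have "\<dots> = (\<Sum>C\<in>form_classes N. real (card {g \<in> C. selling g}) / 3 - real (card {g \<in> C. fst (snd g) = 0}) / 2)"
    using class_weight_card[OF N(1)] by simp
  also have "\<dots> = real (card Sl) / 3 - real (card Ze) / 2"
    unfolding sum_subtractf sum_divide_distrib[symmetric]
    using card[of selling] card[of "\<lambda>f. fst (snd f) = 0"] fS fZ by (simp add: Sl_def Ze_def)
  finally show ?thesis by (simp add: Sl_def Ze_def)
qed

subsection \<open>Finitely supported sums\<close>

lemma finite_support_bij:
  assumes "finite {x. f x \<noteq> (0::real)}" "bij l"
  shows "finite {x. f (l x) \<noteq> 0}"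
proof -
  have "{x. f (l x) \<noteq> 0} = l -` {x. f x \<noteq> 0}" by auto
  then show ?thesis using finite_vimageI[OF assms(1) bij_is_inj[OF assms(2)]] by simp
qed

lemma Sum_any_bij:
  assumes "bij l" shows "Sum_any (\<lambda>x. f (l x)) = Sum_any (f :: 'a \<Rightarrow> real)"
  using Sum_any.reindex_cong[OF assms, of f "\<lambda>x. f (l x)"] by (simp add: comp_def)

lemma Sum_any_cmult: "Sum_any (\<lambda>x. (r::real) * f x) = r * Sum_any f"
proof (cases "r = 0")
  case False
  then have "{x. r * f x \<noteq> 0} = {x. f x \<noteq> 0}" by auto
  then show ?thesis by (simp add: Sum_any.expand_set sum_distrib_left)
qed simp

lemma Sum_any_of_bool:
  assumes "finite {x. P x}" shows "Sum_any (\<lambda>x. of_bool (P x) :: real) = real (card {x. P x})"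
  using Sum_any.expand_superset[OF assms, of "\<lambda>x. of_bool (P x) :: real"] by simp

lemma finite_support_add:
  assumes "finite {x. f x \<noteq> (0::real)}" "finite {x. g x \<noteq> 0}"
  shows "finite {x. f x + g x \<noteq> 0}"
  by (rule finite_subset[of _ "{x. f x \<noteq> 0} \<union> {x. g x \<noteq> 0}"]) (use assms in auto)

lemma finite_support_cmult:
  assumes "finite {x. f x \<noteq> (0::real)}"
  shows "finite {x. r * f x \<noteq> 0}"
  by (rule finite_subset[OF _ assms]) auto

subsection \<open>Integer matrices\<close>

type_synonym mat = "int \<times> int \<times> int \<times> int"

fun det4 :: "mat \<Rightarrow> int" where "det4 (a, b, c, d) = a*d - b*c"
fun tr4 :: "mat \<Rightarrow> int" where "tr4 (a, b, c, d) = a + d"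
fun neg4 :: "mat \<Rightarrow> mat" where "neg4 (a, b, c, d) = (-a, -b, -c, -d)"
fun adj4 :: "mat \<Rightarrow> mat" where "adj4 (a, b, c, d) = (d, -b, -c, a)"

text \<open>With \<open>S = (0, -1; 1, 0)\<close>, \<open>U = (1, -1; 1, 0)\<close> and \<open>T = (1, 1; 0, 1)\<close>, the following are
  \<open>S M\<close>, \<open>U\<^sup>-\<^sup>1 M\<close>, \<open>M S\<close>, \<open>M U\<close>, \<open>M T\<^sup>-\<^sup>1\<close>, \<open>S M S\<^sup>-\<^sup>1\<close> and \<open>U M U\<^sup>-\<^sup>1\<close>.\<close>

fun lS :: "mat \<Rightarrow> mat" where "lS (a, b, c, d) = (-c, -d, a, b)"
fun lV :: "mat \<Rightarrow> mat" where "lV (a, b, c, d) = (c, d, c - a, d - b)"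
fun rS :: "mat \<Rightarrow> mat" where "rS (a, b, c, d) = (b, -a, d, -c)"
fun rU :: "mat \<Rightarrow> mat" where "rU (a, b, c, d) = (a + b, -a, c + d, -c)"
fun rT :: "mat \<Rightarrow> mat" where "rT (a, b, c, d) = (a, b - a, c, d - c)"
fun cS :: "mat \<Rightarrow> mat" where "cS (a, b, c, d) = (d, -c, -b, a)"
fun cU :: "mat \<Rightarrow> mat" where "cU (a, b, c, d) = (d - b, a - c + b - d, -b, a + b)"

lemma bij_neg4: "bij neg4" by (rule o_bij[of neg4]) auto
lemma bij_adj4: "bij adj4" by (rule o_bij[of adj4]) auto
lemma bij_cS: "bij cS" by (rule o_bij[of cS]) auto
lemma bij_cU: "bij cU" by (rule o_bij[of "cU \<circ> cU"]) (auto simp: fun_eq_iff)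
lemma bij_lS: "bij lS" by (rule o_bij[of "neg4 \<circ> lS"]) (auto simp: fun_eq_iff)
lemma bij_rS: "bij rS" by (rule o_bij[of "neg4 \<circ> rS"]) (auto simp: fun_eq_iff)
lemma bij_lV: "bij lV" by (rule o_bij[of "neg4 \<circ> (lV \<circ> lV)"]) (auto simp: fun_eq_iff)
lemma bij_rU: "bij rU" by (rule o_bij[of "neg4 \<circ> (rU \<circ> rU)"]) (auto simp: fun_eq_iff)
lemma bij_rT: "bij rT" by (rule o_bij[of "\<lambda>(a, b, c, d). (a, b + a, c, d + c)"]) (auto simp: fun_eq_iff)

lemma det4_ops [simp]:
  "det4 (neg4 M) = det4 M" "det4 (adj4 M) = det4 M" "det4 (lS M) = det4 M" "det4 (lV M) = det4 M"
  "det4 (rS M) = det4 M" "det4 (rU M) = det4 M" "det4 (rT M) = det4 M" "det4 (cS M) = det4 M"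
  "det4 (cU M) = det4 M"
  by (cases M; simp add: algebra_simps)+

lemma tr4_ops [simp]:
  "tr4 (neg4 M) = - tr4 M" "tr4 (adj4 M) = tr4 M" "tr4 (cS M) = tr4 M" "tr4 (cU M) = tr4 M"
  by (cases M; simp add: algebra_simps)+

lemma finite_matI:
  assumes "\<And>a b c d. (a, b, c, d) \<in> X \<Longrightarrow> \<bar>a\<bar> \<le> K \<and> \<bar>b\<bar> \<le> K \<and> \<bar>c\<bar> \<le> K \<and> \<bar>d\<bar> \<le> (K::int)"
  shows "finite X"
proof (rule finite_subset)
  show "X \<subseteq> {-K..K} \<times> {-K..K} \<times> {-K..K} \<times> {-K..K}"
  proof
    fix M assume "M \<in> X"
    then show "M \<in> {-K..K} \<times> {-K..K} \<times> {-K..K} \<times> {-K..K}"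
      using assms by (cases M) (auto simp: abs_le_iff, fastforce+)
  qed
qed simp

text \<open>\<open>sg M\<close> has the sign of the real part of \<open>M \<rho>\<close>, where \<open>\<rho> = (1 + \<i>\<surd>3) / 2\<close> is the fixed point
  of \<open>U\<close>, the centre of the Farey triangle with vertices \<open>0\<close>, \<open>1\<close>, \<open>\<infinity>\<close>. Accordingly \<open>fixv M\<close> tells
  whether \<open>M \<rho>\<close> lies in that triangle, and \<open>inde M\<close> compares the sides of the geodesic from
  \<open>0\<close> to \<open>\<infinity>\<close> on which \<open>M\<close> puts the centres of its two neighbouring triangles.\<close>

fun sg :: "mat \<Rightarrow> int" where "sg (a, b, c, d) = 2*a*c + 2*b*d + a*d + b*c"

definition lft :: "mat \<Rightarrow> real" where "lft M = of_bool (sg M < 0)"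
definition fixv :: "mat \<Rightarrow> real" where "fixv M = 1 - lft M - lft (lV M) - lft (lV (lV M))"
definition inde :: "mat \<Rightarrow> real" where "inde M = lft (rS M) - lft M"

lemma sg_ops:
  "sg (neg4 M) = sg M" "sg (lS M) = - sg M" "sg (rU M) = sg M" "sg (rT M) = sg (rS M)"
  "sg (cS M) = - sg (rS M)" "sg (cU M) = sg (lV (lV M))" "sg (cU (cU M)) = sg (lV M)"
  "sg (lV (lV (lV M))) = sg M"
  by (cases M; simp add: algebra_simps)+

lemma sg_odd: "odd (det4 M) \<Longrightarrow> odd (sg M)"
  by (cases M) auto

lemma sg_nonzero: "odd (det4 M) \<Longrightarrow> sg M \<noteq> 0"
  using sg_odd by fastforce

text \<open>\<open>X M\<close> tells whether the arrow of the base triangle crosses the side from 0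
  to infinity. Conjugation by U turns to the other two sides, conjugation by S to the neighbouring
  triangle. A triangle is met through three sides and a side from two triangles, hence the divisors
  3 and 2.\<close>

definition lef :: "(mat \<Rightarrow> real) \<Rightarrow> mat \<Rightarrow> real" where
  "lef X M = (1 - X M - X (cU M) - X (cU (cU M))) / 3 - (1 - X M - X (cS M)) / 2"

text \<open>Since \<open>sg\<close> does not vanish, the arrow of the neighbouring triangle is the
  negation of \<open>lft (rS M)\<close>. The right-hand side is the form in which finiteness of the
  support can be proved.\<close>

lemma lef_lft:
  assumes "odd (det4 M)" shows "lef lft M = fixv M / 3 - inde M / 2"
proof -
  have "lft (cS M) = 1 - lft (rS M)"
    using sg_nonzero[of "rS M"] assms by (auto simp: lft_def sg_ops)
  moreover have "lft (cU M) = lft (lV (lV M))" "lft (cU (cU M)) = lft (lV M)"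
    by (simp only: lft_def sg_ops(6), simp only: lft_def sg_ops(7))
  ultimately show ?thesis by (simp add: lef_def fixv_def inde_def)
qed

text \<open>A field of arrows assigns to each vertex of the Farey tree an outgoing edge, or none; its
  Lefschetz number does not change under finite modifications of the field.\<close>

lemma lef_finite_change:
  assumes inv: "\<And>M. k (cU M) = k M" "\<And>M. k (cS M) = (k M :: real)"
    and fin: "finite {M. k M * (X M - Y M) \<noteq> 0}" and finX: "finite {M. k M * lef X M \<noteq> 0}"
  shows "Sum_any (\<lambda>M. k M * lef X M) = Sum_any (\<lambda>M. k M * lef Y M)"
proof -
  define \<delta> where "\<delta> M = k M * (X M - Y M)" for M
  have f0: "finite {M. \<delta> M \<noteq> 0}" using fin by (simp add: \<delta>_def)
  have fU: "finite {M. \<delta> (cU M) \<noteq> 0}" by (rule finite_support_bij[OF f0 bij_cU])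
  have fUU: "finite {M. \<delta> (cU (cU M)) \<noteq> 0}"
    using finite_support_bij[OF fU bij_cU] by simp
  have fS: "finite {M. \<delta> (cS M) \<noteq> 0}" by (rule finite_support_bij[OF f0 bij_cS])
  have sU: "Sum_any (\<lambda>M. \<delta> (cU M)) = Sum_any \<delta>" by (rule Sum_any_bij[OF bij_cU])
  have sUU: "Sum_any (\<lambda>M. \<delta> (cU (cU M))) = Sum_any \<delta>"
    using Sum_any_bij[OF bij_cU, of "\<lambda>M. \<delta> (cU M)"] sU by simp
  have sS: "Sum_any (\<lambda>M. \<delta> (cS M)) = Sum_any \<delta>" by (rule Sum_any_bij[OF bij_cS])
  \<comment> \<open>This is \<open>lef Y - lef X\<close> weighted by \<open>k\<close>, with -1/6 =
    1/3 - 1/2. The four coefficients 1/3, 1/3, -1/6, -1/2 add up to 0, and conjugation does not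
    change the sum of \<open>\<delta>\<close>.\<close>
  define e where "e M = (1/3) * (\<delta> (cU M) + \<delta> (cU (cU M))) + ((-1/6) * \<delta> M + (-1/2) * \<delta> (cS M))" for M
  have f1: "finite {M. \<delta> (cU M) + \<delta> (cU (cU M)) \<noteq> 0}" using finite_support_add[OF fU fUU] .
  have fe1: "finite {M. (1/3) * (\<delta> (cU M) + \<delta> (cU (cU M))) \<noteq> 0}" using finite_support_cmult[OF f1] .
  have fe2: "finite {M. (-1/6) * \<delta> M \<noteq> 0}" "finite {M. (-1/2) * \<delta> (cS M) \<noteq> 0}"
    by (rule finite_support_cmult[OF f0], rule finite_support_cmult[OF fS])
  have fe3: "finite {M. (-1/6) * \<delta> M + (-1/2) * \<delta> (cS M) \<noteq> 0}" using finite_support_add[OF fe2] .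
  have fe: "finite {M. e M \<noteq> 0}" unfolding e_def using finite_support_add[OF fe1 fe3] .
  have "Sum_any e = (1/3) * (Sum_any \<delta> + Sum_any \<delta>) + ((-1/6) * Sum_any \<delta> + (-1/2) * Sum_any \<delta>)"
    unfolding e_def Sum_any.distrib[OF fe1 fe3] Sum_any.distrib[OF fe2] Sum_any_cmult
      Sum_any.distrib[OF fU fUU] sU sUU sS ..
  then have e0: "Sum_any e = 0" by simp
  have "k M * lef Y M = k M * lef X M + e M" for M
    unfolding e_def \<delta>_def lef_def inv by (simp add: field_simps)
  then have "Sum_any (\<lambda>M. k M * lef Y M) = Sum_any (\<lambda>M. k M * lef X M) + Sum_any e"
    using Sum_any.distrib[OF finX fe] by simp
  then show ?thesis using e0 by simp
qed

subsection \<open>Finiteness of the supports\<close>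

lemma abs_le_abs_mult: "y \<noteq> 0 \<Longrightarrow> \<bar>x\<bar> \<le> \<bar>x * y\<bar>" for x y :: int
proof -
  assume "y \<noteq> 0"
  then have "\<bar>x\<bar> * 1 \<le> \<bar>x\<bar> * \<bar>y\<bar>" by (intro mult_left_mono) auto
  then show ?thesis by (simp add: abs_mult)
qed

lemma abs_le_bound:
  assumes "x * y = p \<or> x * y = - p" "p > 0" shows "\<bar>x\<bar> \<le> p \<and> \<bar>y\<bar> \<le> (p::int)"
proof -
  have "x \<noteq> 0" "y \<noteq> 0" using assms by auto
  then have "\<bar>x\<bar> \<le> \<bar>x * y\<bar>" "\<bar>y\<bar> \<le> \<bar>y * x\<bar>" by (simp_all add: abs_le_abs_mult)
  then show ?thesis using assms by (auto simp: mult.commute)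
qed

lemma loeschian_lower:
  fixes u v :: int shows "3*u^2 \<le> 4*(u^2 + u*v + v^2)"
proof -
  have "4*(u^2 + u*v + v^2) = (u + 2*v)^2 + 3*u^2" by (simp add: algebra_simps power2_eq_square)
  then show ?thesis by simp
qed

lemma loeschian_nonneg:
  fixes u v :: int shows "0 \<le> u^2 + u*v + v^2"
proof -
  have "0 \<le> t" if "3*w \<le> 4*t" "0 \<le> w" for t w :: int using that by linarith
  then show ?thesis using loeschian_lower[of u v] zero_le_power2 by blast
qed

lemma quad_bound:
  assumes "x^2 + x*y + y^2 < (p::int)^2" "p > 0"
  shows "\<bar>x\<bar> \<le> 2*p \<and> \<bar>y\<bar> \<le> 2*p"
proof -
  have *: "\<bar>u\<bar> \<le> 2*p" if "u^2 + u*v + v^2 < p^2" for u v :: int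
  proof (rule ccontr)
    assume "\<not> \<bar>u\<bar> \<le> 2*p"
    then have "(2*p)^2 \<le> \<bar>u\<bar>^2" using assms(2) by (intro power_mono) auto
    then have u: "4*p^2 \<le> u^2" by (simp add: power_mult_distrib)
    have "0 < p^2" using assms(2) by simp
    moreover have False if "3*w \<le> 4*t" "0 < q" "t < q" "4*q \<le> w" for t w q :: int
      using that by linarith
    ultimately show False using loeschian_lower[of u v] \<open>u^2 + u*v + v^2 < p^2\<close> u by blast
  qed
  show ?thesis using *[of x y] *[of y x] assms(1) by (simp add: algebra_simps)
qed

text \<open>A nonzero \<open>inde M\<close> means that the images of two neighbouring centres are
  separated by the geodesic from 0 to infinity, so t^2 < s^2 below. As s^2 - p^2 = 4abcd, this
  bounds a definite form in ac and bd by p^2.\<close>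

lemma inde_support:
  assumes "odd p" "p > 0"
  shows "finite {M. det4 M = p \<and> inde M \<noteq> 0}"
proof (rule finite_matI[where K="2*p"])
  fix a b c d assume "(a,b,c,d) \<in> {M. det4 M = p \<and> inde M \<noteq> 0}"
  then have det: "a*d - b*c = p" and i: "inde (a,b,c,d) \<noteq> 0" by auto
  define s t where "s = a*d + b*c" and "t = 2*a*c + 2*b*d"
  have "sg (a,b,c,d) = t + s" "sg (rS (a,b,c,d)) = t - s" by (simp_all add: s_def t_def algebra_simps)
  then have "\<bar>t\<bar> \<le> \<bar>s\<bar>" using i by (auto simp: inde_def lft_def of_bool_def split: if_splits)
  moreover have "odd (s + t)" using sg_odd[of "(a,b,c,d)"] det assms(1) by (simp add: s_def t_def algebra_simps)
  ultimately have "\<bar>t\<bar> < \<bar>s\<bar>" by (cases "\<bar>t\<bar> = \<bar>s\<bar>") (auto simp: abs_eq_iff)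
  then have st: "t^2 < s^2" by (simp add: power2_strict_mono)
  have "4*((a*c)^2 + (a*c)*(b*d) + (b*d)^2) = t^2 - s^2 + (a*d - b*c)^2"
    unfolding s_def t_def by (simp add: algebra_simps power2_eq_square)
  then have "4*((a*c)^2 + (a*c)*(b*d) + (b*d)^2) < p^2" using st det by simp
  moreover have "t < q" if "4*t < q" "0 \<le> t" for t q :: int using that by linarith
  ultimately have "(a*c)^2 + (a*c)*(b*d) + (b*d)^2 < p^2" using loeschian_nonneg by blast
  from quad_bound[OF this assms(2)] have ac: "\<bar>a*c\<bar> \<le> 2*p" and bd: "\<bar>b*d\<bar> \<le> 2*p" by auto
  \<comment> \<open>If x = 0, the product says nothing about y; then the determinant is, up to sign,
    a product of two entries and bounds y instead.\<close>
  have az: "\<bar>y\<bar> \<le> 2*p" if "\<bar>x*y\<bar> \<le> 2*p" "x = 0 \<longrightarrow> \<bar>y\<bar> \<le> p" for x y :: int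
    using that abs_le_abs_mult[of x y] assms(2) by (cases "x = 0") (auto simp: mult.commute)
  show "\<bar>a\<bar> \<le> 2*p \<and> \<bar>b\<bar> \<le> 2*p \<and> \<bar>c\<bar> \<le> 2*p \<and> \<bar>d\<bar> \<le> 2*p"
  proof (intro conjI)
    have "c = 0 \<longrightarrow> \<bar>a\<bar> \<le> p" "a = 0 \<longrightarrow> \<bar>c\<bar> \<le> p" "d = 0 \<longrightarrow> \<bar>b\<bar> \<le> p" "b = 0 \<longrightarrow> \<bar>d\<bar> \<le> p"
      using abs_le_bound[of a d p] abs_le_bound[of b c p] det assms(2) by auto
    then show "\<bar>a\<bar> \<le> 2*p" "\<bar>b\<bar> \<le> 2*p" "\<bar>c\<bar> \<le> 2*p" "\<bar>d\<bar> \<le> 2*p"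
      using az[of c a] az[of a c] az[of d b] az[of b d] ac bd by (simp_all add: mult.commute)
  qed
qed

text \<open>Here \<open>\<alpha>\<close>, \<open>\<beta>\<close>, \<open>\<gamma>\<close> are the coefficients of the definite form with root \<open>M \<rho>\<close>; it has
  discriminant \<open>-3p\<^sup>2\<close>.\<close>

lemma fixv_support:
  assumes "odd p" "p > 0"
  shows "finite {M. det4 M = p \<and> fixv M \<noteq> 0}"
proof (rule finite_matI[where K="4*p^2"])
  fix a b c d assume "(a,b,c,d) \<in> {M. det4 M = p \<and> fixv M \<noteq> 0}"
  then have det: "a*d - b*c = p" and f: "fixv (a,b,c,d) \<noteq> 0" by auto
  define \<alpha> where "\<alpha> = c^2 + c*d + d^2"
  define \<beta> where "\<beta> = 2*a*c + 2*b*d + a*d + b*c"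
  define \<gamma> where "\<gamma> = a^2 + a*b + b^2"
  have s: "sg (a,b,c,d) = \<beta>" "sg (lV (a,b,c,d)) = 2*\<alpha> - \<beta>" "sg (lV (lV (a,b,c,d))) = 2*\<gamma> - \<beta>"
    by (simp_all add: \<alpha>_def \<beta>_def \<gamma>_def algebra_simps power2_eq_square)
  have odd: "odd \<beta>" "odd (2*\<alpha> - \<beta>)" "odd (2*\<gamma> - \<beta>)"
    using sg_odd[of "(a,b,c,d)"] det assms(1) s by auto
  have "4*\<alpha>*\<gamma> - \<beta>^2 = 3*(a*d - b*c)^2"
    unfolding \<alpha>_def \<beta>_def \<gamma>_def by (simp add: algebra_simps power2_eq_square)
  then have disc: "4*\<alpha>*\<gamma> - \<beta>^2 = 3*p^2" using det by simp
  have a0: "0 \<le> \<alpha>" "0 \<le> \<gamma>" using loeschian_nonneg by (simp_all add: \<alpha>_def \<gamma>_def)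
  define x y where "x = 2*\<alpha> - \<beta>" and "y = 2*\<gamma> - \<beta>"
  have e: "x*y + \<beta>*(x + y) = 3*p^2"
    using disc unfolding x_def y_def by (simp add: algebra_simps power2_eq_square)
  \<comment> \<open>A point cannot lie behind two sides of the triangle; for the other two pairs of
    sides \<open>\<alpha>\<close> and \<open>\<gamma>\<close> being nonnegative suffices.\<close>
  have "\<not> (x < 0 \<and> y < 0)"
  proof
    assume "x < 0 \<and> y < 0"
    then have "2*\<alpha> \<le> \<beta>" "2*\<gamma> \<le> \<beta>" by (auto simp: x_def y_def)
    then have "(2*\<alpha>)*(2*\<gamma>) \<le> \<beta>*\<beta>" using a0 by (intro mult_mono) auto
    then have "3*p^2 \<le> 0" using disc by (simp add: power2_eq_square algebra_simps)
    then show False using assms(2) by simp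
  qed
  moreover have "fixv (a,b,c,d) = 1 - of_bool (\<beta> < 0) - of_bool (x < 0) - of_bool (y < 0)"
    unfolding fixv_def lft_def s x_def y_def ..
  ultimately have "0 \<le> \<beta> \<and> 0 \<le> x \<and> 0 \<le> y" using f a0
    by (auto simp: x_def y_def of_bool_def split: if_splits)
  moreover have "\<beta> \<noteq> 0" "x \<noteq> 0" "y \<noteq> 0" using odd by (auto simp: x_def y_def)
  ultimately have p1: "1 \<le> \<beta>" "1 \<le> x" "1 \<le> y" by auto
  have "1 \<le> \<beta>*y" "1 \<le> \<beta>*x" "1 \<le> x*y" using p1 mult_mono[of 1 _ 1 _] by (metis mult_1 zero_le_one order_trans)+
  moreover have "x \<le> x*y" "y \<le> x*y" "\<beta> \<le> \<beta>*x" using p1 by (simp_all add: mult_le_cancel_left1 mult_le_cancel_right1)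
  ultimately have "2*\<alpha> \<le> 6*p^2" "2*\<gamma> \<le> 6*p^2" using e by (simp_all add: x_def y_def algebra_simps)
  then have ag: "\<alpha> \<le> 3*p^2" "\<gamma> \<le> 3*p^2" by auto
  have bd: "\<bar>u\<bar> \<le> 4*p^2" if "u^2 + u*v + v^2 \<le> 3*p^2" for u v :: int
  proof -
    have "w \<le> 4*q" if "3*w \<le> 4*t" "t \<le> 3*q" for t w q :: int using that by linarith
    then have "u^2 \<le> 4*p^2" using loeschian_lower that by blast
    moreover have "\<bar>u\<bar> \<le> u^2" by (cases "u = 0") (use abs_le_abs_mult[of u u] in \<open>auto simp: power2_eq_square\<close>)
    ultimately show ?thesis by linarith
  qed
  have "d^2 + d*c + c^2 = \<alpha>" "b^2 + b*a + a^2 = \<gamma>" by (simp_all add: \<alpha>_def \<gamma>_def algebra_simps)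
  then have "d^2 + d*c + c^2 \<le> 3*p^2" "b^2 + b*a + a^2 \<le> 3*p^2" using ag by simp_all
  then show "\<bar>a\<bar> \<le> 4*p^2 \<and> \<bar>b\<bar> \<le> 4*p^2 \<and> \<bar>c\<bar> \<le> 4*p^2 \<and> \<bar>d\<bar> \<le> 4*p^2"
    using bd[of a b] bd[of b a] bd[of c d] bd[of d c] ag by (simp add: \<alpha>_def \<gamma>_def)
qed

subsection \<open>Lefschetz numbers and class numbers\<close>

text \<open>\<open>A\<close>, \<open>C\<close>, \<open>E\<close> are the values of the form at the
  cusps infinity, 0 and 1. For opposite signs of \<open>A\<close> and \<open>C\<close> the side from
  0 to infinity separates the real roots, and the sign pattern tells which one attracts (for
  positive trace). For equal signs the roots lie on one side, decided by B = E - A - C.\<close>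

definition toward :: "int \<Rightarrow> int \<Rightarrow> int \<Rightarrow> bool" where
  "toward A C E \<longleftrightarrow> (A \<le> 0 \<and> 0 \<le> C \<and> (A \<noteq> 0 \<or> C \<noteq> 0)) \<or> (0 < A \<and> 0 < C \<and> A + C < E)
     \<or> (A < 0 \<and> C < 0 \<and> E < A + C)"

text \<open>The fixed points of \<open>M\<close> are the roots of the form \<open>(A, B, C) = (c, d - a, -b)\<close>, and
  \<open>E = A + B + C\<close>. The arrow points towards the fixed point in the upper half plane if there is
  one and otherwise, provided the trace is positive, towards the attracting fixed point.
  If the fixed points are rational, some vertices have two arrows, and \<open>1 - X M - \<dots>\<close> is \<open>-1\<close> there.\<close>

fun dirn :: "mat \<Rightarrow> real" where
  "dirn (a, b, c, d) = of_bool (toward c (- b) (c + d - a - b))"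

lemma dirn_conj:
  "dirn (cU (a, b, c, d)) = of_bool (toward (- b) (c + d - a - b) c)"
  "dirn (cU (cU (a, b, c, d))) = of_bool (toward (c + d - a - b) c (- b))"
  "dirn (cS (a, b, c, d)) = of_bool (toward (- b) c (a + c - b - d))"
  by (simp_all add: algebra_simps)

text \<open>Here e and m stand for the absolute values of a - d and c - b, and the expression is a
  lower bound for twice \<open>sg\<close>. Since m is at least e - t, it is at least e(e - 4t) +
  3t^2 - 2p, which is where the threshold 4t + 2p + 2 comes from.\<close>

lemma attract_core:
  fixes e m t p :: int
  assumes "e^2 - t^2 \<le> m^2" "0 < m" "4*t + 2*p + 2 \<le> e" "0 \<le> t" "0 < p"
  shows "0 < t^2 - e^2 - 2*p + 2*m*(e - t)"
proof -
  have et: "0 < e - t" using assms by linarith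
  have "(e - t)^2 = e^2 - t^2 - 2*t*(e - t)" by (simp add: algebra_simps power2_eq_square)
  moreover have "0 \<le> 2*t*(e - t)" using et assms by simp
  ultimately have "(e - t)^2 \<le> m^2" using assms by linarith
  then have "e - t \<le> m" using assms(2) power2_le_imp_le[of "e - t" m] by simp
  then have "(e - t)*(e - t) \<le> m*(e - t)" using et by (intro mult_right_mono) auto
  then have 1: "2*((e - t)*(e - t)) \<le> 2*m*(e - t)" by simp
  have "e*(2*p + 2) \<le> e*(e - 4*t)" using assms by (intro mult_left_mono) auto
  moreover have "2*p < e*(2*p + 2)"
  proof -
    have "1*(2*p + 2) \<le> e*(2*p + 2)" using assms by (intro mult_right_mono) auto
    then show ?thesis by simp
  qed
  ultimately have 2: "2*p < e*(e - 4*t)" by linarith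
  have "t^2 - e^2 - 2*p + 2*((e - t)*(e - t)) = e*(e - 4*t) + 3*t^2 - 2*p"
    by (simp add: algebra_simps power2_eq_square)
  moreover have "0 \<le> t^2" by simp
  ultimately show ?thesis using 1 2 by linarith
qed

lemma attract_core':
  fixes e m t p :: int
  assumes "4*t + 2*p + 2 \<le> e" "0 \<le> t" "0 < p" "0 < m"
  shows "t^2 - e^2 - 2*p + 2*m*(t - e) < 0"
proof -
  have "t^2 \<le> e^2" using assms by (intro power_mono) auto
  moreover have "0 < m*(e - t)" using assms by simp
  moreover have "2*m*(t - e) = - 2*(m*(e - t))" by (simp add: algebra_simps)
  ultimately show ?thesis using assms(3) by linarith
qed

text \<open>For large |a - d| the product bc is negative, so c and -b have equal signs and
  \<open>dirn\<close> depends on the sign of a - d only. The same sign governs \<open>sg\<close>,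
  because |b + c| is at most |c - b|, which in turn is large.\<close>

lemma dirn_agrees:
  fixes a b c d p t :: int
  assumes det: "a*d - b*c = p" and tr: "a + d = t" and p: "0 < p" and t: "0 \<le> t"
    and bc: "b*c \<noteq> 0" and e: "4*t + 2*p + 2 \<le> \<bar>a - d\<bar>"
  shows "dirn (a,b,c,d) = lft (a,b,c,d)"
proof -
  define e where "e = a - d"
  have s2: "2*sg (a,b,c,d) = t^2 - e^2 - 2*p + 2*t*(b + c) + 2*e*(c - b)"
    unfolding e_def tr[symmetric] det[symmetric] by (simp add: algebra_simps power2_eq_square)
  have bc4: "4*(b*c) = t^2 - 4*p - e^2"
    unfolding e_def tr[symmetric] det[symmetric] by (simp add: algebra_simps power2_eq_square)
  have "t^2 \<le> \<bar>e\<bar>^2" using assms(6) t p unfolding e_def by (intro power_mono) auto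
  then have "4*(b*c) < 0" using bc4 p by simp
  then have neg: "b*c < 0" by simp
  have m2: "e^2 - t^2 \<le> (c - b)^2"
  proof -
    have "(c - b)^2 = (c + b)^2 - 4*(b*c)" by (simp add: algebra_simps power2_eq_square)
    moreover have "0 \<le> (c + b)^2" by simp
    ultimately show ?thesis using bc4 p by linarith
  qed
  have el: "4*t + 2*p + 2 \<le> e \<or> 4*t + 2*p + 2 \<le> - e" using assms(6) by (auto simp: e_def)
  consider "b < 0" "0 < c" | "0 < b" "c < 0" using neg by (auto simp: mult_less_0_iff)
  then show ?thesis
  proof cases
    case 1
    have tm: "t*(b + c) \<le> t*(c - b)" "- (t*(c - b)) \<le> t*(b + c)"
      using mult_left_mono[of "b + c" "c - b" t] mult_left_mono[of "b - c" "b + c" t] 1 t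
      by (simp_all add: algebra_simps)
    from el show ?thesis
    proof
      assume h: "4*t + 2*p + 2 \<le> e"
      have "0 < t^2 - e^2 - 2*p + 2*(c - b)*(e - t)"
        using attract_core[OF m2 _ h t p] 1 by simp
      then have "0 < 2*sg (a,b,c,d)" unfolding s2 using tm by (simp add: algebra_simps)
      then show ?thesis using 1 h t p by (simp add: lft_def toward_def e_def)
    next
      assume h: "4*t + 2*p + 2 \<le> - e"
      have "t^2 - (-e)^2 - 2*p + 2*(c - b)*(t - (-e)) < 0"
        using attract_core'[OF h t p, of "c - b"] 1 by simp
      then have "2*sg (a,b,c,d) < 0" unfolding s2 using tm by (simp add: algebra_simps)
      then show ?thesis using 1 h t p by (simp add: lft_def toward_def e_def)
    qed
  next
    case 2
    have tm: "t*(b + c) \<le> t*(b - c)" "- (t*(b - c)) \<le> t*(b + c)"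
      using mult_left_mono[of "b + c" "b - c" t] mult_left_mono[of "c - b" "b + c" t] 2 t
      by (simp_all add: algebra_simps)
    from el show ?thesis
    proof
      assume h: "4*t + 2*p + 2 \<le> e"
      have "t^2 - e^2 - 2*p + 2*(b - c)*(t - e) < 0"
        using attract_core'[OF h t p, of "b - c"] 2 by simp
      then have "2*sg (a,b,c,d) < 0" unfolding s2 using tm by (simp add: algebra_simps)
      then show ?thesis using 2 h t p by (simp add: lft_def toward_def e_def)
    next
      assume h: "4*t + 2*p + 2 \<le> - e"
      have "(-e)^2 - t^2 \<le> (b - c)^2" using m2 by (simp add: power2_commute)
      then have "0 < t^2 - (-e)^2 - 2*p + 2*(b - c)*((-e) - t)"
        using attract_core[OF _ _ h t p, of "b - c"] 2 by simp
      then have "0 < 2*sg (a,b,c,d)" unfolding s2 using tm by (simp add: algebra_simps)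
      then show ?thesis using 2 h t p by (simp add: lft_def toward_def e_def)
    qed
  qed
qed

text \<open>One fixed point is the cusp 0 or infinity, and \<open>sg\<close> is p + 2bd or p + 2ac.
  Once the off-diagonal entry reaches p in absolute value, it determines the sign.\<close>

lemma dirn_agrees_triangular:
  fixes a b c d p t :: int
  assumes det: "a*d - b*c = p" and tr: "a + d = t" and p: "0 < p" and t: "0 \<le> t"
    and bc: "b*c = 0" and big: "p \<le> \<bar>b\<bar> \<or> p \<le> \<bar>c\<bar>"
  shows "dirn (a,b,c,d) = lft (a,b,c,d)"
proof -
  have ad: "a*d = p" using det bc by simp
  then have pos: "0 < a" "0 < d" using p t tr by (auto simp: zero_less_mult_iff)
  have big': "p < 2*(x*y)" if "p \<le> x" "0 < y" for x y :: int
  proof -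
    have "x*1 \<le> x*y" using that p by (intro mult_left_mono) auto
    then show ?thesis using that p by linarith
  qed
  consider "c = 0" "p \<le> b" | "c = 0" "p \<le> - b" | "b = 0" "p \<le> c" | "b = 0" "p \<le> - c"
    using bc big p by force
  then show ?thesis
  proof cases
    case 1
    then have "sg (a,b,c,d) = p + 2*(b*d)" using ad by (simp add: algebra_simps)
    moreover have "p < 2*(b*d)" using big'[of "b" d] 1 pos by simp
    ultimately have "0 < sg (a,b,c,d)" using p by (simp del: sg.simps)
    then show ?thesis using 1 p by (simp add: lft_def toward_def del: sg.simps)
  next
    case 2
    then have "sg (a,b,c,d) = p + 2*(b*d)" using ad by (simp add: algebra_simps)
    moreover have "p < 2*(-b*d)" using big'[of "-b" d] 2 pos by simp
    ultimately have "sg (a,b,c,d) < 0" using p by (simp del: sg.simps)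
    then show ?thesis using 2 p by (simp add: lft_def toward_def del: sg.simps)
  next
    case 3
    then have "sg (a,b,c,d) = p + 2*(c*a)" using ad by (simp add: algebra_simps)
    moreover have "p < 2*(c*a)" using big'[of "c" a] 3 pos by simp
    ultimately have "0 < sg (a,b,c,d)" using p by (simp del: sg.simps)
    then show ?thesis using 3 p by (simp add: lft_def toward_def del: sg.simps)
  next
    case 4
    then have "sg (a,b,c,d) = p + 2*(c*a)" using ad by (simp add: algebra_simps)
    moreover have "p < 2*(-c*a)" using big'[of "-c" a] 4 pos by simp
    ultimately have "sg (a,b,c,d) < 0" using p by (simp del: sg.simps)
    then show ?thesis using 4 p by (simp add: lft_def toward_def del: sg.simps)
  qed
qed

text \<open>Where neither comparison applies, the matrix is bounded: t and a - d bound the diagonal,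
  and 4bc = t^2 - 4p - (a - d)^2 bounds b and c when bc is nonzero.\<close>

lemma finite_dirn_neq:
  assumes p: "0 < p" and t: "0 \<le> t"
  shows "finite {M. (det4 M = p \<and> tr4 M = t) \<and> lft M \<noteq> dirn M}"
proof -
  define K where "K = 4*t + 2*p + 2"
  have K: "0 < K" using p t by (simp add: K_def)
  show ?thesis
  proof (rule finite_matI[where K="t^2 + 4*p + K^2 + t + K"])
    fix a b c d assume "(a,b,c,d) \<in> {M. (det4 M = p \<and> tr4 M = t) \<and> lft M \<noteq> dirn M}"
    then have det: "a*d - b*c = p" and tr: "a + d = t" and ne: "dirn (a,b,c,d) \<noteq> lft (a,b,c,d)" by auto
    have pp: "0 \<le> t^2" "0 \<le> K^2" by simp_all
    show "\<bar>a\<bar> \<le> t^2 + 4*p + K^2 + t + K \<and> \<bar>b\<bar> \<le> t^2 + 4*p + K^2 + t + K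
        \<and> \<bar>c\<bar> \<le> t^2 + 4*p + K^2 + t + K \<and> \<bar>d\<bar> \<le> t^2 + 4*p + K^2 + t + K"
    proof (cases "b*c = 0")
      case True
      then have "\<bar>b\<bar> < p" "\<bar>c\<bar> < p" using dirn_agrees_triangular[OF det tr p t True] ne by linarith+
      moreover have "\<bar>a\<bar> \<le> p \<and> \<bar>d\<bar> \<le> p" using abs_le_bound[of a d p] det True p by simp
      ultimately show ?thesis using pp K t p by linarith
    next
      case False
      then have e: "\<bar>a - d\<bar> < K" using dirn_agrees[OF det tr p t False] ne unfolding K_def by linarith
      have bc4: "4*(b*c) = t^2 - 4*p - (a - d)^2"
        unfolding tr[symmetric] det[symmetric] by (simp add: algebra_simps power2_eq_square)
      have "\<bar>a - d\<bar>^2 \<le> K^2" using e by (intro power_mono) auto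
      then have "(a - d)^2 \<le> K^2" by simp
      moreover have "0 \<le> (a - d)^2" by simp
      ultimately have "\<bar>4*(b*c)\<bar> \<le> t^2 + 4*p + K^2" unfolding bc4 using pp p by linarith
      moreover have "\<bar>b*c\<bar> \<le> \<bar>4*(b*c)\<bar>" by (simp add: abs_mult)
      moreover have "\<bar>b\<bar> \<le> \<bar>b*c\<bar>" "\<bar>c\<bar> \<le> \<bar>b*c\<bar>"
        using abs_le_abs_mult[of c b] abs_le_abs_mult[of b c] False by (simp_all add: mult.commute)
      moreover have "\<bar>a\<bar> \<le> t + K" "\<bar>d\<bar> \<le> t + K" using e tr t by linarith+
      ultimately show ?thesis using pp K t p by linarith
    qed
  qed
qed

text \<open>Letting M vary while the triangle and the side stay fixed amounts to running over
  conjugacy classes and, for each, over all triangles and sides modulo the centraliser.\<close>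

definition lnum :: "int \<Rightarrow> int \<Rightarrow> real" where
  "lnum p t = Sum_any (\<lambda>M. of_bool (det4 M = p \<and> tr4 M = t) * (fixv M / 3 - inde M / 2))"

lemma finite_support_L:
  assumes "odd p" "0 < p"
  shows "finite {M. of_bool (det4 M = p \<and> P M) * (fixv M / 3 - inde M / 2) \<noteq> (0::real)}"
  by (rule finite_subset[OF _ finite_UnI[OF inde_support[OF assms] fixv_support[OF assms]]]) auto

lemma lnum_dirn:
  assumes "odd p" "0 < p" "0 \<le> t"
  shows "lnum p t = Sum_any (\<lambda>M. of_bool (det4 M = p \<and> tr4 M = t) * lef dirn M)"
proof -
  let ?k = "\<lambda>M. of_bool (det4 M = p \<and> tr4 M = t) :: real"
  have eq: "?k M * (fixv M / 3 - inde M / 2) = ?k M * lef lft M" for M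
    using lef_lft[of M] assms(1) by auto
  have "lnum p t = Sum_any (\<lambda>M. ?k M * lef lft M)" unfolding lnum_def eq ..
  also have "\<dots> = Sum_any (\<lambda>M. ?k M * lef dirn M)"
  proof (rule lef_finite_change)
    show "finite {M. ?k M * lef lft M \<noteq> 0}" using finite_support_L[OF assms(1,2), of "\<lambda>M. tr4 M = t"] by (simp only: eq)
    show "finite {M. ?k M * (lft M - dirn M) \<noteq> 0}"
      by (rule finite_subset[OF _ finite_dirn_neq[OF assms(2,3)]]) auto
  qed simp_all
  finally show ?thesis .
qed

lemma lnum_neg: "lnum p (- t) = lnum p t"
proof -
  have l: "lft (neg4 M) = lft M" for M by (simp add: lft_def sg_ops)
  have c: "rS (neg4 M) = neg4 (rS M)" "lV (neg4 M) = neg4 (lV M)" for M by (cases M; simp)+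
  define f where "f t M = of_bool (det4 M = p \<and> tr4 M = t) * (fixv M / 3 - inde M / 2)" for t M
  have f: "f (- t) (neg4 M) = f t M" for M
    by (simp add: f_def fixv_def inde_def c l)
  have "Sum_any (f (- t)) = Sum_any (\<lambda>M. f (- t) (neg4 M))"
    using Sum_any_bij[OF bij_neg4] by metis
  also have "\<dots> = Sum_any (f t)" by (simp only: f)
  finally show ?thesis by (simp add: lnum_def f_def[abs_def])
qed

lemma lnum_abs: "lnum p t = lnum p \<bar>t\<bar>"
  using lnum_neg[of p t] by (cases "t \<ge> 0") auto

text \<open>The quantities A + C - E, A + E - C, C + E - A are the Selling parameters -B, 2A + B, 2C
  + B. Unless they all have one sign, the chosen root lies behind exactly one side of the
  triangle.\<close>

lemma toward_hyperbolic:
  assumes "A \<noteq> 0" "C \<noteq> 0" "E \<noteq> 0"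
    "\<not> (0 \<le> A + C - E \<and> 0 \<le> A + E - C \<and> 0 \<le> C + E - A)"
    "\<not> (A + C - E \<le> 0 \<and> A + E - C \<le> 0 \<and> C + E - A \<le> 0)"
  shows "of_bool (toward A C E) + of_bool (toward C E A) + of_bool (toward E A C) = (1::real)"
proof -
  consider "0 < A" "0 < C" "0 < E" | "0 < A" "0 < C" "E < 0" | "0 < A" "C < 0" "0 < E" | "0 < A" "C < 0" "E < 0"
    | "A < 0" "0 < C" "0 < E" | "A < 0" "0 < C" "E < 0" | "A < 0" "C < 0" "0 < E" | "A < 0" "C < 0" "E < 0"
    using assms(1-3) unfolding neq_iff by blast
  then show ?thesis
  proof cases
    case 1
    moreover have "A + C < E \<or> A + E < C \<or> C + E < A" using assms(4) by auto
    ultimately show ?thesis by (elim disjE) (simp_all add: toward_def)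
  next
    case 8
    moreover have "E < A + C \<or> C < A + E \<or> A < C + E" using assms(5) by auto
    ultimately show ?thesis by (elim disjE) (simp_all add: toward_def)
  qed (simp_all add: toward_def)
qed

text \<open>\<open>2*A + 2*C - E\<close> is the value at the cusp -1, the third vertex of the
  neighbouring triangle. The excluded cases are roots at both ends of the side and a definite form
  with root on it.\<close>

lemma toward_flip:
  assumes "A \<noteq> 0 \<or> C \<noteq> 0" "E = A + C \<longrightarrow> \<not> (0 < A \<and> 0 < C) \<and> \<not> (A < 0 \<and> C < 0)"
  shows "of_bool (toward A C E) + of_bool (toward C A (2*A + 2*C - E)) = (1::real)"
proof -
  consider "0 < A" "0 < C" | "0 < A" "C \<le> 0" | "A = 0" | "A < 0" "C < 0" | "A < 0" "0 \<le> C"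
    using not_less_iff_gr_or_eq[of A 0] not_less[of 0 C] not_less[of C 0] by blast
  then show ?thesis
  proof cases
    case 1
    then have "E < A + C \<or> A + C < E" using assms(2) by auto
    then show ?thesis using 1 by (auto simp: toward_def)
  next
    case 4
    then have "E < A + C \<or> A + C < E" using assms(2) by auto
    then show ?thesis using 4 by (auto simp: toward_def)
  qed (use assms(1) in \<open>auto simp: toward_def of_bool_def\<close>)
qed

lemma definite_disc:
  fixes A B C E :: int
  assumes "E = A + B + C"
    and "(0 \<le> A + C - E \<and> 0 \<le> A + E - C \<and> 0 \<le> C + E - A) \<or>
         (A + C - E \<le> 0 \<and> A + E - C \<le> 0 \<and> C + E - A \<le> 0)"
  shows "B^2 - 4*A*C \<le> 0"
proof -
  define x y z where "x = A + C - E" and "y = A + E - C" and "z = C + E - A"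
  have "B^2 - 4*A*C = - (x*y + x*z + y*z)"
    unfolding x_def y_def z_def assms(1) by (simp add: algebra_simps power2_eq_square)
  moreover have "(0 \<le> x \<and> 0 \<le> y \<and> 0 \<le> z) \<or> (x \<le> 0 \<and> y \<le> 0 \<and> z \<le> 0)"
    using assms(2) unfolding x_def y_def z_def .
  then have "0 \<le> x*y" "0 \<le> x*z" "0 \<le> y*z" by (auto simp: mult_nonpos_nonpos)
  ultimately show ?thesis by linarith
qed

lemma form_disc:
  assumes "a*d - b*c = (p::int)" "a + d = t"
  shows "(d - a)^2 - 4*c*(- b) = t^2 - 4*p"
  unfolding assms[symmetric] by (simp add: algebra_simps power2_eq_square)

lemma lef_dirn:
  "lef dirn (a, b, c, d) =
    (1 - (of_bool (toward c (- b) (c + d - a - b)) + of_bool (toward (- b) (c + d - a - b) c)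
        + of_bool (toward (c + d - a - b) c (- b)))) / 3
    - (1 - (of_bool (toward c (- b) (c + d - a - b)) + of_bool (toward (- b) c (a + c - b - d)))) / 2"
  unfolding lef_def dirn_conj by simp

text \<open>A fixed point at 0, 1 or infinity would give integral eigenvalues with product p and
  positive sum, hence trace p + 1. Otherwise every triangle and every side has exactly one arrow,
  and all terms vanish.\<close>

lemma lnum_hyperbolic:
  assumes p: "prime p" "odd p" and t: "0 \<le> t" "4*p < t^2" "t \<noteq> p + 1"
  shows "lnum p t = 0"
proof -
  have p0: "0 < p" using p prime_gt_0_int by blast
  have tri: "a + d = p + 1" if "a*d = p" "a + d = t" for a d
  proof -
    have "a dvd p" using that by auto
    then have "\<bar>a\<bar> = 1 \<or> \<bar>a\<bar> = p" using p(1) by (metis prime_int_iff zdvd1_eq abs_dvd_iff abs_ge_zero)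
    moreover have "0 < a" using that p0 t by (auto simp: zero_less_mult_iff)
    ultimately show ?thesis using that p0 by auto
  qed
  have "lef dirn M = 0" if M: "det4 M = p" "tr4 M = t" for M
  proof -
    obtain a b c d where Me: "M = (a, b, c, d)" by (cases M)
    have det: "a*d - b*c = p" and tr: "a + d = t" using M Me by auto
    have nz: "c \<noteq> 0" "b \<noteq> 0" using tri[of a d] det tr t(3) by auto
    have E: "c + d - a - b \<noteq> 0"
    proof
      assume "c + d - a - b = 0"
      then have d: "d = a + b - c" by simp
      \<comment> \<open>Now (1, 1) is an eigenvector with eigenvalue a + b, and a - c is the other
        eigenvalue.\<close>
      have "(a + b)*(a - c) = p" "(a + b) + (a - c) = t" using det tr unfolding d by (simp_all add: algebra_simps)
      then show False using tri t(3) by metis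
    qed
    have disc: "0 < (d - a)^2 - 4*c*(- b)" using form_disc[OF det tr] t(2) by simp
    have Es: "c + d - a - b = c + (d - a) + (- b)" by simp
    have nd: "\<not> (0 \<le> c + (- b) - (c + d - a - b) \<and> 0 \<le> c + (c + d - a - b) - (- b) \<and> 0 \<le> (- b) + (c + d - a - b) - c)"
       "\<not> (c + (- b) - (c + d - a - b) \<le> 0 \<and> c + (c + d - a - b) - (- b) \<le> 0 \<and> (- b) + (c + d - a - b) - c \<le> 0)"
      using definite_disc[OF Es] disc by linarith+
    have h: "of_bool (toward c (- b) (c + d - a - b)) + of_bool (toward (- b) (c + d - a - b) c)
        + of_bool (toward (c + d - a - b) c (- b)) = (1::real)"
      by (rule toward_hyperbolic) (use nz E nd in auto)
    have "(c + d - a - b) = c + (- b) \<longrightarrow> \<not> (0 < c \<and> 0 < - b) \<and> \<not> (c < 0 \<and> - b < 0)"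
    proof (intro impI)
      assume "(c + d - a - b) = c + (- b)"
      then have "0 < 4*(c*b)" using disc by simp
      then show "\<not> (0 < c \<and> 0 < - b) \<and> \<not> (c < 0 \<and> - b < 0)" by (auto simp: zero_less_mult_iff)
    qed
    from toward_flip[OF _ this] nz
    have "of_bool (toward c (- b) (c + d - a - b)) + of_bool (toward (- b) c (a + c - b - d)) = (1::real)"
      by (simp add: algebra_simps)
    then show ?thesis unfolding Me lef_dirn h by simp
  qed
  then have "(\<lambda>M. of_bool (det4 M = p \<and> tr4 M = t) * lef dirn M) = (\<lambda>M. 0)" by auto
  then show ?thesis using lnum_dirn[OF p(2) p0 t(1)] by (simp only: Sum_any.neutral)
qed

text \<open>A second arrow occurs when one vertex is the attracting fixed point and the repelling
  one lies strictly behind the opposite side: both sides at that vertex are then crossed.\<close>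

lemma toward_split:
  assumes "E = A + B + C" "0 < B^2 - 4*A*C"
  shows "of_bool (toward A C E) + of_bool (toward C E A) + of_bool (toward E A C) =
    (1::real) + of_bool (A = 0 \<and> 0 < C \<and> E < 0) + of_bool (C = 0 \<and> 0 < E \<and> A < 0) + of_bool (E = 0 \<and> 0 < A \<and> C < 0)"
proof -
  have nd: "\<not> (0 \<le> A + C - E \<and> 0 \<le> A + E - C \<and> 0 \<le> C + E - A)"
    "\<not> (A + C - E \<le> 0 \<and> A + E - C \<le> 0 \<and> C + E - A \<le> 0)"
    using definite_disc[OF assms(1)] assms(2) by linarith+
  show ?thesis
  proof (cases "A = 0 \<or> C = 0 \<or> E = 0")
    case False
    then show ?thesis using toward_hyperbolic[OF _ _ _ nd] by simp
  next
    case True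
    consider "A = 0" "C = 0" "E \<noteq> 0" | "A = 0" "E = 0" "C \<noteq> 0" | "C = 0" "E = 0" "A \<noteq> 0"
      | "A = 0" "C \<noteq> 0" "E \<noteq> 0" | "C = 0" "A \<noteq> 0" "E \<noteq> 0" | "E = 0" "A \<noteq> 0" "C \<noteq> 0"
      using True assms nd by force
    then show ?thesis
      by cases (auto simp: toward_def of_bool_def neq_iff)
  qed
qed

text \<open>\<open>R\<close> consists of the p - 2 matrices with attracting fixed point infinity and
  repelling fixed point j/(p - 1) strictly between 0 and 1; their triangles have two arrows.
  \<open>Z\<close> consists of the two matrices fixing 0 and infinity, for which the base side has
  no arrow. The total is -(p - 2) - 1.\<close>

lemma lnum_split:
  assumes p: "prime p" "odd p" shows "lnum p (p + 1) = - (real_of_int p - 1)"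
proof -
  have p0: "2 < p" using p prime_ge_2_int[of p] by (cases "p = 2") auto
  define R where "R = (\<lambda>j. (p, - j, 0::int, 1::int)) ` {1..p - 2}"
  define Z where "Z = {(p, 0::int, 0::int, 1), (1, 0, 0, p)}"
  let ?k = "\<lambda>M. of_bool (det4 M = p \<and> tr4 M = p + 1) :: real"
  have diag: "(a = p \<and> d = 1) \<or> (a = 1 \<and> d = p)" if "a*d = p" "a + d = p + 1" for a d
  proof -
    have "(a - 1)*(a - p) = a*(a + d) - a*d - a*(p + 1) + p" by (simp add: algebra_simps)
    also have "\<dots> = 0" using that by simp
    finally show ?thesis using that by auto
  qed
  have R: "M \<in> R \<longleftrightarrow> det4 M = p \<and> tr4 M = p + 1 \<and> (case M of (a,b,c,d) \<Rightarrow> c = 0 \<and> b < 0 \<and> c + d - a - b < 0)" for M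
  proof -
    obtain a b c d where M: "M = (a,b,c,d)" by (cases M)
    show ?thesis
    proof
      assume "M \<in> R" then show "det4 M = p \<and> tr4 M = p + 1 \<and> (case M of (a,b,c,d) \<Rightarrow> c = 0 \<and> b < 0 \<and> c + d - a - b < 0)"
        by (auto simp: R_def)
    next
      assume "det4 M = p \<and> tr4 M = p + 1 \<and> (case M of (a,b,c,d) \<Rightarrow> c = 0 \<and> b < 0 \<and> c + d - a - b < 0)"
      then have h: "a*d = p" "a + d = p + 1" "c = 0" "b < 0" "d - a - b < 0" by (auto simp: M)
      then have "a = p \<and> d = 1" using diag[of a d] p0 by auto
      moreover have "- b \<in> {1..p - 2}" using h calculation by auto
      ultimately show "M \<in> R" using h(3) unfolding R_def M by (intro image_eqI[where x="- b"]) auto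
    qed
  qed
  have Z: "M \<in> Z \<longleftrightarrow> det4 M = p \<and> tr4 M = p + 1 \<and> (case M of (a,b,c,d) \<Rightarrow> c = 0 \<and> b = 0)" for M
  proof -
    obtain a b c d where M: "M = (a,b,c,d)" by (cases M)
    show ?thesis using diag[of a d] unfolding Z_def M by (auto simp: mult.commute)
  qed
  let ?r = "\<lambda>M. of_bool (M \<in> R) :: real"
  have main: "?k M * lef dirn M = (-1/3) * (?r M + (?r (cU M) + ?r (cU (cU M)))) + (-1/2) * of_bool (M \<in> Z)" for M
  proof (cases "det4 M = p \<and> tr4 M = p + 1")
    case False
    then show ?thesis by (auto simp: R Z)
  next
    case True
    obtain a b c d where M: "M = (a,b,c,d)" by (cases M)
    have det: "a*d - b*c = p" and tr: "a + d = p + 1" using True M by auto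
    define A B C E where "A = c" and "B = d - a" and "C = - b" and "E = c + d - a - b"
    have "(p + 1)^2 - 4*p = (p - 1)^2" by (simp add: algebra_simps power2_eq_square)
    then have disc: "B^2 - 4*A*C = (p - 1)^2" using form_disc[OF det tr] by (simp add: A_def B_def C_def)
    have pos: "0 < (p - 1)^2" using p0 by simp
    have E: "E = A + B + C" by (simp add: A_def B_def C_def E_def)
    have fl: "A \<noteq> 0 \<or> C \<noteq> 0 \<Longrightarrow> of_bool (toward A C E) + of_bool (toward C A (a + c - b - d)) = (1::real)"
    proof -
      assume nz: "A \<noteq> 0 \<or> C \<noteq> 0"
      have "E = A + C \<longrightarrow> \<not> (0 < A \<and> 0 < C) \<and> \<not> (A < 0 \<and> C < 0)"
      proof
        assume "E = A + C"
        then have "4*(A*C) = - ((p - 1)^2)" using disc E by simp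
        then have "A*C < 0" using pos by linarith
        then show "\<not> (0 < A \<and> 0 < C) \<and> \<not> (A < 0 \<and> C < 0)" by (auto simp: mult_less_0_iff)
      qed
      from toward_flip[OF nz this] show ?thesis by (simp add: A_def C_def E_def algebra_simps)
    qed
    have three: "of_bool (toward A C E) + of_bool (toward C E A) + of_bool (toward E A C) =
      (1::real) + of_bool (A = 0 \<and> 0 < C \<and> E < 0) + of_bool (C = 0 \<and> 0 < E \<and> A < 0) + of_bool (E = 0 \<and> 0 < A \<and> C < 0)"
      using toward_split[OF E] disc pos by simp
    have two: "of_bool (toward A C E) + of_bool (toward C A (a + c - b - d)) = (1::real) - of_bool (A = 0 \<and> C = 0)"
    proof (cases "A = 0 \<and> C = 0")
      case True
      then show ?thesis by (simp add: toward_def)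
    qed (use fl in auto)
    let ?Q = "\<lambda>X :: mat. case X of (a,b,c,d) \<Rightarrow> c = 0 \<and> b < 0 \<and> c + d - a - b < 0"
    have rc: "?r X = of_bool (?Q X)" if "det4 X = p" "tr4 X = p + 1" for X
      using R[of X] that by simp
    have r: "?r M = of_bool (?Q M)" "?r (cU M) = of_bool (?Q (cU M))" "?r (cU (cU M)) = of_bool (?Q (cU (cU M)))"
      by (rule rc; use True in simp)+
    have rs: "?r M = of_bool (A = 0 \<and> 0 < C \<and> E < 0)" "?r (cU M) = of_bool (C = 0 \<and> 0 < E \<and> A < 0)"
      "?r (cU (cU M)) = of_bool (E = 0 \<and> 0 < A \<and> C < 0)"
      unfolding r unfolding M by (auto simp: A_def C_def E_def intro!: arg_cong[of _ _ of_bool])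
    have zs: "of_bool (M \<in> Z) = (of_bool (A = 0 \<and> C = 0) :: real)"
      using Z[of M] True by (simp add: M A_def C_def)
    have "lef dirn M = (1 - (of_bool (toward A C E) + of_bool (toward C E A) + of_bool (toward E A C))) / 3
        - (1 - (of_bool (toward A C E) + of_bool (toward C A (a + c - b - d)))) / 2"
      unfolding M lef_dirn A_def C_def E_def ..
    then show ?thesis unfolding three two rs zs using True by (simp add: field_simps)
  qed
  have fR: "finite R" by (simp add: R_def)
  have f0: "finite {M. ?r M \<noteq> 0}" using fR by simp
  have f1: "finite {M. ?r (cU M) \<noteq> 0}" by (rule finite_support_bij[OF f0 bij_cU])
  have f2: "finite {M. ?r (cU (cU M)) \<noteq> 0}" using finite_support_bij[OF f1 bij_cU] by simp
  have "finite Z" by (simp add: Z_def)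
  then have fZ: "finite {M. (-1/2) * (of_bool (M \<in> Z)::real) \<noteq> 0}" by simp
  have f12: "finite {M. ?r (cU M) + ?r (cU (cU M)) \<noteq> 0}" by (rule finite_support_add[OF f1 f2])
  have f012: "finite {M. ?r M + (?r (cU M) + ?r (cU (cU M))) \<noteq> 0}" by (rule finite_support_add[OF f0 f12])
  have s0: "Sum_any ?r = real_of_int p - 2"
  proof -
    have "card R = card {1..p - 2}" unfolding R_def by (rule card_image) (auto simp: inj_on_def)
    then show ?thesis using Sum_any_of_bool[of "\<lambda>M. M \<in> R"] fR p0 by simp
  qed
  have s1: "Sum_any (\<lambda>M. ?r (cU M)) = Sum_any ?r" by (rule Sum_any_bij[OF bij_cU])
  have s2: "Sum_any (\<lambda>M. ?r (cU (cU M))) = Sum_any ?r"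
    using Sum_any_bij[OF bij_cU, of "\<lambda>M. ?r (cU M)"] s1 by simp
  have sZ: "Sum_any (\<lambda>M. of_bool (M \<in> Z) :: real) = 2"
  proof -
    have "card Z = 2" using p0 by (simp add: Z_def)
    then show ?thesis using Sum_any_of_bool[of "\<lambda>M. M \<in> Z"] \<open>finite Z\<close> by simp
  qed
  have "lnum p (p + 1) = Sum_any (\<lambda>M. ?k M * lef dirn M)"
    by (rule lnum_dirn) (use p p0 in auto)
  also have "\<dots> = (-1/3) * (Sum_any ?r + (Sum_any ?r + Sum_any ?r)) + (-1/2) * 2"
    unfolding main Sum_any.distrib[OF finite_support_cmult[OF f012] fZ] Sum_any_cmult
      Sum_any.distrib[OF f0 f12] Sum_any.distrib[OF f1 f2] s1 s2 sZ ..
  finally show ?thesis unfolding s0 by (simp add: field_simps)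
qed

lemma toward_positive: "0 < A \<Longrightarrow> 0 < C \<Longrightarrow> toward A C E \<longleftrightarrow> A + C < E"
  by (auto simp: toward_def)

lemma toward_negative: "A < 0 \<Longrightarrow> C < 0 \<Longrightarrow> toward A C E \<longleftrightarrow> E < A + C"
  by (auto simp: toward_def)

text \<open>A matrix of given trace and determinant is determined by its form (c, d - a, -b), and
  every form of discriminant t^2 - 4p occurs. The adjugate matrix has the negative form, so definite
  forms of both signs contribute, whence the factor 2. Arrows towards the root are missing exactly
  where the root lies in the closed triangle or on the side.\<close>

lemma lnum_elliptic:
  assumes p: "odd p" "0 < p" and t: "0 \<le> t" "t^2 < 4*p"
  shows "lnum p t = 2 * hurwitz (4*p - t^2)"
proof -
  define N where "N = 4*p - t^2"
  have N: "0 < N" using t by (simp add: N_def)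
  have N4: "N mod 4 = 0 \<or> N mod 4 = 3"
  proof (cases "even t")
    case True
    then obtain s where "t = 2*s" by blast
    then have "N = 4*(p - s^2)" by (simp add: N_def power2_eq_square)
    then show ?thesis by simp
  next
    case False
    then obtain s where "t = 2*s + 1" by (elim oddE)
    then have "N = 4*(p - s^2 - s - 1) + 3" by (simp add: N_def power2_eq_square algebra_simps)
    then show ?thesis by presburger
  qed
  define form :: "mat \<Rightarrow> qform" where "form = (\<lambda>(a,b,c,d). (c, d - a, - b))"
  define P where "P M \<longleftrightarrow> det4 M = p \<and> tr4 M = t" for M
  define Q where "Q M \<longleftrightarrow> P M \<and> form M \<in> pd_forms N" for M
  have disc: "(d - a)^2 - 4*c*(- b) = - N" if "P (a,b,c,d)" for a b c d
    using form_disc[of a d b c p t] that by (simp add: P_def N_def)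
  have Q_iff: "Q (a,b,c,d) \<longleftrightarrow> P (a,b,c,d) \<and> 0 < c" for a b c d
    using disc[of a b c d] by (auto simp: Q_def form_def pd_forms_def)
  have bij: "bij_betw form {M. Q M \<and> R (form M)} {f \<in> pd_forms N. R f}" for R
  proof (rule bij_betwI')
    fix M M' assume "M \<in> {M. Q M \<and> R (form M)}" "M' \<in> {M. Q M \<and> R (form M)}"
    then have "tr4 M = t" "tr4 M' = t" by (auto simp: Q_def P_def)
    then show "(form M = form M') = (M = M')" by (cases M; cases M') (auto simp: form_def)
  next
    fix M assume "M \<in> {M. Q M \<and> R (form M)}"
    then show "form M \<in> {f \<in> pd_forms N. R f}" by (simp add: Q_def)
  next
    fix f assume f: "f \<in> {f \<in> pd_forms N. R f}"
    obtain A B C where fe: "f = (A,B,C)" by (cases f)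
    have d: "B^2 - 4*A*C = t^2 - 4*p" using f by (simp add: fe pd_forms_def N_def)
    then have "B^2 - t^2 = 2*(2*(A*C - p))" by simp
    then have "even (B^2 - t^2)" by (metis dvd_triv_left)
    then have "even (t - B)" by auto
    then obtain a where a: "t - B = 2*a" by blast
    have B: "B = t - 2*a" using a by simp
    have "4*(a*(t - a)) = 4*(p - A*C)" using d unfolding B by (simp add: algebra_simps power2_eq_square)
    moreover have "x = y" if "4*x = 4*y" for x y :: int using that by simp
    ultimately have "a*(t - a) = p - A*C" by blast
    then have "det4 (a, - C, A, t - a) = p" by simp
    moreover have "form (a, - C, A, t - a) = f" by (simp add: form_def fe B)
    ultimately have "(a, - C, A, t - a) \<in> {M. Q M \<and> R (form M)} \<and> f = form (a, - C, A, t - a)"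
      using f by (simp add: Q_def P_def)
    then show "\<exists>M\<in>{M. Q M \<and> R (form M)}. f = form M" by blast
  qed
  define S1 where "S1 M \<longleftrightarrow> Q M \<and> selling (form M)" for M
  define S2 where "S2 M \<longleftrightarrow> Q M \<and> fst (snd (form M)) = 0" for M
  have fin: "finite {f \<in> pd_forms N. selling f}" by (rule finite_selling[OF N])
  have "{f \<in> pd_forms N. fst (snd f) = 0} \<subseteq> {f \<in> pd_forms N. selling f}"
    using middle_zero_selling[OF _ N] by (auto split: prod.splits)
  then have fin2: "finite {f \<in> pd_forms N. fst (snd f) = 0}" using fin finite_subset by blast
  have c1: "finite {M. S1 M}" "card {M. S1 M} = card {f \<in> pd_forms N. selling f}"
    using bij[of selling] fin unfolding S1_def by (auto simp: bij_betw_finite bij_betw_same_card)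
  have c2: "finite {M. S2 M}" "card {M. S2 M} = card {f \<in> pd_forms N. fst (snd f) = 0}"
    using bij[of "\<lambda>f. fst (snd f) = 0"] fin2 unfolding S2_def by (auto simp: bij_betw_finite bij_betw_same_card)
  define G where "G M = (1/3) * (of_bool (S1 M) :: real) + (-1/2) * of_bool (S2 M)" for M
  have f1: "finite {M. (1/3) * (of_bool (S1 M) :: real) \<noteq> 0}" using c1(1) by simp
  have f2: "finite {M. (-1/2) * (of_bool (S2 M) :: real) \<noteq> 0}" using c2(1) by simp
  have fG: "finite {M. G M \<noteq> 0}" unfolding G_def by (rule finite_support_add[OF f1 f2])
  have "Sum_any G = real (card {M. S1 M}) / 3 - real (card {M. S2 M}) / 2"
    unfolding G_def Sum_any.distrib[OF f1 f2] Sum_any_cmult Sum_any_of_bool[OF c1(1)] Sum_any_of_bool[OF c2(1)]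
    by simp
  then have sG: "Sum_any G = hurwitz N" using hurwitz_card[OF N N4] c1(2) c2(2) by simp
  have main: "of_bool (P M) * lef dirn M = G M + G (adj4 M)" for M
  proof (cases "P M")
    case False
    then have "\<not> P (adj4 M)" by (simp add: P_def)
    then show ?thesis using False by (simp add: G_def S1_def S2_def Q_def)
  next
    case True
    obtain a b c d where M: "M = (a,b,c,d)" by (cases M)
    have dc: "(d - a)^2 - 4*c*(- b) = - N" using disc True M by simp
    have adj: "P (adj4 M)" using True by (simp add: P_def)
    have QM: "Q M \<longleftrightarrow> 0 < c" "Q (adj4 M) \<longleftrightarrow> c < 0" using True adj unfolding M by (simp_all add: Q_iff)
    have SM: "S1 M \<longleftrightarrow> 0 < c \<and> d - a \<le> 0 \<and> 0 \<le> 2*c + (d - a) \<and> 0 \<le> - 2*b + (d - a)"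
      "S1 (adj4 M) \<longleftrightarrow> c < 0 \<and> a - d \<le> 0 \<and> 0 \<le> - 2*c + (a - d) \<and> 0 \<le> 2*b + (a - d)"
      "S2 M \<longleftrightarrow> 0 < c \<and> d - a = 0" "S2 (adj4 M) \<longleftrightarrow> c < 0 \<and> a - d = 0"
      unfolding S1_def S2_def QM unfolding M by (auto simp: form_def selling_def)
    define A C E where "A = c" and "C = - b" and "E = c + d - a - b"
    have "4*(A*C) = (d - a)^2 + N" "4*(A*E) = (2*c + (d - a))^2 + N"
      using dc by (simp_all add: A_def C_def E_def algebra_simps power2_eq_square)
    then have "0 < 4*(A*C)" "0 < 4*(A*E)" using N by (simp_all only: add_nonneg_pos zero_le_power2)
    then have pos: "0 < A*C" "0 < A*E" by simp_all
    have lM: "lef dirn M = (1 - (of_bool (toward A C E) + of_bool (toward C E A) + of_bool (toward E A C))) / 3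
        - (1 - (of_bool (toward A C E) + of_bool (toward C A (2*A + 2*C - E)))) / 2"
      unfolding M lef_dirn A_def C_def E_def by (simp add: algebra_simps)
    have S: "S1 M \<longleftrightarrow> 0 < A \<and> E \<le> A + C \<and> C \<le> A + E \<and> A \<le> C + E"
      "S1 (adj4 M) \<longleftrightarrow> A < 0 \<and> A + C \<le> E \<and> A + E \<le> C \<and> C + E \<le> A"
      "S2 M \<longleftrightarrow> 0 < A \<and> E = A + C" "S2 (adj4 M) \<longleftrightarrow> A < 0 \<and> E = A + C"
      unfolding SM A_def C_def E_def by auto
    consider "0 < A" "0 < C" "0 < E" | "A < 0" "C < 0" "E < 0"
      using pos by (auto simp: zero_less_mult_iff)
    then have "lef dirn M = G M + G (adj4 M)"
    proof cases
      case 1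
      show ?thesis unfolding lM G_def S
        using 1 by (simp add: toward_positive)
    next
      case 2
      show ?thesis unfolding lM G_def S
        using 2 by (simp add: toward_negative)
    qed
    then show ?thesis using True by simp
  qed
  have "lnum p t = Sum_any (\<lambda>M. of_bool (P M) * lef dirn M)"
    unfolding P_def by (rule lnum_dirn[OF p t(1)])
  also have "\<dots> = Sum_any G + Sum_any (\<lambda>M. G (adj4 M))"
    unfolding main by (rule Sum_any.distrib[OF fG finite_support_bij[OF fG bij_adj4]])
  also have "Sum_any (\<lambda>M. G (adj4 M)) = Sum_any G" by (rule Sum_any_bij[OF bij_adj4])
  finally show ?thesis using sG by (simp add: N_def)
qed

subsection \<open>The action on vectors modulo 5\<close>

fun act :: "mat \<Rightarrow> int \<times> int \<Rightarrow> int \<times> int" where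
  "act (a, b, c, d) (x, y) = ((a*x + b*y) mod 5, (c*x + d*y) mod 5)"

text \<open>\<open>vS\<close>, \<open>vU\<close>, \<open>vV\<close>, \<open>vT\<close> are the
  actions of S, U, U^-1 and T on column vectors.\<close>

fun vS :: "int \<times> int \<Rightarrow> int \<times> int" where "vS (x, y) = ((- y) mod 5, x mod 5)"
fun vU :: "int \<times> int \<Rightarrow> int \<times> int" where "vU (x, y) = ((x - y) mod 5, x mod 5)"
fun vV :: "int \<times> int \<Rightarrow> int \<times> int" where "vV (x, y) = (y mod 5, (y - x) mod 5)"
fun vT :: "int \<times> int \<Rightarrow> int \<times> int" where "vT (x, y) = ((x + y) mod 5, y mod 5)"

abbreviation grid :: "(int \<times> int) set" where "grid \<equiv> {0..4} \<times> {0..4}"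

lemma act_grid: "act M x \<in> grid"
  by (cases M; cases x) auto

lemma act_mod: "act M (x mod 5, y mod 5) = act M (x, y)"
proof -
  have "(u*(x mod 5) + v*(y mod 5)) mod 5 = (u*x + v*y) mod 5" for u v :: int
    by (rule mod_add_cong) (simp_all add: mod_mult_right_eq)
  then show ?thesis by (cases M) simp
qed

lemma act_ops:
  "act (lS M) x = vS (act M x)" "act (lV M) x = vV (act M x)"
  "act (rS M) x = act M (vS x)" "act (rU M) x = act M (vU x)" "act (rT M) (vT x) = act M x"
proof -
  show "act (lS M) x = vS (act M x)"
    by (cases M; cases x; simp add: mod_simps)
  show "act (lV M) x = vV (act M x)"
    by (cases M; cases x; simp add: mod_simps; simp add: algebra_simps)
  show "act (rS M) x = act M (vS x)"
    by (cases M; cases x; simp only: rS.simps vS.simps act_mod; simp add: algebra_simps)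
  show "act (rU M) x = act M (vU x)"
    by (cases M; cases x; simp only: rU.simps vU.simps act_mod; simp add: algebra_simps)
  show "act (rT M) (vT x) = act M x"
    by (cases M; cases x; simp only: rT.simps vT.simps act_mod; simp add: algebra_simps)
qed

lemma vS_inj: "u \<in> grid \<Longrightarrow> v \<in> grid \<Longrightarrow> vS u = vS v \<longleftrightarrow> u = v"
proof -
  have "vS (vS (vS (vS w))) = w" if "w \<in> grid" for w using that by (cases w) (auto simp: mod_simps)
  then show "u \<in> grid \<Longrightarrow> v \<in> grid \<Longrightarrow> vS u = vS v \<longleftrightarrow> u = v" by metis
qed

lemma vV_inj: "u \<in> grid \<Longrightarrow> v \<in> grid \<Longrightarrow> vV u = vV v \<longleftrightarrow> u = v"
proof -
  have "vU (vV w) = w" if "w \<in> grid" for w using that by (cases w) (auto simp: mod_simps)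
  then show "u \<in> grid \<Longrightarrow> v \<in> grid \<Longrightarrow> vV u = vV v \<longleftrightarrow> u = v" by metis
qed

lemma lV_rS: "lV (rS M) = rS (lV M)" by (cases M) simp
lemma lV_rU: "lV (rU M) = rU (lV M)" by (cases M) simp
lemma lS_rS: "rS (lS M) = lS (rS M)" by (cases M) simp
lemma rS_rS: "rS (rS M) = neg4 M" by (cases M) simp

lemma lft_lS: "odd (det4 M) \<Longrightarrow> lft (lS M) = 1 - lft M"
  using sg_nonzero[of M] by (auto simp: lft_def sg_ops)

lemma inde_lS: "odd (det4 M) \<Longrightarrow> inde (lS M) = - inde M"
  by (simp add: inde_def lS_rS lft_lS)

lemma inde_rS: "inde (rS M) = - inde M"
  by (simp add: inde_def rS_rS lft_def sg_ops)

lemma inde_rT: "inde M = lft (rT M) - lft M"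
  by (simp add: inde_def lft_def sg_ops)

lemma fixv_lV: "fixv (lV M) = fixv M"
  by (simp add: fixv_def lft_def sg_ops)

lemma fixv_rU: "fixv (rU M) = fixv M"
  by (simp add: fixv_def lft_def sg_ops lV_rU)

text \<open>The path joining the images of two neighbouring centres enters and leaves the base
  triangle through its three sides. This is the pointwise form of the commutation with the boundary
  map.\<close>

lemma inde_boundary: "inde M + inde (lV M) + inde (lV (lV M)) = fixv M - fixv (rS M)"
  by (simp add: inde_def fixv_def lV_rS)

section \<open>The operators on edges and vertices modulo 5\<close>

lemma Sum_any_subst:
  assumes "bij l" "\<And>M. f (l M) = (g M :: real)" shows "Sum_any f = Sum_any g"
  using Sum_any_bij[OF assms(1), of f] by (simp only: assms(2))

text \<open>Nonzero vectors modulo 5 label the cosets of Gamma_1(5) in SL2(Z). The matrices carrying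
  x to y make up one entry of the Hecke operator, here on oriented edges and in \<open>Fker\<close>
  on vertices.\<close>

definition Iker :: "int \<Rightarrow> int \<times> int \<Rightarrow> int \<times> int \<Rightarrow> real" where
  "Iker p x y = Sum_any (\<lambda>M. of_bool (det4 M = p \<and> act M x = y) * inde M)"

definition Fker :: "int \<Rightarrow> int \<times> int \<Rightarrow> int \<times> int \<Rightarrow> real" where
  "Fker p x y = Sum_any (\<lambda>M. of_bool (det4 M = p \<and> act M x = y) * fixv M)"

context
  fixes p :: int
  assumes odd: "odd p" and pos: "0 < p"
begin

lemma fin_inde: "finite {M. of_bool (det4 M = p \<and> P M) * inde M \<noteq> 0}"
  by (rule finite_subset[OF _ inde_support[OF odd pos]]) auto

lemma fin_fixv: "finite {M. of_bool (det4 M = p \<and> P M) * fixv M \<noteq> 0}"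
  by (rule finite_subset[OF _ fixv_support[OF odd pos]]) auto

text \<open>S reverses the base side and U rotates the base triangle. Hence the edge kernel is odd
  under \<open>vS\<close> and the vertex kernel invariant under \<open>vU\<close>, in each argument,
  and both descend to the quotient graph.\<close>

lemma Iker_vS_right: "y \<in> grid \<Longrightarrow> Iker p x (vS y) = - Iker p x y"
proof -
  assume y: "y \<in> grid"
  have "Iker p x (vS y) = Sum_any (\<lambda>M. (-1) * (of_bool (det4 M = p \<and> act M x = y) * inde M))"
    unfolding Iker_def
    by (rule Sum_any_subst[OF bij_lS])
       (simp add: act_ops vS_inj[OF act_grid y] inde_lS odd)
  then show ?thesis unfolding Sum_any_cmult Iker_def by simp
qed

lemma Iker_vS_left: "Iker p (vS x) y = - Iker p x y"
proof -
  have "Iker p x y = Sum_any (\<lambda>M. (-1) * (of_bool (det4 M = p \<and> act M (vS x) = y) * inde M))"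
    unfolding Iker_def
    by (rule Sum_any_subst[OF bij_rS]) (simp add: act_ops inde_rS)
  then show ?thesis unfolding Sum_any_cmult Iker_def by simp
qed

lemma Fker_vU_left: "Fker p (vU x) y = Fker p x y"
  unfolding Fker_def
  by (rule sym, rule Sum_any_subst[OF bij_rU]) (simp add: act_ops fixv_rU)

lemma Fker_vV_right: "y \<in> grid \<Longrightarrow> Fker p x (vV y) = Fker p x y"
  unfolding Fker_def
  by (rule Sum_any_subst[OF bij_lV]) (simp add: act_ops fixv_lV vV_inj[OF act_grid])

lemma Iker_boundary:
  assumes y: "y \<in> grid"
  shows "Iker p (vS x) y + Iker p (vS x) (vV y) + Iker p (vS x) (vV (vV y)) = Fker p (vS x) y - Fker p x y"
proof -
  let ?k = "\<lambda>M. of_bool (det4 M = p \<and> act M (vS x) = y) :: real"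
  have vVg: "vV y \<in> grid" using y by (cases y) auto
  have 1: "Iker p (vS x) (vV y) = Sum_any (\<lambda>M. ?k M * inde (lV M))"
    unfolding Iker_def by (rule Sum_any_subst[OF bij_lV]) (simp add: act_ops vV_inj[OF act_grid y])
  have 2: "Iker p (vS x) (vV (vV y)) = Sum_any (\<lambda>M. ?k M * inde (lV (lV M)))"
  proof -
    have "Iker p (vS x) (vV (vV y)) = Sum_any (\<lambda>M. of_bool (det4 M = p \<and> act M (vS x) = vV y) * inde (lV M))"
      unfolding Iker_def by (rule Sum_any_subst[OF bij_lV]) (simp add: act_ops vV_inj[OF act_grid vVg])
    also have "\<dots> = Sum_any (\<lambda>M. ?k M * inde (lV (lV M)))"
      by (rule Sum_any_subst[OF bij_lV]) (simp add: act_ops vV_inj[OF act_grid y])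
    finally show ?thesis .
  qed
  have 3: "Fker p x y = Sum_any (\<lambda>M. ?k M * fixv (rS M))"
    unfolding Fker_def by (rule Sum_any_subst[OF bij_rS]) (simp add: act_ops)
  have f: "finite {M. ?k M * inde M \<noteq> 0}" "finite {M. ?k M * fixv M \<noteq> 0}"
    by (rule fin_inde, rule fin_fixv)
  have fi1: "finite {M. ?k M * inde (lV M) \<noteq> 0}"
    by (rule finite_subset[OF _ finite_support_bij[OF fin_inde[of "\<lambda>_. True"] bij_lV]]) auto
  have fi2: "finite {M. ?k M * inde (lV (lV M)) \<noteq> 0}"
    by (rule finite_subset[OF _ finite_support_bij[OF finite_support_bij[OF fin_inde[of "\<lambda>_. True"] bij_lV] bij_lV]]) auto
  have ff: "finite {M. (-1) * (?k M * fixv (rS M)) \<noteq> 0}"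
    by (rule finite_subset[OF _ finite_support_bij[OF fin_fixv[of "\<lambda>_. True"] bij_rS]]) auto
  have "Iker p (vS x) y + (Iker p (vS x) (vV y) + Iker p (vS x) (vV (vV y)))
      = Sum_any (\<lambda>M. ?k M * inde M + (?k M * inde (lV M) + ?k M * inde (lV (lV M))))"
    unfolding Sum_any.distrib[OF f(1) finite_support_add[OF fi1 fi2]] Sum_any.distrib[OF fi1 fi2] 1 2
    by (simp add: Iker_def)
  also have "\<dots> = Sum_any (\<lambda>M. ?k M * fixv M + (-1) * (?k M * fixv (rS M)))"
  proof (rule Sum_any.cong)
    fix M
    have "?k M * inde M + (?k M * inde (lV M) + ?k M * inde (lV (lV M)))
        = ?k M * (inde M + inde (lV M) + inde (lV (lV M)))" by (simp only: distrib_left add.assoc)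
    then show "?k M * inde M + (?k M * inde (lV M) + ?k M * inde (lV (lV M)))
        = ?k M * fixv M + (-1) * (?k M * fixv (rS M))"
      unfolding inde_boundary by (simp add: right_diff_distrib)
  qed
  also have "\<dots> = Fker p (vS x) y - Fker p x y"
    unfolding Sum_any.distrib[OF f(2) ff] Sum_any_cmult 3 by (simp add: Fker_def)
  finally show ?thesis by simp
qed

end

text \<open>Replacing \<open>lft\<close> by \<open>lfc\<close>, which depends on the image of \<open>\<infinity>\<close> under \<open>M\<close> only, affects finitely many
  matrices of a given determinant and reduces all counts to triangular matrices.\<close>

fun lfc :: "mat \<Rightarrow> real" where
  "lfc (a, b, c, d) = (if a*c = 0 then lft (a, b, c, d) else of_bool (a*c < 0))"

fun upp :: "mat \<Rightarrow> bool" where "upp (a, b, c, d) \<longleftrightarrow> c = 0"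

text \<open>By 2ac sg(M) = X^2 + Xw + w^2 - p^2 with X = 2ac and w = ad + bc, the sign of
  \<open>sg\<close> is that of ac outside an ellipse: the image of the centre then lies on the same
  side as the image a/c of infinity.\<close>

lemma cusp_side:
  assumes det: "a*d - b*c = p" and "0 < p" "odd p" "a*c \<noteq> 0" "\<not> (\<bar>a*c\<bar> \<le> p \<and> \<bar>a*d + b*c\<bar> \<le> 2*p)"
  shows "lft (a,b,c,d) = lfc (a,b,c,d)"
proof -
  define X w where "X = 2*(a*c)" and "w = a*d + b*c"
  have "2*((a*c)*sg (a,b,c,d)) = X^2 + X*w + w^2 - (a*d - b*c)^2"
    unfolding X_def w_def by (simp add: algebra_simps power2_eq_square)
  then have e: "2*((a*c)*sg (a,b,c,d)) = X^2 + X*w + w^2 - p^2" unfolding det .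
  have "\<not> (X^2 + X*w + w^2 < p^2)"
    using quad_bound[of X w p] assms unfolding X_def w_def by (auto simp: abs_mult)
  then have "0 \<le> (a*c)*sg (a,b,c,d)" using e by (simp del: sg.simps)
  moreover have "(a*c)*sg (a,b,c,d) \<noteq> 0"
    using sg_nonzero[of "(a,b,c,d)"] det assms(3,4) by (simp del: sg.simps)
  ultimately have "0 < (a*c)*sg (a,b,c,d)" by linarith
  then have "a*c < 0 \<longleftrightarrow> sg (a,b,c,d) < 0"
    unfolding zero_less_mult_iff[of "a*c"] by linarith
  then show ?thesis using assms(4) by (simp add: lft_def del: sg.simps)
qed

lemma finite_lft_neq_lfc:
  assumes "0 < p" "odd p"
  shows "finite {M. det4 M = p \<and> lft M \<noteq> lfc M}"
proof (rule finite_matI[where K="2*p"])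
  fix a b c d assume "(a,b,c,d) \<in> {M. det4 M = p \<and> lft M \<noteq> lfc M}"
  then have det: "a*d - b*c = p" and ne: "lft (a,b,c,d) \<noteq> lfc (a,b,c,d)" by auto
  have ac: "a*c \<noteq> 0" using ne by auto
  have bd: "\<bar>a*c\<bar> \<le> p" "\<bar>a*d + b*c\<bar> \<le> 2*p" using cusp_side[OF det assms ac] ne by auto
  have a0: "a \<noteq> 0" "c \<noteq> 0" using ac by auto
  have "\<bar>a*d\<bar> \<le> 2*p" "\<bar>b*c\<bar> \<le> 2*p" using bd(2) det assms(1) by linarith+
  then show "\<bar>a\<bar> \<le> 2*p \<and> \<bar>b\<bar> \<le> 2*p \<and> \<bar>c\<bar> \<le> 2*p \<and> \<bar>d\<bar> \<le> 2*p"
    using bd(1) assms(1) abs_le_abs_mult[OF a0(2), of a] abs_le_abs_mult[OF a0(1), of c]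
      abs_le_abs_mult[OF a0(2), of b] abs_le_abs_mult[OF a0(1), of d]
    by (simp add: mult.commute)
qed

lemma lfc_lS: "odd (det4 M) \<Longrightarrow> lfc (lS M) = 1 - lfc M"
proof -
  assume odd: "odd (det4 M)"
  obtain a b c d where M: "M = (a,b,c,d)" by (cases M)
  show ?thesis
  proof (cases "a*c = 0")
    case True
    then show ?thesis using lft_lS[OF odd] by (auto simp: M)
  next
    case False
    then have "a*c < 0 \<or> 0 < a*c" by linarith
    then show ?thesis using False by (auto simp: M mult.commute[of c a] of_bool_def)
  qed
qed

lemma Sum_any_sum:
  assumes "finite A" "\<And>k. k \<in> A \<Longrightarrow> finite {M. f k M \<noteq> (0::real)}"
  shows "finite {M. (\<Sum>k\<in>A. f k M) \<noteq> 0} \<and> Sum_any (\<lambda>M. \<Sum>k\<in>A. f k M) = (\<Sum>k\<in>A. Sum_any (f k))"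
  using assms
proof (induction A rule: finite_induct)
  case (insert k A)
  then have f: "finite {M. f k M \<noteq> 0}" "finite {M. (\<Sum>k\<in>A. f k M) \<noteq> 0}" by auto
  then show ?case using insert finite_support_add[OF f] Sum_any.distrib[OF f] by simp
qed simp

lemma card_residue_window:
  assumes "0 \<le> r" "r < 5"
  shows "finite {b. l \<le> b \<and> b < l + 5 * int n \<and> b mod 5 = r} \<and>
     card {b. l \<le> b \<and> b < l + 5 * int n \<and> b mod 5 = r} = n"
proof (induction n)
  case 0
  have "{b. l \<le> b \<and> b < l + 5 * int 0 \<and> b mod 5 = r} = {}" by auto
  then show ?case by (simp only: finite.emptyI card.empty simp_thms)
next
  case (Suc n)
  define m where "m = l + 5 * int n"
  have m: "l + 5 * int (Suc n) = m + 5" "l \<le> m" by (simp_all add: m_def)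
  have new: "b = m + (r - m) mod 5 \<longleftrightarrow> m \<le> b \<and> b < m + 5 \<and> b mod 5 = r" for b
  proof
    assume b: "b = m + (r - m) mod 5"
    then have "b mod 5 = (m + (r - m)) mod 5" by (simp add: mod_add_right_eq)
    then show "m \<le> b \<and> b < m + 5 \<and> b mod 5 = r" using assms b by simp
  next
    assume b: "m \<le> b \<and> b < m + 5 \<and> b mod 5 = r"
    then have "(r - m) mod 5 = (b - m) mod 5" by (auto simp: mod_diff_left_eq)
    also have "\<dots> = b - m" using b by (intro mod_pos_pos_trivial) auto
    finally show "b = m + (r - m) mod 5" by simp
  qed
  have "{b. l \<le> b \<and> b < l + 5 * int (Suc n) \<and> b mod 5 = r}
      = insert (m + (r - m) mod 5) {b. l \<le> b \<and> b < m \<and> b mod 5 = r}"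
  proof (rule Set.set_eqI)
    fix b
    show "b \<in> {b. l \<le> b \<and> b < l + 5 * int (Suc n) \<and> b mod 5 = r}
      \<longleftrightarrow> b \<in> insert (m + (r - m) mod 5) {b. l \<le> b \<and> b < m \<and> b mod 5 = r}"
      unfolding insert_iff mem_Collect_eq new m(1) using m(2) by auto
  qed
  moreover have "m + (r - m) mod 5 \<notin> {b. l \<le> b \<and> b < m \<and> b mod 5 = r}" by auto
  ultimately show ?case using Suc.IH by (simp add: m_def[symmetric])
qed

lemma funpow_rT: "(rT ^^ 5) (a, b, c, d) = (a, b - 5*a, c, d - 5*c)"
  by (simp add: eval_nat_numeral)

lemma bij_funpow_rT: "bij (rT ^^ k)"
  by (rule bij_fn[OF bij_rT])

lemma act_funpow_rT: "act ((rT ^^ 5) M) x = act M x"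
proof -
  obtain a b c d where M: "M = (a,b,c,d)" by (cases M)
  obtain s t where x: "x = (s,t)" by (cases x)
  have mod: "(u - 5*v) mod 5 = u mod 5" for u v :: int by presburger
  have "u*s + (v - 5*u)*t = (u*s + v*t) - 5*(u*t)" for u v by (simp add: algebra_simps)
  then have "(u*s + (v - 5*u)*t) mod 5 = (u*s + v*t) mod 5" for u v by (simp only: mod)
  then show ?thesis unfolding M x funpow_rT act.simps by (simp only:)
qed

lemma det4_funpow_rT: "det4 ((rT ^^ k) M) = det4 M"
  by (induction k) simp_all

text \<open>Contribution of the triangular matrices to a closed loop around a cusp; T^5 closes the
  loop because it is the identity modulo 5.\<close>

definition Kcusp :: "int \<Rightarrow> int \<times> int \<Rightarrow> int \<times> int \<Rightarrow> real" where
  "Kcusp p x y = Sum_any (\<lambda>M. of_bool (det4 M = p \<and> act M x = y \<and> upp M) * (lft ((rT ^^ 5) M) - lft M))"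

text \<open>Right multiplication by powers of T keeps a and c, so \<open>lfc\<close> can change only
  for c = 0 or a = 0; S carries the second case to the first.\<close>

lemma cusp_split:
  assumes "det4 M \<noteq> 0"
  shows "lfc ((rT ^^ 5) M) - lfc M =
    of_bool (upp M) * (lft ((rT ^^ 5) M) - lft M) + of_bool (upp (lS M)) * (lft ((rT ^^ 5) M) - lft M)"
proof -
  obtain a b c d where M: "M = (a,b,c,d)" by (cases M)
  have "a \<noteq> 0 \<or> c \<noteq> 0" using assms by (auto simp: M)
  then show ?thesis by (auto simp: M funpow_rT)
qed

section \<open>Residues and fixed vectors modulo 5\<close>

lemma act_mod_matrix: "act (a mod 5, b mod 5, c mod 5, d mod 5) x = act (a, b, c, d) x"
proof -
  have "((u mod 5)*x + (v mod 5)*y) mod 5 = (u*x + v*y) mod 5" for u v x y :: int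
    by (rule mod_add_cong) (simp_all add: mod_mult_left_eq)
  then show ?thesis by (cases x) simp
qed

lemma grid_nonzero:
  "grid - {(0, 0)} = {(0, 1), (0, 2), (0, 3), (0, 4), (1, 0), (1, 1), (1, 2), (1, 3), (1, 4),
    (2, 0), (2, 1), (2, 2), (2, 3), (2, 4), (3, 0), (3, 1), (3, 2), (3, 3), (3, 4),
    (4, 0), (4, 1), (4, 2), (4, 3), (4, 4)}"
proof -
  have "{0..4::int} = {0, 1, 2, 3, 4}" by auto
  then show ?thesis by (simp add: insert_Times_insert)
qed

lemma mod_5_inverse:
  fixes b s :: int
  assumes "0 \<le> s" "s \<le> 4"
  shows "(2*b) mod 5 = s \<longleftrightarrow> b mod 5 = (3*s) mod 5" "(3*b) mod 5 = s \<longleftrightarrow> b mod 5 = (2*s) mod 5"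
proof -
  have s: "s = 0 \<or> s = 1 \<or> s = 2 \<or> s = 3 \<or> s = 4" using assms by auto
  define r where "r = b mod 5"
  have "0 \<le> r" "r < 5" by (simp_all add: r_def)
  then have r: "r = 0 \<or> r = 1 \<or> r = 2 \<or> r = 3 \<or> r = 4" by linarith
  have "(2*b) mod 5 = (2*r) mod 5" "(3*b) mod 5 = (3*r) mod 5"
    unfolding r_def by (simp_all only: mod_mult_right_eq)
  then show "(2*b) mod 5 = s \<longleftrightarrow> b mod 5 = (3*s) mod 5" "(3*b) mod 5 = s \<longleftrightarrow> b mod 5 = (2*s) mod 5"
    unfolding r_def[symmetric] using r s by (elim disjE; simp)+
qed

lemma act_eq_zero:
  assumes "det4 M = p" "\<not> 5 dvd p" "x \<in> grid" "act M x = (0, 0)"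
  shows "x = (0, 0)"
proof -
  obtain a b c d where M: "M = (a,b,c,d)" by (cases M)
  obtain s t where x: "x = (s,t)" by (cases x)
  have d: "5 dvd a*s + b*t" "5 dvd c*s + d*t" using assms(4) by (auto simp: M x)
  have p5: "prime (5::int)" by simp
  have p: "p = a*d - b*c" using assms(1) by (simp add: M)
  have "p*s = d*(a*s + b*t) - b*(c*s + d*t)" "p*t = a*(c*s + d*t) - c*(a*s + b*t)"
    unfolding p by (simp_all add: algebra_simps)
  then have "5 dvd p*s" "5 dvd p*t" using d by (metis dvd_diff dvd_mult)+
  then have "5 dvd s" "5 dvd t" using assms(2) p5 by (metis prime_dvd_mult_iff)+
  then show ?thesis using assms(3) by (auto simp: x dvd_def)
qed

text \<open>As det(M - 1) = p + 1 - tr M, the trace condition says that 1 is an eigenvalue. The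
  other eigenvalue is p, different from 1, so the fixed vectors form a line. The claim is checked on
  all residue matrices.\<close>

lemma card_fixed:
  assumes "det4 M = p" "p mod 5 = 2 \<or> p mod 5 = 3 \<or> p mod 5 = 4"
  shows "card {x \<in> grid - {(0, 0)}. act M x = x} = (if tr4 M mod 5 = (p + 1) mod 5 then 4 else 0)"
proof -
  have all: "\<forall>a\<in>set [0, 1, 2, 3, 4]. \<forall>b\<in>set [0, 1, 2, 3, 4]. \<forall>c\<in>set [0, 1, 2, 3, 4]. \<forall>d\<in>set [0, 1, 2, 3, 4].
    (a*d - b*c) mod 5 \<noteq> 0 \<longrightarrow> (a*d - b*c) mod 5 \<noteq> 1 \<longrightarrow>
    length (filter (\<lambda>x. act (a, b, c, d) x = x) (tl (List.product [0, 1, 2, 3, 4] [0, 1, 2, 3, 4])))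
      = (if (a + d) mod 5 = (a*d - b*c + 1) mod 5 then 4 else 0)"
    by code_simp
  obtain a b c d where M: "M = (a,b,c,d)" by (cases M)
  have p: "p = a*d - b*c" using assms(1) by (simp add: M)
  let ?a = "a mod 5" and ?b = "b mod 5" and ?c = "c mod 5" and ?d = "d mod 5"
  have range: "x mod 5 \<in> set [0, 1, 2, 3, 4]" for x :: int by simp presburger
  have det: "(?a*?d - ?b*?c) mod 5 = p mod 5" unfolding p by (rule mod_diff_cong) (simp_all add: mod_mult_eq)
  have tr: "(?a + ?d) mod 5 = tr4 M mod 5" by (simp add: M mod_simps)
  have det1: "(?a*?d - ?b*?c + 1) mod 5 = (p + 1) mod 5" using det by (metis mod_add_left_eq)
  have ne: "(?a*?d - ?b*?c) mod 5 \<noteq> 0" "(?a*?d - ?b*?c) mod 5 \<noteq> 1" unfolding det using assms(2) by auto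
  let ?L = "tl (List.product [0, 1, 2, 3, 4] [0, 1, 2, 3, 4]) :: (int \<times> int) list"
  have "distinct ?L" by simp
  moreover have "set ?L = grid - {(0, 0)}" unfolding grid_nonzero by simp
  ultimately have "card {x \<in> grid - {(0, 0)}. act M x = x} = length (filter (\<lambda>x. act M x = x) ?L)"
    using distinct_length_filter[of ?L "\<lambda>x. act M x = x"] by (simp only: Int_def mem_Collect_eq conj_commute)
  also have "\<dots> = length (filter (\<lambda>x. act (?a, ?b, ?c, ?d) x = x) ?L)"
    by (simp only: M act_mod_matrix)
  also have "\<dots> = (if tr4 M mod 5 = (p + 1) mod 5 then 4 else 0)"
    by (rule all[rule_format, OF range[of a] range[of b] range[of c] range[of d] ne, unfolded tr det1])
  finally show ?thesis .
qed

lemma residues_mod_5: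
  fixes p q :: int
  assumes "p mod 5 = q"
  shows "(- p) mod 5 = (- q) mod 5" "(2*p) mod 5 = (2*q) mod 5" "(p*2) mod 5 = (2*q) mod 5"
    "(- (2*p)) mod 5 = (- (2*q)) mod 5" "(- (p*2)) mod 5 = (- (2*q)) mod 5"
proof -
  show 1: "(- p) mod 5 = (- q) mod 5" unfolding assms[symmetric] by (simp only: mod_minus_eq)
  show 2: "(2*p) mod 5 = (2*q) mod 5" unfolding assms[symmetric] by (simp only: mod_mult_right_eq)
  then show "(p*2) mod 5 = (2*q) mod 5" by (simp only: mult.commute)
  show 3: "(- (2*p)) mod 5 = (- (2*q)) mod 5" using 2 by (metis mod_minus_eq)
  then show "(- (p*2)) mod 5 = (- (2*q)) mod 5" by (simp only: mult.commute)
qed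

lemma hurwitz_4: "hurwitz 4 = 1/2"
proof -
  have sel: "{f \<in> pd_forms 4. selling f} = {(1, 0, 1), (1, - 2, 2), (2, - 2, 1)}"
  proof
    show "{f \<in> pd_forms 4. selling f} \<subseteq> {(1, 0, 1), (1, - 2, 2), (2, - 2, 1)}"
    proof
      fix f :: qform assume "f \<in> {f \<in> pd_forms 4. selling f}"
      moreover obtain a b c where f: "f = (a,b,c)" by (cases f)
      ultimately have pd: "(a,b,c) \<in> pd_forms 4" and s: "selling (a,b,c)" by auto
      have d: "b^2 - 4*a*c = - 4" using pd by (simp add: pd_forms_def)
      have ab: "0 \<le> 2*a + b" "0 \<le> 2*c + b" using s by (auto simp: selling_def)
      have "b \<in> {- 4..0}" "a \<in> {1..4}" "c \<in> {1..4}" using selling_bounds[OF pd s] by auto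
      moreover have "{- 4..0::int} = {- 4, - 3, - 2, - 1, 0}" "{1..4::int} = {1, 2, 3, 4}" by auto
      ultimately have "b \<in> {- 4, - 3, - 2, - 1, 0}" "a \<in> {1, 2, 3, 4}" "c \<in> {1, 2, 3, 4}"
        by (simp_all only:)
      then show "f \<in> {(1, 0, 1), (1, - 2, 2), (2, - 2, 1)}"
        unfolding f by (elim insertE emptyE) (use d ab in simp_all)
    qed
    show "{(1, 0, 1), (1, - 2, 2), (2, - 2, 1)} \<subseteq> {f \<in> pd_forms 4. selling f}"
      by (simp add: pd_forms_def selling_def)
  qed
  have "{f \<in> pd_forms 4. fst (snd f) = 0} = {f \<in> {f \<in> pd_forms 4. selling f}. fst (snd f) = 0}"
    using middle_zero_selling[of _ _ 4] by (auto split: prod.splits)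
  also have "\<dots> = {(1, 0, 1)}" unfolding sel by auto
  finally show ?thesis using hurwitz_card[of 4] by (simp add: sel)
qed

lemma abs_less_2_sqrt_iff: "real_of_int \<bar>r\<bar> < 2 * sqrt (real p) \<longleftrightarrow> r^2 < 4 * int p"
proof -
  have "2 * sqrt (real p) = sqrt (4 * real p)" by (simp add: real_sqrt_mult)
  moreover have "real_of_int \<bar>r\<bar> = sqrt (real_of_int (r^2))" by simp
  ultimately have "real_of_int \<bar>r\<bar> < 2 * sqrt (real p) \<longleftrightarrow> real_of_int (r^2) < 4 * real p"
    by (simp only: real_sqrt_less_iff)
  also have "\<dots> \<longleftrightarrow> real_of_int (r^2) < real_of_int (4 * int p)" by simp
  finally show ?thesis by (simp only: of_int_less_iff)
qed

lemma finite_square_less: "finite {t::int. t^2 < 4*p}"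
proof (rule finite_subset[of _ "{- \<bar>4*p\<bar>..\<bar>4*p\<bar>}"])
  have "\<bar>t\<bar> \<le> t^2" for t :: int
    by (cases "t = 0") (use abs_le_abs_mult[of t t] in \<open>auto simp: power2_eq_square\<close>)
  then have "\<bar>t\<bar> \<le> \<bar>4*p\<bar>" if "t^2 < 4*p" for t
    using that by (meson abs_ge_self less_imp_le order_trans)
  then show "{t. t^2 < 4*p} \<subseteq> {- \<bar>4*p\<bar>..\<bar>4*p\<bar>}" by (auto simp: abs_le_iff minus_le_iff)
qed simp

context
  fixes p :: int
  assumes prime: "prime p" and odd: "odd p"
begin

lemma p_gt: "2 < p"
  using prime odd prime_ge_2_int[of p] by (cases "p = 2") auto

lemma p_pos: "0 < p" using p_gt by simp

lemma fin_delta: "finite {M. of_bool (det4 M = p \<and> P M) * (lft M - lfc M) \<noteq> 0}"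
  by (rule finite_subset[OF _ finite_lft_neq_lfc[OF p_pos odd]]) auto

section \<open>Upper triangular matrices of prime determinant\<close>

lemma upper_entries:
  assumes "det4 (a, b, 0, d) = p"
  shows "(a = p \<and> d = 1) \<or> (a = - p \<and> d = - 1) \<or> (a = 1 \<and> d = p) \<or> (a = - 1 \<and> d = - p)"
proof -
  have ad: "a*d = p" using assms by simp
  then have "d dvd p" by (metis dvd_triv_right)
  then have "\<bar>d\<bar> = 1 \<or> \<bar>d\<bar> = p" using prime by (metis prime_int_iff abs_dvd_iff abs_ge_zero)
  then show ?thesis
  proof
    assume "\<bar>d\<bar> = 1"
    then show ?thesis using ad by (auto simp: abs_if split: if_splits)
  next
    assume "\<bar>d\<bar> = p"
    then consider "d = p" | "d = - p" by linarith
    then show ?thesis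
    proof cases
      case 1
      then have "(a - 1)*p = 0" using ad by (simp add: algebra_simps)
      then show ?thesis using 1 p_pos by simp
    next
      case 2
      then have "(a + 1)*p = 0" using ad by (simp add: algebra_simps)
      then show ?thesis using 2 p_pos by simp
    qed
  qed
qed

text \<open>The families with negative diagonal are parametrised by -b, so that M and -M share a
  parameter.\<close>

lemma upper_card:
  assumes "finite {b. R (p, b, 0, 1)}" "finite {b. R (- p, - b, 0, - 1)}"
    "finite {b. R (1, b, 0, p)}" "finite {b. R (- 1, - b, 0, - p)}"
  shows "finite {M. det4 M = p \<and> upp M \<and> R M}"
    and "card {M. det4 M = p \<and> upp M \<and> R M} =
      card {b. R (p, b, 0, 1)} + card {b. R (- p, - b, 0, - 1)} +
      (card {b. R (1, b, 0, p)} + card {b. R (- 1, - b, 0, - p)})"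
proof -
  let ?A = "(\<lambda>b. (p, b, 0::int, 1::int)) ` {b. R (p, b, 0, 1)}"
  let ?B = "(\<lambda>b. (- p, - b, 0::int, - 1::int)) ` {b. R (- p, - b, 0, - 1)}"
  let ?C = "(\<lambda>b. (1::int, b, 0::int, p)) ` {b. R (1, b, 0, p)}"
  let ?D = "(\<lambda>b. (- 1::int, - b, 0::int, - p)) ` {b. R (- 1, - b, 0, - p)}"
  have eq: "{M. det4 M = p \<and> upp M \<and> R M} = (?A \<union> ?B) \<union> (?C \<union> ?D)"
  proof
    show "{M. det4 M = p \<and> upp M \<and> R M} \<subseteq> (?A \<union> ?B) \<union> (?C \<union> ?D)"
    proof
      fix M assume M: "M \<in> {M. det4 M = p \<and> upp M \<and> R M}"
      then obtain a b d where Me: "M = (a, b, 0, d)" by (cases M) auto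
      have R: "R (a, b, 0, d)" and "det4 (a, b, 0, d) = p" using M Me by auto
      from upper_entries[OF this(2)] show "M \<in> (?A \<union> ?B) \<union> (?C \<union> ?D)"
      proof (elim disjE conjE)
        assume h: "a = p" "d = 1"
        have "M \<in> ?A" by (rule image_eqI[where x=b]) (use h R Me in auto)
        then show ?thesis by blast
      next
        assume h: "a = - p" "d = - 1"
        have "M \<in> ?B" by (rule image_eqI[where x="- b"]) (use h R Me in auto)
        then show ?thesis by blast
      next
        assume h: "a = 1" "d = p"
        have "M \<in> ?C" by (rule image_eqI[where x=b]) (use h R Me in auto)
        then show ?thesis by blast
      next
        assume h: "a = - 1" "d = - p"
        have "M \<in> ?D" by (rule image_eqI[where x="- b"]) (use h R Me in auto)
        then show ?thesis by blast
      qed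
    qed
    show "(?A \<union> ?B) \<union> (?C \<union> ?D) \<subseteq> {M. det4 M = p \<and> upp M \<and> R M}" by auto
  qed
  show "finite {M. det4 M = p \<and> upp M \<and> R M}" unfolding eq using assms by simp
  have c: "card ?A = card {b. R (p, b, 0, 1)}" "card ?B = card {b. R (- p, - b, 0, - 1)}"
    "card ?C = card {b. R (1, b, 0, p)}" "card ?D = card {b. R (- 1, - b, 0, - p)}"
    by (rule card_image; simp add: inj_on_def)+
  define A B C D where "A = ?A" and "B = ?B" and "C = ?C" and "D = ?D"
  have fin: "finite A" "finite B" "finite C" "finite D"
    unfolding A_def B_def C_def D_def by (rule finite_imageI, rule assms)+
  have ne: "p \<noteq> 1" "p \<noteq> - 1" "- p \<noteq> 1" "- p \<noteq> - 1" "p \<noteq> - p" "1 \<noteq> (- 1::int)" using p_gt by auto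
  have q: "\<forall>M\<in>A. snd (snd (snd M)) = 1" "\<forall>M\<in>B. snd (snd (snd M)) = - 1"
    "\<forall>M\<in>C. snd (snd (snd M)) = p" "\<forall>M\<in>D. snd (snd (snd M)) = - p"
    unfolding A_def B_def C_def D_def by simp_all
  have dis: "(A \<union> B) \<inter> (C \<union> D) = {}" "A \<inter> B = {}" "C \<inter> D = {}"
    unfolding disjoint_iff Un_iff using q ne by metis+
  have "card ((A \<union> B) \<union> (C \<union> D)) = (card A + card B) + (card C + card D)"
    using fin dis by (simp only: card_Un_disjoint finite_Un simp_thms)
  then show "card {M. det4 M = p \<and> upp M \<and> R M} =
      card {b. R (p, b, 0, 1)} + card {b. R (- p, - b, 0, - 1)} +
      (card {b. R (1, b, 0, p)} + card {b. R (- 1, - b, 0, - p)})"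
    unfolding eq c[symmetric] A_def B_def C_def D_def by simp
qed

text \<open>S exchanges the two sides of the geodesic from 0 to infinity, which negates every
  summand.\<close>

lemma Sum_any_delta: "Sum_any (\<lambda>M. of_bool (det4 M = p) * (lft M - lfc M)) = 0"
proof -
  let ?f = "\<lambda>M. of_bool (det4 M = p) * (lft M - lfc M)"
  have "Sum_any ?f = Sum_any (\<lambda>M. (-1) * ?f M)"
    by (rule Sum_any_subst[OF bij_lS]) (use odd in \<open>simp add: lft_lS lfc_lS\<close>)
  then show ?thesis unfolding Sum_any_cmult by simp
qed

text \<open>There are p + 1 matrices of determinant p up to left multiplication by SL2(Z), and six
  elements of SL2(Z) carry a point off the sides into the base triangle. The proof counts at
  infinity instead: \<open>g\<close> marks the upper triangular M for which the real part of M
  \<rho> lies strictly between 0 and 1, of which there are 2 + 2p.\<close>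

lemma total_fixv: "Sum_any (\<lambda>M. of_bool (det4 M = p) * fixv M) = 6 * (real_of_int p + 1)"
proof -
  let ?k = "\<lambda>M. of_bool (det4 M = p) :: real"
  define \<delta> where "\<delta> M = ?k M * (lft M - lfc M)" for M
  define R where "R M \<longleftrightarrow> \<not> sg M < 0 \<and> \<not> sg (lV M) < 0" for M
  define g where "g M = (of_bool (det4 M = p \<and> upp M \<and> R M) :: real)" for M
  have cR: "R (p, b, 0, 1) \<longleftrightarrow> b = (1 - p) div 2"
    "R (- p, - b, 0, - 1) \<longleftrightarrow> b = (1 - p) div 2"
    "R (1, b, 0, p) \<longleftrightarrow> 0 \<le> b \<and> b < p"
    "R (- 1, - b, 0, - p) \<longleftrightarrow> 0 \<le> b \<and> b < p" for b
  proof -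
    show "R (p, b, 0, 1) \<longleftrightarrow> b = (1 - p) div 2" "R (- p, - b, 0, - 1) \<longleftrightarrow> b = (1 - p) div 2"
      using odd by (auto simp: R_def; presburger)+
    have e: "sg (1, b, 0, p) = p*(2*b + 1)" "sg (lV (1, b, 0, p)) = p*(2*(p - b) - 1)"
      "sg (- 1, - b, 0, - p) = p*(2*b + 1)" "sg (lV (- 1, - b, 0, - p)) = p*(2*(p - b) - 1)"
      by (simp_all add: algebra_simps)
    have px: "p*x < 0 \<longleftrightarrow> x < 0" for x using p_pos by (simp add: mult_less_0_iff)
    show "R (1, b, 0, p) \<longleftrightarrow> 0 \<le> b \<and> b < p" "R (- 1, - b, 0, - p) \<longleftrightarrow> 0 \<le> b \<and> b < p"
      unfolding R_def e px by auto
  qed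
  have seg: "{b. 0 \<le> b \<and> b < p} = {0..<p}" by auto
  have finR: "finite {M. det4 M = p \<and> upp M \<and> R M}"
    and "card {M. det4 M = p \<and> upp M \<and> R M} = 2 + (nat p + nat p)"
    using upper_card[of R] unfolding cR by (simp_all add: seg)
  then have sg: "Sum_any g = 2*(real_of_int p + 1)"
    unfolding g_def Sum_any_of_bool[OF finR] using p_pos by simp
  have fg: "finite {M. g M \<noteq> 0}" by (rule finite_subset[OF _ finR]) (auto simp: g_def)
  have fd: "finite {M. \<delta> M \<noteq> 0}" using fin_delta[of "\<lambda>_. True"] by (simp add: \<delta>_def)
  have dd: "Sum_any \<delta> = 0" using Sum_any_delta by (simp add: \<delta>_def[abs_def])
  have main: "?k M * fixv M = (g M + (g (lV M) + g (lV (lV M)))) + (-1) * (\<delta> M + (\<delta> (lV M) + \<delta> (lV (lV M))))" for M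
  proof (cases "det4 M = p")
    case False
    then show ?thesis by (simp add: g_def \<delta>_def)
  next
    case True
    have l3: "lft (lV (lV (lV M))) = lft M" "sg (lV (lV (lV M))) < 0 \<longleftrightarrow> sg M < 0" by (simp_all only: lft_def sg_ops(8))
    have ll: "lft X + lft (lV X) \<le> 1" if "upp X" "det4 X = p" for X
    proof -
      obtain a b d where X: "X = (a,b,0,d)" using \<open>upp X\<close> by (cases X) auto
      have "sg X + sg (lV X) = 2*d^2" by (simp add: X algebra_simps power2_eq_square)
      then have "\<not> (sg X < 0 \<and> sg (lV X) < 0)" using zero_le_power2[of d] by linarith
      then show ?thesis by (auto simp: lft_def)
    qed
    have gu: "g X = (if upp X then 1 - lft X - lft (lV X) else 0)" if "det4 X = p" for X
      using ll[of X] that by (auto simp: g_def R_def lft_def of_bool_def split: if_splits)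
    have "g M + (g (lV M) + g (lV (lV M))) = 1 - lfc M - lfc (lV M) - lfc (lV (lV M))"
    proof -
      obtain a b c d where M: "M = (a,b,c,d)" by (cases M)
      have u: "upp M \<longleftrightarrow> c = 0" "upp (lV M) \<longleftrightarrow> c = a" "upp (lV (lV M)) \<longleftrightarrow> a = 0" by (auto simp: M)
      have lc: "lfc M = (if a*c = 0 then lft M else of_bool (a*c < 0))"
        "lfc (lV M) = (if c*(c - a) = 0 then lft (lV M) else of_bool (c*(c - a) < 0))"
        "lfc (lV (lV M)) = (if (c - a)*a = 0 then lft (lV (lV M)) else of_bool ((a - c)*a < 0))"
        by (auto simp: M algebra_simps)
      have nz: "a \<noteq> 0 \<or> c \<noteq> 0" using True p_pos M by auto
      have G: "g M = (if c = 0 then 1 - lft M - lft (lV M) else 0)"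
        "g (lV M) = (if c = a then 1 - lft (lV M) - lft (lV (lV M)) else 0)"
        "g (lV (lV M)) = (if a = 0 then 1 - lft (lV (lV M)) - lft M else 0)"
        using gu[of M] gu[of "lV M"] gu[of "lV (lV M)"] True unfolding u l3 by simp_all
      consider "c = 0" "a \<noteq> 0" | "a = 0" "c \<noteq> 0" | "a = c" "c \<noteq> 0" | "a \<noteq> 0" "c \<noteq> 0" "a \<noteq> c"
        using nz by blast
      then show ?thesis
      proof cases
        case 4
        \<comment> \<open>Here a/c is none of the vertices 0, 1, infinity, so it lies behind exactly
          one side.\<close>
        have "of_bool (a*c < 0) + of_bool (c*(c - a) < 0) + of_bool ((a - c)*a < 0) = (1::real)"
          using 4 by (auto simp: mult_less_0_iff of_bool_def)
        then show ?thesis using 4 unfolding G lc by simp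
      qed (unfold G lc, auto simp: mult_less_0_iff)
    qed
    then show ?thesis using True by (simp add: \<delta>_def fixv_def)
  qed
  have shift: "finite {M. f (lV M) \<noteq> 0} \<and> Sum_any (\<lambda>M. f (lV M)) = Sum_any f" if "finite {M. f M \<noteq> 0}" for f :: "mat \<Rightarrow> real"
    using finite_support_bij[OF that bij_lV] Sum_any_bij[OF bij_lV, of f] by simp
  have three: "finite {M. f M + (f (lV M) + f (lV (lV M))) \<noteq> 0} \<and>
     Sum_any (\<lambda>M. f M + (f (lV M) + f (lV (lV M)))) = 3 * Sum_any f" if f: "finite {M. f M \<noteq> 0}" for f :: "mat \<Rightarrow> real"
  proof -
    have 1: "finite {M. f (lV M) \<noteq> 0}" "Sum_any (\<lambda>M. f (lV M)) = Sum_any f" using shift[OF f] by auto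
    have 2: "finite {M. f (lV (lV M)) \<noteq> 0}" "Sum_any (\<lambda>M. f (lV (lV M))) = Sum_any f"
      using shift[OF 1(1)] 1(2) by auto
    note 3 = finite_support_add[OF 1(1) 2(1)]
    show ?thesis
      using finite_support_add[OF f 3] Sum_any.distrib[OF f 3] Sum_any.distrib[OF 1(1) 2(1)] 1(2) 2(2) by simp
  qed
  have "Sum_any (\<lambda>M. ?k M * fixv M) = 3 * Sum_any g + (-1) * (3 * Sum_any \<delta>)"
    unfolding main Sum_any.distrib[OF conjunct1[OF three[OF fg]] finite_support_cmult[OF conjunct1[OF three[OF fd]]]]
      Sum_any_cmult conjunct2[OF three[OF fg]] conjunct2[OF three[OF fd]] ..
  then show ?thesis using sg dd by simp
qed

section \<open>Sums of the edge kernel around cusps\<close>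

lemma Iker_funpow_vT:
  "Iker p ((vT ^^ k) x) y = Sum_any (\<lambda>M. of_bool (det4 M = p \<and> act M x = y) * inde ((rT ^^ k) M))"
proof (induction k arbitrary: x)
  case 0
  then show ?case by (simp add: Iker_def)
next
  case (Suc k)
  have "Iker p ((vT ^^ Suc k) x) y = Iker p ((vT ^^ k) (vT x)) y" by (simp only: funpow_Suc_right comp_apply)
  also have "\<dots> = Sum_any (\<lambda>M. of_bool (det4 M = p \<and> act M (vT x) = y) * inde ((rT ^^ k) M))" by (rule Suc)
  also have "\<dots> = Sum_any (\<lambda>M. of_bool (det4 M = p \<and> act M x = y) * inde ((rT ^^ Suc k) M))"
    by (rule Sum_any_subst[OF bij_rT]) (simp only: act_ops det4_ops funpow_Suc_right comp_apply)
  finally show ?case .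
qed

text \<open>Along powers of T the numbers \<open>inde\<close> telescope to the change of
  \<open>lft\<close> over a full turn. Passing to \<open>lfc\<close> costs \<open>\<delta>\<close>
  and returns it, since T^5 preserves the condition on M. What remains are matrices taking infinity
  to infinity or to 0; S turns the latter into the former with opposite sign and with w in place of
  \<open>vS w\<close>.\<close>

lemma cusp_sum:
  assumes w: "w \<in> grid"
  shows "(\<Sum>k<5. Iker p ((vT ^^ k) x) (vS w)) = Kcusp p x (vS w) - Kcusp p x w"
proof -
  let ?r = "rT ^^ 5"
  define k where "k M = (of_bool (det4 M = p \<and> act M x = vS w) :: real)" for M
  define \<delta> where "\<delta> M = k M * (lft M - lfc M)" for M
  note pp = p_pos
  have kr: "k (?r M) = k M" for M by (simp add: k_def act_funpow_rT det4_funpow_rT)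
  have fin: "finite {M. k M * inde ((rT ^^ j) M) \<noteq> 0}" for j
    by (rule finite_subset[OF _ finite_support_bij[OF fin_inde[OF odd pp, of "\<lambda>_. True"] bij_funpow_rT[of j]]])
       (auto simp: k_def det4_funpow_rT)
  have start: "(\<Sum>j<5. Iker p ((vT ^^ j) x) (vS w)) = Sum_any (\<lambda>M. \<Sum>j<5. k M * inde ((rT ^^ j) M))"
    unfolding Iker_funpow_vT using Sum_any_sum[of "{..<5}" "\<lambda>j M. k M * inde ((rT ^^ j) M)"] fin
    by (simp add: k_def)
  have tel: "(\<Sum>j<5. k M * inde ((rT ^^ j) M)) = k M * (lft (?r M) - lft M)" for M
  proof -
    have "(\<Sum>j<5. inde ((rT ^^ j) M)) = (\<Sum>j<5. lft ((rT ^^ Suc j) M) - lft ((rT ^^ j) M))"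
      by (simp add: inde_rT)
    also have "\<dots> = lft (?r M) - lft M"
      by (subst sum_lessThan_telescope) simp
    finally show ?thesis by (simp add: sum_distrib_left[symmetric])
  qed
  have finL: "finite {M. k M * (lft (?r M) - lft M) \<noteq> 0}"
    using Sum_any_sum[of "{..<5}" "\<lambda>j M. k M * inde ((rT ^^ j) M)"] fin unfolding tel by simp
  have fd: "finite {M. \<delta> M \<noteq> 0}" using fin_delta[of "\<lambda>M. act M x = vS w"] by (simp add: \<delta>_def k_def)
  have fdr: "finite {M. (-1) * \<delta> (?r M) \<noteq> 0}"
    using finite_support_bij[OF fd bij_funpow_rT[of 5]] by simp
  have sdr: "Sum_any (\<lambda>M. \<delta> (?r M)) = Sum_any \<delta>" by (rule Sum_any_bij[OF bij_funpow_rT])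
  define g where "g M = k M * (lfc (?r M) - lfc M)" for M
  have g: "g M = k M * (lft (?r M) - lft M) + (\<delta> M + (-1) * \<delta> (?r M))" for M
    by (simp add: g_def \<delta>_def kr algebra_simps)
  have fg: "finite {M. g M \<noteq> 0}" unfolding g by (rule finite_support_add[OF finL finite_support_add[OF fd fdr]])
  have "Sum_any g = Sum_any (\<lambda>M. k M * (lft (?r M) - lft M)) + (Sum_any \<delta> + (-1) * Sum_any \<delta>)"
    unfolding g[abs_def] Sum_any.distrib[OF finL finite_support_add[OF fd fdr]] Sum_any.distrib[OF fd fdr]
      Sum_any_cmult sdr ..
  then have sg: "Sum_any (\<lambda>M. k M * (lft (?r M) - lft M)) = Sum_any g" by simp
  define g1 where "g1 M = of_bool (det4 M = p \<and> act M x = vS w \<and> upp M) * (lft (?r M) - lft M)" for M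
  define g2 where "g2 M = of_bool (det4 M = p \<and> act M x = vS w \<and> upp (lS M)) * (lft (?r M) - lft M)" for M
  have gs: "g M = g1 M + g2 M" for M
  proof (cases "det4 M = p")
    case True
    then have "det4 M \<noteq> 0" using pp by simp
    from cusp_split[OF this] show ?thesis
      using True by (cases "act M x = vS w") (simp_all add: g_def g1_def g2_def k_def)
  qed (simp add: g_def g1_def g2_def k_def)
  \<comment> \<open>As the supports are disjoint, both are finite because that of the sum
    is.\<close>
  have disj: "g1 M = 0 \<or> g2 M = 0" for M
    using pp by (cases M) (auto simp: g1_def g2_def)
  have f1: "finite {M. g1 M \<noteq> 0}" and f2: "finite {M. g2 M \<noteq> 0}"
    by (rule finite_subset[OF _ fg]; use disj gs in force)+
  have "Sum_any g2 = Sum_any (\<lambda>M. (-1) * (of_bool (det4 M = p \<and> act M x = w \<and> upp M) * (lft (?r M) - lft M)))"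
  proof (rule Sum_any_subst[OF bij_lS])
    fix M
    have "?r (lS M) = lS (?r M)" by (cases M) (simp add: funpow_rT)
    moreover have "upp (lS (lS M)) = upp M" by (cases M) simp
    ultimately show "g2 (lS M) = (-1) * (of_bool (det4 M = p \<and> act M x = w \<and> upp M) * (lft (?r M) - lft M))"
      using odd by (auto simp: g2_def act_ops vS_inj[OF act_grid w] lft_lS det4_funpow_rT)
  qed
  then have "Sum_any g2 = - Kcusp p x w" unfolding Sum_any_cmult Kcusp_def by simp
  moreover have "Sum_any g1 = Kcusp p x (vS w)" by (simp add: Kcusp_def g1_def[abs_def])
  ultimately have "Sum_any g = Kcusp p x (vS w) - Kcusp p x w"
    unfolding gs[abs_def] Sum_any.distrib[OF f1 f2] by simp
  then show ?thesis unfolding start tel sg .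
qed

text \<open>A full turn lowers \<open>sg\<close> of an upper triangular matrix by 10ad = 10p, so
  \<open>lft\<close> changes exactly when \<open>sg\<close> lies in the window from 0 to
  10p.\<close>

lemma Kcusp_card:
  "Kcusp p x y =
    real (card {b. 0 \<le> p + 2*b \<and> p + 2*b < 10*p \<and> act (p, b, 0, 1) x = y}) +
    real (card {b. 0 \<le> p + 2*b \<and> p + 2*b < 10*p \<and> act (- p, - b, 0, - 1) x = y}) +
    (real (card {b. 0 \<le> b \<and> b \<le> 4 \<and> act (1, b, 0, p) x = y}) +
     real (card {b. 0 \<le> b \<and> b \<le> 4 \<and> act (- 1, - b, 0, - p) x = y}))"
proof -
  define R where "R M \<longleftrightarrow> 0 \<le> sg M \<and> sg M < 10*p \<and> act M x = y" for M
  note pp = p_pos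
  have "sg (p, b, 0, 1) = p + 2*b" "sg (- p, - b, 0, - 1) = p + 2*b"
    "sg (1, b, 0, p) = p*(2*b + 1)" "sg (- 1, - b, 0, - p) = p*(2*b + 1)" for b
    by (simp_all add: algebra_simps)
  moreover have "p*(2*b + 1) < 10*p \<longleftrightarrow> b \<le> 4" "0 \<le> p*(2*b + 1) \<longleftrightarrow> 0 \<le> b" for b
  proof -
    have "p*(2*b + 1) < 10*p \<longleftrightarrow> p*(2*b + 1) < p*10" by (simp add: mult.commute)
    also have "\<dots> \<longleftrightarrow> 2*b + 1 < 10" using pp by (simp only: mult_less_cancel_left_pos)
    finally show "p*(2*b + 1) < 10*p \<longleftrightarrow> b \<le> 4" by auto
    have "0 \<le> p*(2*b + 1) \<longleftrightarrow> 0 \<le> 2*b + 1" using pp by (simp only: zero_le_mult_iff) auto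
    then show "0 \<le> p*(2*b + 1) \<longleftrightarrow> 0 \<le> b" by auto
  qed
  ultimately have cR: "R (p, b, 0, 1) \<longleftrightarrow> 0 \<le> p + 2*b \<and> p + 2*b < 10*p \<and> act (p, b, 0, 1) x = y"
    "R (- p, - b, 0, - 1) \<longleftrightarrow> 0 \<le> p + 2*b \<and> p + 2*b < 10*p \<and> act (- p, - b, 0, - 1) x = y"
    "R (1, b, 0, p) \<longleftrightarrow> 0 \<le> b \<and> b \<le> 4 \<and> act (1, b, 0, p) x = y"
    "R (- 1, - b, 0, - p) \<longleftrightarrow> 0 \<le> b \<and> b \<le> 4 \<and> act (- 1, - b, 0, - p) x = y" for b
    unfolding R_def by (simp_all only: simp_thms)
  have fw: "finite {b. 0 \<le> p + 2*b \<and> p + 2*b < 10*p \<and> Q b}" "finite {b::int. 0 \<le> b \<and> b \<le> 4 \<and> Q b}" for Q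
  proof -
    show "finite {b. 0 \<le> p + 2*b \<and> p + 2*b < 10*p \<and> Q b}"
      by (rule finite_subset[of _ "{- p..10*p}"]) (use pp in auto)
    show "finite {b::int. 0 \<le> b \<and> b \<le> 4 \<and> Q b}" by (rule finite_subset[of _ "{0..4}"]) auto
  qed
  have fin: "finite {M. det4 M = p \<and> upp M \<and> R M}" and
    card: "card {M. det4 M = p \<and> upp M \<and> R M} =
      card {b. R (p, b, 0, 1)} + card {b. R (- p, - b, 0, - 1)} +
      (card {b. R (1, b, 0, p)} + card {b. R (- 1, - b, 0, - p)})"
    by (rule upper_card[of R, unfolded cR, OF fw(1) fw(1) fw(2) fw(2)] |
        rule upper_card[of R, unfolded cR, OF fw(1) fw(1) fw(2) fw(2), folded cR])+
  have "of_bool (det4 M = p \<and> act M x = y \<and> upp M) * (lft ((rT ^^ 5) M) - lft M) = (of_bool (det4 M = p \<and> upp M \<and> R M) :: real)" for M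
  proof (cases "det4 M = p \<and> upp M")
    case True
    then obtain a b d where M: "M = (a, b, 0, d)" and ad: "a*d = p" by (cases M) auto
    have "sg ((rT ^^ 5) M) = sg M - 10*p" unfolding M funpow_rT using ad by (simp add: algebra_simps)
    then show ?thesis using True pp by (auto simp: lft_def R_def of_bool_def)
  qed auto
  then have "Kcusp p x y = real (card {M. det4 M = p \<and> upp M \<and> R M})"
    unfolding Kcusp_def using Sum_any_of_bool[OF fin] by simp
  then show ?thesis unfolding card cR by simp
qed

text \<open>As p is odd, b runs through 5p consecutive integers starting at (1 - p)/2.\<close>

lemma card_window:
  "0 \<le> r \<Longrightarrow> r < 5 \<Longrightarrow> card {b. 0 \<le> p + 2*b \<and> p + 2*b < 10*p \<and> b mod 5 = r} = nat p"
  "card {b. 0 \<le> p + 2*b \<and> p + 2*b < 10*p} = 5 * nat p"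
proof -
  define l where "l = (1 - p) div 2"
  have l: "2*l = 1 - p" using odd by (auto simp: l_def)
  have w: "0 \<le> p + 2*b \<and> p + 2*b < 10*p \<longleftrightarrow> l \<le> b \<and> b < l + 5 * int (nat p)" for b
    using l p_pos by auto
  show "card {b. 0 \<le> p + 2*b \<and> p + 2*b < 10*p \<and> b mod 5 = r} = nat p" if "0 \<le> r" "r < 5"
  proof -
    have "{b. 0 \<le> p + 2*b \<and> p + 2*b < 10*p \<and> b mod 5 = r} = {b. l \<le> b \<and> b < l + 5 * int (nat p) \<and> b mod 5 = r}"
      using w by blast
    then show ?thesis using card_residue_window[OF that, of l "nat p"] by (simp only: simp_thms)
  qed
  have "{b. l \<le> b \<and> b < l + 5 * int (nat p)} = {l..<l + 5 * int (nat p)}" by auto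
  then show "card {b. 0 \<le> p + 2*b \<and> p + 2*b < 10*p} = 5 * nat p" unfolding w using p_pos by (simp add: nat_mult_distrib)
qed

lemma Kcusp_infinity:
  "Kcusp p (s, 0) y = of_bool (((p*s) mod 5, 0) = y) * (5 * p) + of_bool (((- p*s) mod 5, 0) = y) * (5 * p)
    + (of_bool ((s mod 5, 0) = y) * 5 + of_bool (((- s) mod 5, 0) = y) * 5)"
proof -
  have act: "act (p, b, 0, 1) (s, 0) = ((p*s) mod 5, 0)" "act (- p, - b, 0, - 1) (s, 0) = ((- p*s) mod 5, 0)"
    "act (1, b, 0, p) (s, 0) = (s mod 5, 0)" "act (- 1, - b, 0, - p) (s, 0) = ((- s) mod 5, 0)" for b
    by simp_all
  have "{b. 0 \<le> b \<and> b \<le> 4} = {0..4::int}" by auto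
  then have "card {b. 0 \<le> b \<and> b \<le> (4::int)} = 5" by simp
  then have "real (card {b. 0 \<le> b \<and> b \<le> (4::int) \<and> Q}) = of_bool Q * 5" for Q by (cases Q) simp_all
  moreover have "real (card {b. 0 \<le> p + 2*b \<and> p + 2*b < 10*p \<and> Q}) = of_bool Q * (5 * p)" for Q
    using card_window(2) p_pos by (cases Q) simp_all
  ultimately show ?thesis unfolding Kcusp_card act by simp
qed

text \<open>On (0, 2) the first coordinate of the image determines b modulo 5, whereas on (s, 0) the
  image does not depend on b; hence p and 1 here against 5p and 5 there.\<close>

lemma Kcusp_zero:
  assumes "0 \<le> s" "s \<le> 4"
  shows "Kcusp p (0, 2) (s, t) = of_bool (t = 2) * p + of_bool (t = 3) * p
    + (of_bool (t = (2*p) mod 5) + of_bool (t = (- 2*p) mod 5))"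
proof -
  have act: "act (p, b, 0, 1) (0, 2) = (s, t) \<longleftrightarrow> t = 2 \<and> b mod 5 = (3*s) mod 5"
    "act (- p, - b, 0, - 1) (0, 2) = (s, t) \<longleftrightarrow> t = 3 \<and> b mod 5 = (2*s) mod 5"
    "act (1, b, 0, p) (0, 2) = (s, t) \<longleftrightarrow> t = (2*p) mod 5 \<and> b mod 5 = (3*s) mod 5"
    "act (- 1, - b, 0, - p) (0, 2) = (s, t) \<longleftrightarrow> t = (- 2*p) mod 5 \<and> b mod 5 = (2*s) mod 5" for b
  proof -
    have "- (b*2) = 3*b + 5*(- b)" by simp
    then have q2: "(- (b*2)) mod 5 = (3*b) mod 5" by (simp only: mod_mult_self2)
    note q = mod_5_inverse[OF assms, of b]
    have e: "act (p, b, 0, 1) (0, 2) = ((2*b) mod 5, 2)" "act (- p, - b, 0, - 1) (0, 2) = ((- (b*2)) mod 5, 3)"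
      "act (1, b, 0, p) (0, 2) = ((2*b) mod 5, (2*p) mod 5)" "act (- 1, - b, 0, - p) (0, 2) = ((- (b*2)) mod 5, (- 2*p) mod 5)"
      by (simp_all add: mult.commute)
    show "act (p, b, 0, 1) (0, 2) = (s, t) \<longleftrightarrow> t = 2 \<and> b mod 5 = (3*s) mod 5"
    "act (- p, - b, 0, - 1) (0, 2) = (s, t) \<longleftrightarrow> t = 3 \<and> b mod 5 = (2*s) mod 5"
    "act (1, b, 0, p) (0, 2) = (s, t) \<longleftrightarrow> t = (2*p) mod 5 \<and> b mod 5 = (3*s) mod 5"
    "act (- 1, - b, 0, - p) (0, 2) = (s, t) \<longleftrightarrow> t = (- 2*p) mod 5 \<and> b mod 5 = (2*s) mod 5"
      unfolding e prod.inject q2 q by blast+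
  qed
  have w: "card {b. 0 \<le> p + 2*b \<and> p + 2*b < 10*p \<and> Q \<and> b mod 5 = r mod 5} = of_bool Q * nat p" for Q r
    using card_window(1)[of "r mod 5"] by (cases Q) simp_all
  have v: "card {b. 0 \<le> b \<and> b \<le> 4 \<and> Q \<and> b mod 5 = r mod (5::int)} = of_bool Q" for Q r
  proof -
    have "{b. 0 \<le> b \<and> b \<le> 4 \<and> Q \<and> b mod 5 = r mod (5::int)} = (if Q then {r mod 5} else {})" by auto
    then show ?thesis by simp
  qed
  show ?thesis unfolding Kcusp_card act w v using p_pos by (simp add: of_bool_def)
qed

section \<open>Evaluation of the trace on the quotient graph\<close>

lemmas Fker_left =
  Fker_vU_left[OF odd p_pos, of "(0, 1)", simplified]
  Fker_vU_left[OF odd p_pos, of "(4, 0)", simplified]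
  Fker_vU_left[OF odd p_pos, of "(4, 4)", simplified]
  Fker_vU_left[OF odd p_pos, of "(0, 4)", simplified]
  Fker_vU_left[OF odd p_pos, of "(1, 0)", simplified]
  Fker_vU_left[OF odd p_pos, of "(1, 2)", simplified]
  Fker_vU_left[OF odd p_pos, of "(4, 1)", simplified]
  Fker_vU_left[OF odd p_pos, of "(3, 4)", simplified]
  Fker_vU_left[OF odd p_pos, of "(4, 3)", simplified]
  Fker_vU_left[OF odd p_pos, of "(1, 4)", simplified]
  Fker_vU_left[OF odd p_pos, of "(1, 3)", simplified]
  Fker_vU_left[OF odd p_pos, of "(3, 1)", simplified]
  Fker_vU_left[OF odd p_pos, of "(2, 3)", simplified]
  Fker_vU_left[OF odd p_pos, of "(4, 2)", simplified]
  Fker_vU_left[OF odd p_pos, of "(2, 4)", simplified]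
  Fker_vU_left[OF odd p_pos, of "(0, 2)", simplified]
  Fker_vU_left[OF odd p_pos, of "(3, 0)", simplified]
  Fker_vU_left[OF odd p_pos, of "(3, 3)", simplified]
  Fker_vU_left[OF odd p_pos, of "(0, 3)", simplified]
  Fker_vU_left[OF odd p_pos, of "(2, 0)", simplified]

lemmas Fker_right =
  Fker_vV_right[OF odd p_pos, of "(0, 1)", simplified]
  Fker_vV_right[OF odd p_pos, of "(1, 1)", simplified]
  Fker_vV_right[OF odd p_pos, of "(1, 0)", simplified]
  Fker_vV_right[OF odd p_pos, of "(0, 4)", simplified]
  Fker_vV_right[OF odd p_pos, of "(4, 4)", simplified]
  Fker_vV_right[OF odd p_pos, of "(1, 2)", simplified]
  Fker_vV_right[OF odd p_pos, of "(2, 1)", simplified]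
  Fker_vV_right[OF odd p_pos, of "(1, 4)", simplified]
  Fker_vV_right[OF odd p_pos, of "(4, 3)", simplified]
  Fker_vV_right[OF odd p_pos, of "(3, 4)", simplified]
  Fker_vV_right[OF odd p_pos, of "(1, 3)", simplified]
  Fker_vV_right[OF odd p_pos, of "(3, 2)", simplified]
  Fker_vV_right[OF odd p_pos, of "(2, 4)", simplified]
  Fker_vV_right[OF odd p_pos, of "(4, 2)", simplified]
  Fker_vV_right[OF odd p_pos, of "(2, 3)", simplified]
  Fker_vV_right[OF odd p_pos, of "(0, 2)", simplified]
  Fker_vV_right[OF odd p_pos, of "(2, 2)", simplified]
  Fker_vV_right[OF odd p_pos, of "(2, 0)", simplified]
  Fker_vV_right[OF odd p_pos, of "(0, 3)", simplified]
  Fker_vV_right[OF odd p_pos, of "(3, 3)", simplified]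

lemmas Iker_left =
  Iker_vS_left[OF odd p_pos, of "(0, 1)", simplified]
  Iker_vS_left[OF odd p_pos, of "(4, 0)", simplified]
  Iker_vS_left[OF odd p_pos, of "(0, 4)", simplified]
  Iker_vS_left[OF odd p_pos, of "(0, 2)", simplified]
  Iker_vS_left[OF odd p_pos, of "(3, 0)", simplified]
  Iker_vS_left[OF odd p_pos, of "(0, 3)", simplified]
  Iker_vS_left[OF odd p_pos, of "(1, 1)", simplified]
  Iker_vS_left[OF odd p_pos, of "(4, 1)", simplified]
  Iker_vS_left[OF odd p_pos, of "(4, 4)", simplified]
  Iker_vS_left[OF odd p_pos, of "(1, 2)", simplified]
  Iker_vS_left[OF odd p_pos, of "(3, 1)", simplified]
  Iker_vS_left[OF odd p_pos, of "(4, 3)", simplified]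
  Iker_vS_left[OF odd p_pos, of "(1, 3)", simplified]
  Iker_vS_left[OF odd p_pos, of "(2, 1)", simplified]
  Iker_vS_left[OF odd p_pos, of "(4, 2)", simplified]
  Iker_vS_left[OF odd p_pos, of "(2, 2)", simplified]
  Iker_vS_left[OF odd p_pos, of "(3, 2)", simplified]
  Iker_vS_left[OF odd p_pos, of "(3, 3)", simplified]

lemmas Iker_right =
  Iker_vS_right[OF odd p_pos, of "(0, 1)", simplified]
  Iker_vS_right[OF odd p_pos, of "(4, 0)", simplified]
  Iker_vS_right[OF odd p_pos, of "(0, 4)", simplified]
  Iker_vS_right[OF odd p_pos, of "(0, 2)", simplified]
  Iker_vS_right[OF odd p_pos, of "(3, 0)", simplified]
  Iker_vS_right[OF odd p_pos, of "(0, 3)", simplified]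
  Iker_vS_right[OF odd p_pos, of "(1, 1)", simplified]
  Iker_vS_right[OF odd p_pos, of "(4, 1)", simplified]
  Iker_vS_right[OF odd p_pos, of "(4, 4)", simplified]
  Iker_vS_right[OF odd p_pos, of "(1, 2)", simplified]
  Iker_vS_right[OF odd p_pos, of "(3, 1)", simplified]
  Iker_vS_right[OF odd p_pos, of "(4, 3)", simplified]
  Iker_vS_right[OF odd p_pos, of "(1, 3)", simplified]
  Iker_vS_right[OF odd p_pos, of "(2, 1)", simplified]
  Iker_vS_right[OF odd p_pos, of "(4, 2)", simplified]
  Iker_vS_right[OF odd p_pos, of "(2, 2)", simplified]
  Iker_vS_right[OF odd p_pos, of "(3, 2)", simplified]
  Iker_vS_right[OF odd p_pos, of "(3, 3)", simplified]

lemma Fker_zero: "\<not> 5 dvd p \<Longrightarrow> x \<in> grid \<Longrightarrow> x \<noteq> (0, 0) \<Longrightarrow> Fker p x (0, 0) = 0"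
proof -
  assume h: "\<not> 5 dvd p" "x \<in> grid" "x \<noteq> (0, 0)"
  have "of_bool (det4 M = p \<and> act M x = (0, 0)) * fixv M = 0" for M
    using act_eq_zero[of M p x] h by (cases "det4 M = p \<and> act M x = (0, 0)") auto
  then show ?thesis unfolding Fker_def by (simp only: Sum_any.neutral)
qed

text \<open>Each M carries x to exactly one y. So constants are an eigenvector of the vertex
  operator; orbits of U having length 6, its eigenvalue on vertices is p + 1.\<close>

lemma Fker_row_sum: "(\<Sum>y\<in>grid. Fker p x y) = 6 * (real_of_int p + 1)"
proof -
  have "(\<Sum>y\<in>grid. Fker p x y) = Sum_any (\<lambda>M. \<Sum>y\<in>grid. of_bool (det4 M = p \<and> act M x = y) * fixv M)"
    unfolding Fker_def using Sum_any_sum[of grid "\<lambda>y M. of_bool (det4 M = p \<and> act M x = y) * fixv M"]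
      fin_fixv[OF odd p_pos] by simp
  also have "\<dots> = Sum_any (\<lambda>M. of_bool (det4 M = p) * fixv M)"
  proof (rule Sum_any.cong)
    fix M
    have "(\<Sum>y\<in>grid. of_bool (det4 M = p \<and> act M x = y) * fixv M)
        = (\<Sum>y\<in>grid. if act M x = y then of_bool (det4 M = p) * fixv M else 0)"
      by (intro sum.cong) auto
    also have "\<dots> = of_bool (det4 M = p) * fixv M"
      using act_grid[of M x] by simp
    finally show "(\<Sum>y\<in>grid. of_bool (det4 M = p \<and> act M x = y) * fixv M) = of_bool (det4 M = p) * fixv M" .
  qed
  finally show ?thesis using total_fixv by simp
qed

text \<open>Vertices and edges of the quotient graph are the orbits of \<open>U\<close> and \<open>S\<close> on nonzero vectors modulo 5.
  There are four vertices, represented by \<open>(0, 1)\<close>, \<open>(1, 2)\<close>, \<open>(1, 3)\<close>, \<open>(0, 2)\<close>, and the edges \<open>(1, 1)\<close>, \<open>(1, 2)\<close>, \<open>(2, 2)\<close>, which form a spanning tree, together with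
  \<open>(0, 1)\<close>, \<open>(0, 2)\<close>, \<open>(1, 3)\<close>, each of which closes a loop that is homotopic to loops around cusps.\<close>

lemma trace_value:
  assumes "p mod 5 = 2 \<or> p mod 5 = 3 \<or> p mod 5 = 4"
  shows "(\<Sum>x\<in>grid - {(0, 0)}. Fker p x x / 3 - Iker p x x / 2) = (if p mod 5 = 4 then - 4 * (real_of_int p + 1) else 0)"
proof -
  have p5: "\<not> 5 dvd p" using assms by auto
  note rules = Fker_left Fker_right Iker_left Iker_right
  \<comment> \<open>Diagonal entries are constant on the orbits, which have length 6 for U and 4 for
    S; 6/3 and 4/2 both give the factor 2.\<close>
  have trace: "(\<Sum>x\<in>grid - {(0, 0)}. Fker p x x / 3 - Iker p x x / 2) =
     2 * (Fker p (0,1) (0,1) + Fker p (1,2) (1,2) + Fker p (1,3) (1,3) + Fker p (0,2) (0,2))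
     - 2 * (Iker p (0,1) (0,1) + Iker p (0,2) (0,2) + Iker p (1,1) (1,1) + Iker p (1,2) (1,2)
       + Iker p (1,3) (1,3) + Iker p (2,2) (2,2))"
    unfolding grid_nonzero by (simp add: rules)
  have "(\<Sum>y\<in>grid. Fker p (1,2) y) = Fker p (1,2) (0,0) + (\<Sum>y\<in>grid - {(0, 0)}. Fker p (1,2) y)"
    by (rule sum.remove) auto
  then have row: "Fker p (1,2) (0,1) + Fker p (1,2) (1,2) + Fker p (1,2) (1,3) + Fker p (1,2) (0,2) = real_of_int p + 1"
    using Fker_row_sum[of "(1,2)"] Fker_zero[OF p5, of "(1,2)"] unfolding grid_nonzero by (simp add: rules)
  note bd = Iker_boundary[OF odd p_pos]
  have e11: "Iker p (1,1) y + Iker p (1,1) (vV y) + Iker p (1,1) (vV (vV y)) = Fker p (1,1) y - Fker p (1,4) y"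
    and e12: "Iker p (1,2) y + Iker p (1,2) (vV y) + Iker p (1,2) (vV (vV y)) = Fker p (1,2) y - Fker p (2,4) y"
    and e22: "Iker p (2,2) y + Iker p (2,2) (vV y) + Iker p (2,2) (vV (vV y)) = Fker p (2,2) y - Fker p (2,3) y"
    if "y \<in> grid" for y
    using bd[OF that, of "(1,4)"] bd[OF that, of "(2,4)"] bd[OF that, of "(2,3)"] by simp_all
  note cs = cusp_sum
  \<comment> \<open>T fixes (1, 0) and (2, 0), so in \<open>c1\<close>, \<open>c2\<close> and
    \<open>c3\<close> the five terms of the cusp sum coincide.\<close>
  have c1: "5 * Iker p (1,0) (0,1) = Kcusp p (1,0) (0,1) - Kcusp p (1,0) (1,0)"
    using cs[of "(1,0)" "(1,0)"] by (simp add: eval_nat_numeral)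
  have c2: "5 * Iker p (2,0) (0,2) = Kcusp p (2,0) (0,2) - Kcusp p (2,0) (2,0)"
    using cs[of "(2,0)" "(2,0)"] by (simp add: eval_nat_numeral)
  have c3: "5 * Iker p (2,0) (1,3) = Kcusp p (2,0) (1,3) - Kcusp p (2,0) (3,4)"
    using cs[of "(3,4)" "(2,0)"] by (simp add: eval_nat_numeral)
  \<comment> \<open>The vectors (2, 2) and (3, 2) are the two orientations of one edge and cancel,
    and (4, 2) is the edge (1, 3). With \<open>c3\<close> this closes the last loop.\<close>
  have c4: "Iker p (0,2) (1,3) + Iker p (2,2) (1,3) + Iker p (4,2) (1,3) + Iker p (1,2) (1,3) + Iker p (3,2) (1,3)
      = Kcusp p (0,2) (1,3) - Kcusp p (0,2) (3,4)"
    using cs[of "(3,4)" "(0,2)"] by (simp add: eval_nat_numeral)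
  \<comment> \<open>The boundary relations of the three tree edges at the four vertices, the row sum
    and the four cusp relations form a linear system that determines the trace.\<close>
  note E =
    e11[of "(0, 1)", simplified, simplified rules]
    e11[of "(1, 2)", simplified, simplified rules]
    e11[of "(1, 3)", simplified, simplified rules]
    e11[of "(0, 2)", simplified, simplified rules]
    e12[of "(0, 1)", simplified, simplified rules]
    e12[of "(1, 2)", simplified, simplified rules]
    e12[of "(1, 3)", simplified, simplified rules]
    e12[of "(0, 2)", simplified, simplified rules]
    e22[of "(0, 1)", simplified, simplified rules]
    e22[of "(1, 2)", simplified, simplified rules]
    e22[of "(1, 3)", simplified, simplified rules]
    e22[of "(0, 2)", simplified, simplified rules]
  note cE = c1[simplified rules] c2[simplified rules] c3[simplified rules] c4[simplified rules]
  note K = Kcusp_infinity Kcusp_zero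
  from assms show ?thesis
  proof (elim disjE)
    assume q: "p mod 5 = 2"
    note r = residues_mod_5[OF q, simplified]
    have k: "Kcusp p (1,0) (0,1) = 0" "Kcusp p (1,0) (1,0) = 5" "Kcusp p (2,0) (0,2) = 0"
      "Kcusp p (2,0) (2,0) = 5" "Kcusp p (2,0) (1,3) = 0" "Kcusp p (2,0) (3,4) = 0"
      "Kcusp p (0,2) (1,3) = real_of_int p" "Kcusp p (0,2) (3,4) = 1"
      by (simp_all add: K q r)
    have "p mod 5 \<noteq> 4" using q by simp
    then show ?thesis using E row cE k unfolding trace by simp
  next
    assume q: "p mod 5 = 3"
    note r = residues_mod_5[OF q, simplified]
    have k: "Kcusp p (1,0) (0,1) = 0" "Kcusp p (1,0) (1,0) = 5" "Kcusp p (2,0) (0,2) = 0"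
      "Kcusp p (2,0) (2,0) = 5" "Kcusp p (2,0) (1,3) = 0" "Kcusp p (2,0) (3,4) = 0"
      "Kcusp p (0,2) (1,3) = real_of_int p" "Kcusp p (0,2) (3,4) = 1"
      by (simp_all add: K q r)
    have "p mod 5 \<noteq> 4" using q by simp
    then show ?thesis using E row cE k unfolding trace by simp
  next
    assume q: "p mod 5 = 4"
    note r = residues_mod_5[OF q, simplified]
    have k: "Kcusp p (1,0) (0,1) = 0" "Kcusp p (1,0) (1,0) = 5 + 5 * real_of_int p" "Kcusp p (2,0) (0,2) = 0"
      "Kcusp p (2,0) (2,0) = 5 + 5 * real_of_int p" "Kcusp p (2,0) (1,3) = 0" "Kcusp p (2,0) (3,4) = 0"
      "Kcusp p (0,2) (1,3) = real_of_int p + 1" "Kcusp p (0,2) (3,4) = 0"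
      by (simp_all add: K q r)
    have "p mod 5 = 4" using q by simp
    then show ?thesis using E row cE k unfolding trace by simp
  qed
qed

section \<open>From the trace to class numbers\<close>

lemma lnum_small: "t^2 < 4*p \<Longrightarrow> lnum p t = 2 * hurwitz (4*p - t^2)"
  using lnum_elliptic[OF odd p_pos, of "\<bar>t\<bar>"] by (subst lnum_abs) simp

text \<open>The parabolic case t^2 = 4p would make p a square; thus H(0) never enters.\<close>

lemma lnum_zero: "\<not> t^2 < 4*p \<Longrightarrow> \<bar>t\<bar> \<noteq> p + 1 \<Longrightarrow> lnum p t = 0"
proof -
  assume t: "\<not> t^2 < 4*p" "\<bar>t\<bar> \<noteq> p + 1"
  have "t^2 \<noteq> 4*p"
  proof
    assume e: "t^2 = 4*p"
    then have "even (t^2)" by simp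
    then have "even t" by simp
    then obtain s where "t = 2*s" by blast
    then have "s^2 = p" using e by (simp add: power2_eq_square)
    then show False using prime prime_power_iff[of s 2] by simp
  qed
  then have "4*p < \<bar>t\<bar>^2" using t by simp
  then show ?thesis using lnum_hyperbolic[OF prime odd, of "\<bar>t\<bar>"] t(2) lnum_abs[of p t] by simp
qed

text \<open>Interchanging the sums counts each matrix once per fixed vector, that is 4 times or not
  at all. \<open>V\<close> collects the traces that contribute, enlarged by those that are evaluated
  later, to keep the sum finite.\<close>

lemma trace_lnum:
  assumes "p mod 5 = 2 \<or> p mod 5 = 3 \<or> p mod 5 = 4"
  shows "\<exists>V. finite V \<and> {t. t^2 < 4*p} \<union> {p + 1, - (p + 1)} \<subseteq> V \<and>
    (\<Sum>x\<in>grid - {(0, 0)}. Fker p x x / 3 - Iker p x x / 2) =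
    4 * (\<Sum>t\<in>{t \<in> V. t mod 5 = (p + 1) mod 5}. lnum p t)"
proof -
  define L where "L M = fixv M / 3 - inde M / 2" for M
  have fL: "finite {M. of_bool (det4 M = p \<and> P M) * L M \<noteq> 0}" for P
    unfolding L_def by (rule finite_support_L[OF odd p_pos])
  define S where "S = {M. of_bool (det4 M = p) * L M \<noteq> 0}"
  have fS: "finite S" using fL[of "\<lambda>_. True"] by (simp add: S_def)
  define V where "V = tr4 ` S \<union> ({t. t^2 < 4*p} \<union> {p + 1, - (p + 1)})"
  have fV: "finite V" using fS finite_square_less by (simp add: V_def)
  define V' where "V' = {t \<in> V. t mod 5 = (p + 1) mod 5}"
  have fV': "finite V'" using fV by (simp add: V'_def)
  have one: "Fker p x x / 3 - Iker p x x / 2 = Sum_any (\<lambda>M. of_bool (det4 M = p \<and> act M x = x) * L M)" for x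
  proof -
    have f1: "finite {M. (1/3) * (of_bool (det4 M = p \<and> act M x = x) * fixv M) \<noteq> 0}"
      by (rule finite_support_cmult[OF fin_fixv[OF odd p_pos]])
    have f2: "finite {M. (-1/2) * (of_bool (det4 M = p \<and> act M x = x) * inde M) \<noteq> 0}"
      by (rule finite_support_cmult[OF fin_inde[OF odd p_pos]])
    have "of_bool (det4 M = p \<and> act M x = x) * L M = (1/3) * (of_bool (det4 M = p \<and> act M x = x) * fixv M)
        + (-1/2) * (of_bool (det4 M = p \<and> act M x = x) * inde M)" for M
      by (simp add: L_def field_simps)
    then show ?thesis
      using Sum_any.distrib[OF f1 f2] unfolding Sum_any_cmult Fker_def Iker_def by simp
  qed
  have "(\<Sum>x\<in>grid - {(0, 0)}. Fker p x x / 3 - Iker p x x / 2) =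
    Sum_any (\<lambda>M. \<Sum>x\<in>grid - {(0, 0)}. of_bool (det4 M = p \<and> act M x = x) * L M)"
    unfolding one using Sum_any_sum[of "grid - {(0, 0)}" "\<lambda>x M. of_bool (det4 M = p \<and> act M x = x) * L M"] fL by simp
  also have "\<dots> = Sum_any (\<lambda>M. 4 * (\<Sum>t\<in>V'. of_bool (det4 M = p \<and> tr4 M = t) * L M))"
  proof (rule Sum_any.cong)
    fix M
    show "(\<Sum>x\<in>grid - {(0, 0)}. of_bool (det4 M = p \<and> act M x = x) * L M)
        = 4 * (\<Sum>t\<in>V'. of_bool (det4 M = p \<and> tr4 M = t) * L M)"
    proof (cases "det4 M = p \<and> L M \<noteq> 0")
      case False
      then have "of_bool (det4 M = p \<and> Q) * L M = 0" for Q by auto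
      then show ?thesis by (simp only: sum.neutral_const mult_zero_right)
    next
      case True
      then have "tr4 M \<in> V" by (auto simp: V_def S_def)
      then have tV: "tr4 M \<in> V' \<longleftrightarrow> tr4 M mod 5 = (p + 1) mod 5" by (simp add: V'_def)
      have "(\<Sum>x\<in>grid - {(0, 0)}. of_bool (det4 M = p \<and> act M x = x) * L M)
          = real (card {x \<in> grid - {(0, 0)}. act M x = x}) * L M"
      proof -
        have "(\<Sum>x\<in>grid - {(0, 0)}. of_bool (det4 M = p \<and> act M x = x) * L M)
          = (\<Sum>x\<in>grid - {(0, 0)}. if act M x = x then L M else 0)"
          using True by (intro sum.cong) auto
        also have "\<dots> = (\<Sum>x\<in>{x \<in> grid - {(0, 0)}. act M x = x}. L M)"
          by (rule sum.inter_filter[symmetric]) simp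
        finally show ?thesis by simp
      qed
      also have "\<dots> = 4 * (of_bool (tr4 M \<in> V') * L M)"
        using card_fixed[of M p] True assms tV by simp
      also have "of_bool (tr4 M \<in> V') * L M = (\<Sum>t\<in>V'. if tr4 M = t then L M else 0)"
        using fV' by simp
      also have "\<dots> = (\<Sum>t\<in>V'. of_bool (det4 M = p \<and> tr4 M = t) * L M)"
        using True by (intro sum.cong) auto
      finally show ?thesis .
    qed
  qed
  also have "\<dots> = 4 * (\<Sum>t\<in>V'. lnum p t)"
    unfolding Sum_any_cmult
    using Sum_any_sum[OF fV', of "\<lambda>t M. of_bool (det4 M = p \<and> tr4 M = t) * L M"] fL
    by (simp add: lnum_def L_def)
  finally show ?thesis using fV unfolding V'_def by (intro exI[of _ V]) (auto simp: V_def)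
qed

text \<open>With S the class number sum and k the number of traces among p + 1 and -(p + 1) in the
  residue class, the trace is 4(2S - k(p - 1)). Its value is 0 with k = 1, or -4(p + 1) with k =
  2.\<close>

lemma hurwitz_sum_odd:
  assumes "p mod 5 = 2 \<or> p mod 5 = 3 \<or> p mod 5 = 4"
  shows "(\<Sum>t\<in>{t. t^2 < 4*p \<and> t mod 5 = (p + 1) mod 5}. hurwitz (4*p - t^2)) =
    (if p mod 5 = 4 then (real_of_int p - 3) / 2 else (real_of_int p - 1) / 2)"
proof -
  obtain V where V: "finite V" "{t. t^2 < 4*p} \<union> {p + 1, - (p + 1)} \<subseteq> V"
    and tr: "(\<Sum>x\<in>grid - {(0, 0)}. Fker p x x / 3 - Iker p x x / 2) =
      4 * (\<Sum>t\<in>{t \<in> V. t mod 5 = (p + 1) mod 5}. lnum p t)"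
    using trace_lnum[OF assms] by blast
  define A where "A = {t. t^2 < 4*p \<and> t mod 5 = (p + 1) mod 5}"
  define B where "B = {t \<in> {p + 1, - (p + 1)}. t mod 5 = (p + 1) mod 5}"
  have p2: "2 < p" by (rule p_gt)
  have fA: "finite A" unfolding A_def by (rule finite_subset[OF _ finite_square_less]) auto
  have "(p + 1)^2 = 4*p + (p - 1)^2" by (simp add: power2_eq_square algebra_simps)
  moreover have "0 < (p - 1)^2" using p2 by simp
  ultimately have big: "4*p < (p + 1)^2" by linarith
  have disj: "A \<inter> B = {}"
  proof -
    have "(- (p + 1))^2 = (p + 1)^2" by (rule power2_minus)
    then show ?thesis using big by (auto simp: A_def B_def simp del: power2_minus minus_add_distrib)
  qed
  have "(\<Sum>t\<in>{t \<in> V. t mod 5 = (p + 1) mod 5}. lnum p t) = (\<Sum>t\<in>A \<union> B. lnum p t)"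
  proof (rule sum.mono_neutral_right)
    show "A \<union> B \<subseteq> {t \<in> V. t mod 5 = (p + 1) mod 5}" using V(2) by (auto simp: A_def B_def)
    show "\<forall>t\<in>{t \<in> V. t mod 5 = (p + 1) mod 5} - (A \<union> B). lnum p t = 0"
    proof
      fix t assume "t \<in> {t \<in> V. t mod 5 = (p + 1) mod 5} - (A \<union> B)"
      then have "\<not> t^2 < 4*p" "t \<noteq> p + 1" "t \<noteq> - (p + 1)" by (auto simp: A_def B_def)
      then show "lnum p t = 0" using lnum_zero[of t] by (simp add: abs_if split: if_splits)
    qed
  qed (use V in simp)
  also have "\<dots> = (\<Sum>t\<in>A. lnum p t) + (\<Sum>t\<in>B. lnum p t)"
    by (rule sum.union_disjoint[OF fA _ disj]) (simp add: B_def)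
  also have "(\<Sum>t\<in>A. lnum p t) = 2 * (\<Sum>t\<in>A. hurwitz (4*p - t^2))"
    unfolding sum_distrib_left by (rule sum.cong) (auto simp: A_def lnum_small)
  also have "(\<Sum>t\<in>B. lnum p t) = real (card B) * (- (real_of_int p - 1))"
  proof -
    have "lnum p t = - (real_of_int p - 1)" if "t \<in> B" for t
      using that lnum_split[OF prime odd] lnum_neg[of p "p + 1"] by (auto simp: B_def)
    then show ?thesis by simp
  qed
  finally have main: "(if p mod 5 = 4 then - 4 * (real_of_int p + 1) else 0)
     = 4 * (2 * (\<Sum>t\<in>A. hurwitz (4*p - t^2)) + real (card B) * (- (real_of_int p - 1)))"
    using tr trace_value[OF assms] by simp
  have r1: "(p + 1) mod 5 = (p mod 5 + 1) mod 5" by (simp only: mod_add_left_eq)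
  have r2: "(- (p + 1)) mod 5 = (- ((p + 1) mod 5)) mod 5" by (simp only: mod_minus_eq)
  have "card B = (if p mod 5 = 4 then 2 else 1)"
  proof (cases "p mod 5 = 4")
    case True
    then have "(p + 1) mod 5 = 0" "(- (p + 1)) mod 5 = 0" unfolding r2 r1 by simp_all
    then have "(- (p + 1)) mod 5 = (p + 1) mod 5" by simp
    then have "B = {p + 1, - (p + 1)}" by (auto simp: B_def)
    then show ?thesis using True p2 by simp
  next
    case False
    then have "p mod 5 = 2 \<or> p mod 5 = 3" using assms by blast
    then have "(- (p + 1)) mod 5 \<noteq> (p + 1) mod 5" unfolding r2 r1 by (elim disjE) simp_all
    then have "B = {p + 1}" by (auto simp: B_def)
    then show ?thesis using False by simp
  qed
  note card = this
  define S where "S = (\<Sum>t\<in>A. hurwitz (4*p - t^2))"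
  note main' = main[folded S_def]
  have "S = (if p mod 5 = 4 then (real_of_int p - 3) / 2 else (real_of_int p - 1) / 2)"
  proof (cases "p mod 5 = 4")
    case True
    then show ?thesis using main' card by simp
  next
    case False
    then show ?thesis using main' card by simp
  qed
  then show ?thesis by (simp only: S_def A_def)
qed

end

theorem theorem4:
  fixes p :: nat and c :: int
  assumes "prime p"
  shows "(([c = int p + 1] (mod 5) \<or> [c = - (int p + 1)] (mod 5)) \<and>
           ([int p = 2] (mod 5) \<or> [int p = - 2] (mod 5)) \<longrightarrow>
           (\<Sum>r\<in>{r::int. real_of_int \<bar>r\<bar> < 2 * sqrt (real p) \<and> [r = c] (mod 5)}.
              hurwitz (4 * int p - r^2)) = (real p - 1) / 2)
       \<and> ([c = 0] (mod 5) \<and> [int p = 4] (mod 5) \<longrightarrow>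
           (\<Sum>r\<in>{r::int. real_of_int \<bar>r\<bar> < 2 * sqrt (real p) \<and> [r = c] (mod 5)}.
              hurwitz (4 * int p - r^2)) = (real p - 3) / 2)"
proof -
  let ?T = "\<lambda>c. \<Sum>r\<in>{r. r^2 < 4 * int p \<and> r mod 5 = c mod 5}. hurwitz (4 * int p - r^2)"
  have sum_eq: "(\<Sum>r\<in>{r::int. real_of_int \<bar>r\<bar> < 2 * sqrt (real p) \<and> [r = c] (mod 5)}.
      hurwitz (4 * int p - r^2)) = ?T c" for c
    unfolding abs_less_2_sqrt_iff cong_def ..
  have sym: "?T (- c) = ?T c" for c
  proof (rule sum.reindex_bij_witness[of _ uminus uminus])
    have *: "(- r) mod 5 = c mod 5" if "r mod 5 = (- c) mod 5" for r c :: int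
      using that by (metis mod_minus_cong minus_minus)
    show "- r \<in> {r. r^2 < 4 * int p \<and> r mod 5 = (- c) mod 5}" if "r \<in> {r. r^2 < 4 * int p \<and> r mod 5 = c mod 5}" for r
      using that *[of r "- c"] by simp
    show "- r \<in> {r. r^2 < 4 * int p \<and> r mod 5 = c mod 5}" if "r \<in> {r. r^2 < 4 * int p \<and> r mod 5 = (- c) mod 5}" for r
      using that *[of r c] by simp
  qed auto
  have main: "?T (int p + 1) = (if int p mod 5 = 4 then (real p - 3) / 2 else (real p - 1) / 2)"
    if "int p mod 5 = 2 \<or> int p mod 5 = 3 \<or> int p mod 5 = 4"
  proof (cases "odd p")
    case True
    then show ?thesis using hurwitz_sum_odd[of "int p"] assms that by simp
  next
    \<comment> \<open>For even determinant \<open>sg\<close> may vanish, so p = 2 is computed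
      directly: the class of 3 leaves only r = -2, and H(4) = 1/2.\<close>
    case False
    then have p: "p = 2" using assms primes_dvd_imp_eq two_is_prime_nat by blast
    have "r^2 < 8 \<and> r mod 5 = 3 \<longleftrightarrow> r = - 2" for r :: int
    proof
      assume h: "r^2 < 8 \<and> r mod 5 = 3"
      then have "r^2 < 3^2" by simp
      then have "\<bar>r\<bar> < 3" by (metis abs_numeral power2_abs power2_less_imp_less abs_ge_zero zero_le_numeral)
      then have "r = -2 \<or> r = -1 \<or> r = 0 \<or> r = 1 \<or> r = 2" by auto
      then show "r = - 2" using h by auto
    qed auto
    then have "{r::int. r^2 < 8 \<and> r mod 5 = 3} = {- 2}" by simp
    then show ?thesis by (simp add: p hurwitz_4)
  qed
  show ?thesis
  proof (intro conjI impI; elim conjE; unfold sum_eq)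
    assume c: "[c = int p + 1] (mod 5) \<or> [c = - (int p + 1)] (mod 5)"
      and p: "[int p = 2] (mod 5) \<or> [int p = - 2] (mod 5)"
    have q: "int p mod 5 = 2 \<or> int p mod 5 = 3" using p by (auto simp: cong_def)
    have "?T c = ?T (int p + 1) \<or> ?T c = ?T (- (int p + 1))"
      using c unfolding cong_def by (elim disjE) (simp_all only: simp_thms)
    then have "?T c = ?T (int p + 1)" unfolding sym by (simp only: simp_thms)
    then show "?T c = (real p - 1) / 2" using main q by auto
  next
    assume c: "[c = 0] (mod 5)" and p: "[int p = 4] (mod 5)"
    have q: "int p mod 5 = 4" using p by (simp add: cong_def)
    then have "(int p + 1) mod 5 = c mod 5" using c unfolding cong_def by presburger
    then have "?T c = ?T (int p + 1)" by simp
    then show "?T c = (real p - 3) / 2" using main q by simp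
  qed
qed

end
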